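(* Let $\mathbf{\Psi}=\{\Psi_t\}_{t\geq0}$ be a dynamical quantum stochastic system with respect to the Hilbert space $\mathcal{H}$, let $\psi$ denote its infinitesimal generator, let $\psi^\sharp$ denote the $w^*$-infinitesimal generator of the dual semigroup $\{\Psi_t^\sharp\}_{t\ge0}$, and let $A\in\mathcal{B}(\mathcal{H})$. The following assertions are equivalent: (i) $[L_A,\Psi_t]=0$ for all $t\geq0$. (ii) $A$ and $A^*A$ are constants of $\mathbf{\Psi}$. (iii) $[R_A,\Psi_t^\sharp]=0$ for all $t\geq0$. (iv) $A$ and $A^*A$ are joint fixed points of $\Psi_t^\sharp$ for all $t\geq0$. (v) $[L_A,\psi]=0$, that is, $L_A$ leaves $\operatorname{Dom}(\psi)$ invariant and $A\psi(T)=\psi(AT)$ for all $T\in\operatorname{Dom}(\psi)$. (vi) $A,A^*A\in\ker(\psi^\sharp)$, that is, $A,A^*A\in\operatorname{Dom}(\psi^\sharp)$ and $\psi^\sharp(A)=\psi^\sharp(A^*A)=0$.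
   Context: $\mathcal{B}(\mathcal{H})$ is the algebra of bounded operators on $\mathcal{H}$ and $\mathcal{B}_1(\mathcal{H})$ the trace class with trace norm; $\mathcal{B}(\mathcal{H})$ is the dual of $\mathcal{B}_1(\mathcal{H})$ via $\langle T,S\rangle=\operatorname{tr}(TS)$. A quantum operation is a completely positive, trace-preserving linear map on $\mathcal{B}_1(\mathcal{H})$. A dynamical quantum (stochastic) system is a strongly continuous semigroup $\{\Psi_t\}_{t\ge0}$ of quantum operations on $\mathcal{B}_1(\mathcal{H})$ ($\Psi_s\Psi_t=\Psi_{s+t}$, $\Psi_0=I$, $t\mapsto\Psi_t(T)$ trace-norm continuous on $[0,\infty)$ for each $T$). Its infinitesimal generator is $\psi(T)=\lim_{t\to0+}(\Psi_t(T)-T)/t$ with domain $\operatorname{Dom}(\psi)$ all $T\in\mathcal{B}_1(\mathcal{H})$ for which the limit exists. $\Psi_t^\sharp$ on $\mathcal{B}(\mathcal{H})$ is given by $\operatorname{tr}(\Psi_t(T)S)=\operatorname{tr}(T\Psi_t^\sharp(S))$, and $\psi^\sharp(S)=w^*\text{-}\lim_{t\to0+}(\Psi_t^\sharp(S)-S)/t$ with domain $\operatorname{Dom}(\psi^\sharp)$ all $S\in\mathcal{B}(\mathcal{H})$ for which the $w^*$-limit exists. $L_A(T)=AT$, $R_A(T)=TA$, on $\mathcal{B}_1(\mathcal{H})$ or $\mathcal{B}(\mathcal{H})$ according to context, and $[\Phi,\Psi]=\Phi\Psi-\Psi\Phi$. An operator $B\in\mathcal{B}(\mathcal{H})$ is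 a constant of $\mathbf{\Psi}$ if for every density operator $\rho$ (positive trace-class operator of trace $1$) $\operatorname{tr}(\Psi_t(\rho)B)$ does not depend on $t\ge0$. *)

theory Defs
  imports "HOL-Analysis.Analysis"
begin

section \<open>Complex Hilbert spaces\<close>

class complex_vector = real_vector +
  fixes scaleC :: "complex \<Rightarrow> 'a \<Rightarrow> 'a"  (infixr \<open>*\<^sub>C\<close> 75)
  assumes scaleC_add_right: "c *\<^sub>C (x + y) = c *\<^sub>C x + c *\<^sub>C y"
    and scaleC_add_left: "(c + d) *\<^sub>C x = c *\<^sub>C x + d *\<^sub>C x"
    and scaleC_scaleC: "c *\<^sub>C d *\<^sub>C x = (c * d) *\<^sub>C x"
    and scaleR_eq_scaleC: "r *\<^sub>R x = complex_of_real r *\<^sub>C x"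

text \<open>
  The underlying real Hilbert space is part of the structure, its inner product being the real
  part of the complex one; positive definiteness and the norm are inherited from it.
  The inner product is conjugate-linear in its first argument.
\<close>

class complex_hilbert = complex_vector + real_inner + banach +
  fixes cinner :: "'a \<Rightarrow> 'a \<Rightarrow> complex"
  assumes cinner_commute: "cinner x y = cnj (cinner y x)"
    and cinner_add_right: "cinner x (y + z) = cinner x y + cinner x z"
    and cinner_scaleC_right: "cinner x (c *\<^sub>C y) = c * cinner x y"
    and inner_eq_Re_cinner: "x \<bullet> y = Re (cinner x y)"

lemma norm_scaleC: "norm (c *\<^sub>C x) = cmod c * norm (x::'a::complex_hilbert)"
proof -
  have "cinner (c *\<^sub>C x) (c *\<^sub>C x) = c * cnj (c * cinner x x)"
    by (metis cinner_commute cinner_scaleC_right)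
  also have "\<dots> = complex_of_real ((cmod c)\<^sup>2) * cinner x x"
    using cinner_commute[of x x] by (simp add: complex_norm_square del: of_real_power)
  finally have "Re (cinner (c *\<^sub>C x) (c *\<^sub>C x)) = (cmod c)\<^sup>2 * Re (cinner x x)"
    by simp
  then have "(norm (c *\<^sub>C x))\<^sup>2 = (cmod c * norm x)\<^sup>2"
    by (simp add: power2_norm_eq_inner inner_eq_Re_cinner power_mult_distrib)
  then show ?thesis
    by simp
qed

lemma bounded_linear_scaleC: "bounded_linear (\<lambda>x::'a::complex_hilbert. c *\<^sub>C x)"
  by (rule bounded_linear_intro[where K = "cmod c"])
    (simp_all add: scaleC_add_right norm_scaleC scaleR_eq_scaleC scaleC_scaleC mult.commute)

definition is_onb :: "'a::complex_hilbert set \<Rightarrow> bool" where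
  "is_onb E \<longleftrightarrow> (\<forall>e\<in>E. norm e = 1) \<and> (\<forall>e\<in>E. \<forall>f\<in>E. e \<noteq> f \<longrightarrow> cinner e f = 0)
     \<and> (\<forall>x. (\<forall>e\<in>E. cinner e x = 0) \<longrightarrow> x = 0)"

definition some_onb :: "'a::complex_hilbert set" where
  "some_onb = (SOME E. is_onb E)"


section \<open>Bounded operators\<close>

text \<open>
  The library type \<open>'a \<Rightarrow>\<^sub>L 'a\<close> consists of the bounded \<^emph>\<open>real\<close>-linear maps; the algebra of
  bounded operators of the complex Hilbert space is the following subset of it.
\<close>

type_synonym 'a op = "'a \<Rightarrow>\<^sub>L 'a"

definition bounded_ops :: "'a::complex_hilbert op set" where
  "bounded_ops = {T :: 'a op. \<forall>c x. T (c *\<^sub>C x) = c *\<^sub>C T x}"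

instantiation blinfun :: (real_normed_vector, complex_hilbert) complex_vector
begin

lift_definition scaleC_blinfun :: "complex \<Rightarrow> 'a \<Rightarrow>\<^sub>L 'b \<Rightarrow> 'a \<Rightarrow>\<^sub>L 'b"
  is "\<lambda>c f x. c *\<^sub>C f x"
  by (rule bounded_linear_compose[OF bounded_linear_scaleC])

instance
  by standard
    (transfer, simp add: fun_eq_iff scaleC_add_right scaleC_add_left scaleC_scaleC
      scaleR_eq_scaleC)+

end

definition adj :: "'a::complex_hilbert op \<Rightarrow> 'a op" where
  "adj T = (THE S. S \<in> bounded_ops \<and> (\<forall>x y. cinner (S x) y = cinner x (T y)))"

definition positive_op :: "'a::complex_hilbert op \<Rightarrow> bool" where
  "positive_op P \<longleftrightarrow> P \<in> bounded_ops \<and> (\<forall>x. cinner x (P x) \<in> \<real>\<^sub>\<ge>\<^sub>0)"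

definition abs_op :: "'a::complex_hilbert op \<Rightarrow> 'a op" where
  "abs_op T = (THE P. positive_op P \<and> P o\<^sub>L P = adj T o\<^sub>L T)"


section \<open>Trace class\<close>

text \<open>
  Neither the summability of the diagonal of a positive operator nor the trace of a trace class
  operator depends on the orthonormal basis.
\<close>

definition tr :: "'a::complex_hilbert op \<Rightarrow> complex" where
  "tr T = (\<Sum>\<^sub>\<infinity>e\<in>some_onb. cinner e (T e))"

definition trace_class :: "'a::complex_hilbert op set" where
  "trace_class = {T \<in> bounded_ops.
     \<exists>E. is_onb E \<and> (\<lambda>e. cinner e (abs_op T e)) summable_on E}"

definition trace_norm :: "'a::complex_hilbert op \<Rightarrow> real" where
  "trace_norm T = Re (tr (abs_op T))"

definition density_op :: "'a::complex_hilbert op \<Rightarrow> bool" where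
  "density_op \<rho> \<longleftrightarrow> positive_op \<rho> \<and> \<rho> \<in> trace_class \<and> tr \<rho> = 1"

definition trace_norm_tendsto ::
    "('b \<Rightarrow> 'a::complex_hilbert op) \<Rightarrow> 'a op \<Rightarrow> 'b filter \<Rightarrow> bool" where
  "trace_norm_tendsto f L F \<longleftrightarrow> L \<in> trace_class \<and> ((\<lambda>t. trace_norm (f t - L)) \<longlongrightarrow> 0) F"

text \<open>
  The weak* topology of the bounded operators as the dual of the trace class under
  \<open>(T, S) \<mapsto> tr (T S)\<close>.
\<close>

definition weak_star_tendsto ::
    "('b \<Rightarrow> 'a::complex_hilbert op) \<Rightarrow> 'a op \<Rightarrow> 'b filter \<Rightarrow> bool" where
  "weak_star_tendsto f L F \<longleftrightarrow>
     L \<in> bounded_ops \<and> (\<forall>T\<in>trace_class. ((\<lambda>t. tr (T o\<^sub>L f t)) \<longlongrightarrow> tr (T o\<^sub>L L)) F)"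


section \<open>Quantum operations\<close>

text \<open>
  Positivity of the \<open>n \<times> n\<close> operator matrix \<open>(T i j)\<close>, acting on the direct sum of \<open>n\<close> copies of
  the Hilbert space, i.e. on its tensor product with \<open>\<complex>\<^sup>n\<close>.
\<close>

definition positive_block :: "nat \<Rightarrow> (nat \<Rightarrow> nat \<Rightarrow> 'a::complex_hilbert op) \<Rightarrow> bool" where
  "positive_block n T \<longleftrightarrow>
     (\<forall>x :: nat \<Rightarrow> 'a. (\<Sum>i<n. \<Sum>j<n. cinner (x i) (T i j (x j))) \<in> \<real>\<^sub>\<ge>\<^sub>0)"

definition completely_positive :: "('a::complex_hilbert op \<Rightarrow> 'a op) \<Rightarrow> bool" where
  "completely_positive \<Phi> \<longleftrightarrow>
     (\<forall>n T. (\<forall>i<n. \<forall>j<n. T i j \<in> trace_class) \<longrightarrow> positive_block n T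
        \<longrightarrow> positive_block n (\<lambda>i j. \<Phi> (T i j)))"

text \<open>
  Maps on the trace class are functions on all of \<open>'a op\<close> of which only the values on
  \<open>trace_class\<close> matter.
\<close>

definition quantum_operation :: "('a::complex_hilbert op \<Rightarrow> 'a op) \<Rightarrow> bool" where
  "quantum_operation \<Phi> \<longleftrightarrow>
     (\<forall>T\<in>trace_class. \<Phi> T \<in> trace_class)
   \<and> (\<forall>S\<in>trace_class. \<forall>T\<in>trace_class. \<Phi> (S + T) = \<Phi> S + \<Phi> T)
   \<and> (\<forall>c. \<forall>T\<in>trace_class. \<Phi> (c *\<^sub>C T) = c *\<^sub>C \<Phi> T)
   \<and> completely_positive \<Phi>
   \<and> (\<forall>T\<in>trace_class. tr (\<Phi> T) = tr T)"

definition dual_map :: "('a::complex_hilbert op \<Rightarrow> 'a op) \<Rightarrow> 'a op \<Rightarrow> 'a op"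
    (\<open>_\<^sup>\<sharp>\<close> [1000] 1000) where
  "\<Phi>\<^sup>\<sharp> S = (THE S'. S' \<in> bounded_ops \<and> (\<forall>T\<in>trace_class. tr (\<Phi> T o\<^sub>L S) = tr (T o\<^sub>L S')))"


section \<open>Dynamical quantum stochastic systems\<close>

definition dynamical_quantum_system :: "(real \<Rightarrow> 'a::complex_hilbert op \<Rightarrow> 'a op) \<Rightarrow> bool" where
  "dynamical_quantum_system \<Psi> \<longleftrightarrow>
     (\<forall>t\<ge>0. quantum_operation (\<Psi> t))
   \<and> (\<forall>T\<in>trace_class. \<Psi> 0 T = T)
   \<and> (\<forall>s\<ge>0. \<forall>t\<ge>0. \<forall>T\<in>trace_class. \<Psi> s (\<Psi> t T) = \<Psi> (s + t) T)
   \<and> (\<forall>T\<in>trace_class. \<forall>t\<ge>0. trace_norm_tendsto (\<lambda>s. \<Psi> s T) (\<Psi> t T) (at t within {0..}))"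

definition is_generator_value ::
    "(real \<Rightarrow> 'a::complex_hilbert op \<Rightarrow> 'a op) \<Rightarrow> 'a op \<Rightarrow> 'a op \<Rightarrow> bool" where
  "is_generator_value \<Psi> T L \<longleftrightarrow>
     trace_norm_tendsto (\<lambda>t. (\<Psi> t T - T) /\<^sub>R t) L (at_right 0)"

definition generator_dom :: "(real \<Rightarrow> 'a::complex_hilbert op \<Rightarrow> 'a op) \<Rightarrow> 'a op set" where
  "generator_dom \<Psi> = {T \<in> trace_class. \<exists>L. is_generator_value \<Psi> T L}"

definition generator :: "(real \<Rightarrow> 'a::complex_hilbert op \<Rightarrow> 'a op) \<Rightarrow> 'a op \<Rightarrow> 'a op" where
  "generator \<Psi> T = (THE L. is_generator_value \<Psi> T L)"

definition is_dual_generator_value ::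
    "(real \<Rightarrow> 'a::complex_hilbert op \<Rightarrow> 'a op) \<Rightarrow> 'a op \<Rightarrow> 'a op \<Rightarrow> bool" where
  "is_dual_generator_value \<Psi> S L \<longleftrightarrow>
     weak_star_tendsto (\<lambda>t. ((\<Psi> t)\<^sup>\<sharp> S - S) /\<^sub>R t) L (at_right 0)"

definition dual_generator_dom :: "(real \<Rightarrow> 'a::complex_hilbert op \<Rightarrow> 'a op) \<Rightarrow> 'a op set" where
  "dual_generator_dom \<Psi> = {S \<in> bounded_ops. \<exists>L. is_dual_generator_value \<Psi> S L}"

definition dual_generator :: "(real \<Rightarrow> 'a::complex_hilbert op \<Rightarrow> 'a op) \<Rightarrow> 'a op \<Rightarrow> 'a op" where
  "dual_generator \<Psi> S = (THE L. is_dual_generator_value \<Psi> S L)"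

definition dual_generator_ker :: "(real \<Rightarrow> 'a::complex_hilbert op \<Rightarrow> 'a op) \<Rightarrow> 'a op set" where
  "dual_generator_ker \<Psi> = {S \<in> dual_generator_dom \<Psi>. dual_generator \<Psi> S = 0}"

definition is_constant :: "(real \<Rightarrow> 'a::complex_hilbert op \<Rightarrow> 'a op) \<Rightarrow> 'a op \<Rightarrow> bool" where
  "is_constant \<Psi> B \<longleftrightarrow> B \<in> bounded_ops \<and>
     (\<forall>\<rho>. density_op \<rho> \<longrightarrow> (\<forall>s\<ge>0. \<forall>t\<ge>0. tr (\<Psi> s \<rho> o\<^sub>L B) = tr (\<Psi> t \<rho> o\<^sub>L B)))"

definition left_mult :: "'a::complex_hilbert op \<Rightarrow> 'a op \<Rightarrow> 'a op" where
  "left_mult A T = A o\<^sub>L T"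

definition right_mult :: "'a::complex_hilbert op \<Rightarrow> 'a op \<Rightarrow> 'a op" where
  "right_mult A T = T o\<^sub>L A"

definition commutator ::
    "('a::complex_hilbert op \<Rightarrow> 'a op) \<Rightarrow> ('a op \<Rightarrow> 'a op) \<Rightarrow> 'a op \<Rightarrow> 'a op" where
  "commutator \<Phi> \<Xi> T = \<Phi> (\<Xi> T) - \<Xi> (\<Phi> T)"

definition all_equivalent :: "bool list \<Rightarrow> bool" where
  "all_equivalent Ps \<longleftrightarrow> (\<forall>P\<in>set Ps. \<forall>Q\<in>set Ps. P \<longleftrightarrow> Q)"

end

theory Submission imports Defs
begin

text \<open>
  Everything is reduced to assertion (iv), that \<open>A\<close> and \<open>A\<^sup>* A\<close> are fixed by every \<open>\<Psi>\<^sub>t\<^sup>\<sharp>\<close>.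

  \<^item> (i) and (iii) are transposes of each other under the pairing \<open>(T, S) \<mapsto> tr (T S)\<close>
    (\<open>left_mult_commutes_iff_right_mult_commutes\<close>).

  \<^item> (iii) gives (iv) by evaluation at \<open>S = 1\<close> and \<open>S = A\<^sup>*\<close>. The converse is a multiplicative domain
    argument (\<open>dual_map_multiplicative\<close>): \<open>\<Phi> = \<Psi>\<^sub>t\<^sup>\<sharp>\<close> is unital and completely positive, so the image under \<open>\<Phi>\<close>
    of the positive \<open>3 \<times> 3\<close> block operator \<open>V\<^sup>* V\<close> with \<open>V = (1, A, S\<^sup>*)\<close> is positive; if \<open>A\<close> and \<open>A\<^sup>* A\<close> are
    fixed, the vectors \<open>(- A y, y, 0)\<close> are null vectors of its quadratic form, and orthogonality to them reads
    \<open>\<Phi> (S A) = \<Phi> S A\<close>.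

  \<^item> (ii) is (iv) tested on the rank one density operators, which determine a bounded operator.

  \<^item> For (v) and (vi) the generator is used in the form: if \<open>tr (\<psi>(T) B) = 0\<close> for all \<open>T\<close> in the domain of
    \<open>\<psi>\<close>, then \<open>B\<close> is fixed (\<open>dual_fixed_pointI\<close>). Indeed \<open>t \<mapsto> tr (\<Psi>\<^sub>t(T) B)\<close> then has right derivative \<open>0\<close>, so
    it is constant for \<open>T\<close> in the domain, and the domain is dense because it contains the integrals of
    orbits. Under (vi) the hypothesis is immediate. Under (v) one has \<open>tr (\<psi>(T) A) = tr (\<psi>(A T)) = 0\<close>
    as the trace is preserved, so \<open>A\<close> and \<open>A\<^sup>*\<close> are fixed, and then
    \<open>tr (\<psi>(T) A\<^sup>* A) = tr (\<psi>(A T) A\<^sup>*) = 0\<close>.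

  What these arguments take for granted about Hilbert space operators makes up most of the text: the
  adjoint, square roots and the polar decomposition; the trace, its independence of the basis and
  its cyclicity, obtained from factorizations into Hilbert--Schmidt operators; the completeness of the trace
  class; and the existence of the dual map of a quantum operation, which rests on the density of the
  finite rank operators.
\<close>

section \<open>Complex inner products\<close>

lemma scaleC_one [simp]: "1 *\<^sub>C x = (x::'a::complex_vector)"
  using scaleR_eq_scaleC[of 1 x] by simp

lemma scaleC_zero_left [simp]: "0 *\<^sub>C x = (0::'a::complex_vector)"
  using scaleR_eq_scaleC[of 0 x] by simp

lemma scaleC_zero_right [simp]: "c *\<^sub>C 0 = (0::'a::complex_vector)"
  using scaleC_add_right[of c 0 0] by simp

lemma scaleC_minus_left [simp]: "(- c) *\<^sub>C x = - (c *\<^sub>C (x::'a::complex_vector))"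
  by (metis add.right_inverse minus_unique scaleC_add_left scaleC_zero_left)

lemma scaleC_minus_right [simp]: "c *\<^sub>C (- x) = - (c *\<^sub>C (x::'a::complex_vector))"
  by (metis add.right_inverse minus_unique scaleC_add_right scaleC_zero_right)

lemma scaleC_diff_right: "c *\<^sub>C (x - y) = c *\<^sub>C x - c *\<^sub>C (y::'a::complex_vector)"
  by (metis (no_types) diff_conv_add_uminus scaleC_add_right scaleC_minus_right)

lemma scaleC_scaleR: "c *\<^sub>C (r *\<^sub>R x) = r *\<^sub>R (c *\<^sub>C (x::'a::complex_vector))"
  by (simp add: scaleR_eq_scaleC scaleC_scaleC mult.commute)

lemma cinner_scaleC_left [simp]: "cinner (c *\<^sub>C x) y = cnj c * cinner x (y::'a::complex_hilbert)"
  by (metis cinner_commute cinner_scaleC_right complex_cnj_mult)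

lemma cinner_add_left: "cinner (x + y) z = cinner x z + cinner y (z::'a::complex_hilbert)"
  by (metis cinner_commute cinner_add_right complex_cnj_add)

lemma cinner_scaleR_right [simp]: "cinner x (r *\<^sub>R y) = of_real r * cinner x (y::'a::complex_hilbert)"
  by (simp add: scaleR_eq_scaleC cinner_scaleC_right)

lemma cinner_scaleR_left [simp]: "cinner (r *\<^sub>R x) y = of_real r * cinner x (y::'a::complex_hilbert)"
  by (simp add: scaleR_eq_scaleC)

declare cinner_scaleC_right [simp]

lemma cinner_self: "cinner x x = of_real ((norm (x::'a::complex_hilbert))\<^sup>2)"
proof -
  have "Im (cinner x x) = 0"
    using cinner_commute[of x x] by (metis complex_cnj_cancel_iff complex_eq_iff cnj.simps(2) neg_equal_zero)
  then show ?thesis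
    by (simp add: complex_eq_iff power2_norm_eq_inner inner_eq_Re_cinner)
qed

lemma norm_cinner_le: "cmod (cinner x y) \<le> norm x * norm (y::'a::complex_hilbert)"
proof (cases "cinner x y = 0")
  case False
  \<comment> \<open>rotate \<open>y\<close> by a phase so that the inner product becomes real\<close>
  define u where "u = cnj (cinner x y) / of_real (cmod (cinner x y))"
  have u: "cmod u = 1"
    using False by (simp add: u_def norm_divide)
  have "cinner x (u *\<^sub>C y) = of_real (cmod (cinner x y))"
    using False by (simp add: u_def complex_norm_square[symmetric] mult.commute power2_eq_square)
  then have "cmod (cinner x y) = x \<bullet> (u *\<^sub>C y)"
    by (simp only: inner_eq_Re_cinner Re_complex_of_real)
  also have "\<dots> \<le> norm x * norm (u *\<^sub>C y)"
    by (rule norm_cauchy_schwarz)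
  finally show ?thesis
    by (simp add: norm_scaleC u)
qed simp

interpretation cinner: bounded_bilinear "cinner :: 'a::complex_hilbert \<Rightarrow> 'a \<Rightarrow> complex"
proof
  show "\<exists>K. \<forall>a b::'a. norm (cinner a b) \<le> norm a * norm b * K"
    by (rule exI[of _ 1]) (simp add: norm_cinner_le)
qed (simp_all add: cinner_add_left cinner_add_right scaleR_conv_of_real)

declare cinner.zero_left [simp] cinner.zero_right [simp]

lemma cinner_eq_ext:
  assumes "\<And>x. cinner x y = cinner x (z::'a::complex_hilbert)"
  shows "y = z"
proof -
  have "cinner (y - z) (y - z) = 0"
    using assms[of "y - z"] by (simp add: cinner.diff_right)
  then show ?thesis
    by (simp add: cinner_self)
qed

lemma Re_cinner_commute: "Re (cinner x y) = Re (cinner y (x::'a::complex_hilbert))"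
  by (metis cinner_commute cnj.simps(1))

section \<open>The algebra of bounded operators\<close>

lemma scaleC_blinfun_apply [simp]: "blinfun_apply (c *\<^sub>C T) x = c *\<^sub>C blinfun_apply T x"
  by transfer simp

lemma bounded_opsD: "T \<in> bounded_ops \<Longrightarrow> blinfun_apply T (c *\<^sub>C x) = c *\<^sub>C blinfun_apply T x"
  by (simp add: bounded_ops_def)

lemma zero_bounded_ops [simp, intro]: "0 \<in> bounded_ops"
  and id_bounded_ops [simp, intro]: "id_blinfun \<in> bounded_ops"
  and compose_bounded_ops [simp, intro]: "S \<in> bounded_ops \<Longrightarrow> T \<in> bounded_ops \<Longrightarrow> S o\<^sub>L T \<in> bounded_ops"
  and add_bounded_ops [simp, intro]: "S \<in> bounded_ops \<Longrightarrow> T \<in> bounded_ops \<Longrightarrow> S + T \<in> bounded_ops"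
  and diff_bounded_ops [simp, intro]: "S \<in> bounded_ops \<Longrightarrow> T \<in> bounded_ops \<Longrightarrow> S - T \<in> bounded_ops"
  and minus_bounded_ops [simp, intro]: "S \<in> bounded_ops \<Longrightarrow> - S \<in> bounded_ops"
  and scaleC_bounded_ops [simp, intro]: "S \<in> bounded_ops \<Longrightarrow> c *\<^sub>C S \<in> bounded_ops"
  and scaleR_bounded_ops [simp, intro]: "S \<in> bounded_ops \<Longrightarrow> r *\<^sub>R S \<in> bounded_ops"
  by (simp_all add: bounded_ops_def blinfun.zero_left blinfun.add_left blinfun.diff_left blinfun.minus_left
      blinfun.scaleR_left scaleC_add_right scaleC_diff_right scaleC_scaleC mult.commute scaleC_scaleR)

lemma closed_bounded_ops: "closed (bounded_ops :: 'a::complex_hilbert op set)"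
proof -
  have "bounded_ops = (\<Inter>c. \<Inter>x. {T :: 'a op. T (c *\<^sub>C x) = c *\<^sub>C T x})"
    by (auto simp: bounded_ops_def)
  moreover have "closed {T :: 'a op. T (c *\<^sub>C x) = c *\<^sub>C T x}" for c x
    by (intro closed_Collect_eq continuous_intros
        bounded_linear.continuous_on[OF bounded_linear_scaleC])
  ultimately show ?thesis
    by (metis (no_types, lifting) closed_INT)
qed

lemma blinfun_eq_iff: "S = T \<longleftrightarrow> (\<forall>x. blinfun_apply S x = blinfun_apply T x)"
  by (auto intro: blinfun_eqI)

lemma blinfun_compose_diff_left: "(S - T) o\<^sub>L U = (S o\<^sub>L U) - (T o\<^sub>L U)"
  and blinfun_compose_diff_right: "U' o\<^sub>L (S - T) = (U' o\<^sub>L S) - (U' o\<^sub>L T)"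
  by (auto intro!: blinfun_eqI simp: blinfun.diff_left blinfun.diff_right)

lemma blinfun_compose_add_left: "(S + T) o\<^sub>L U = (S o\<^sub>L U) + (T o\<^sub>L U)"
  and blinfun_compose_add_right: "U' o\<^sub>L (S + T) = (U' o\<^sub>L S) + (U' o\<^sub>L T)"
  by (auto intro!: blinfun_eqI simp: blinfun.add_left blinfun.add_right)

lemma blinfun_compose_assoc: "(S o\<^sub>L T) o\<^sub>L U = S o\<^sub>L (T o\<^sub>L U)"
  by (auto intro!: blinfun_eqI)

lemma blinfun_compose_scaleC_left: "(c *\<^sub>C S) o\<^sub>L T = c *\<^sub>C (S o\<^sub>L T)"
  by (auto intro!: blinfun_eqI)

lemma blinfun_compose_scaleC_right: "S \<in> bounded_ops \<Longrightarrow> S o\<^sub>L (c *\<^sub>C T) = c *\<^sub>C (S o\<^sub>L T)"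
  by (auto intro!: blinfun_eqI simp: bounded_opsD)

lemma blinfun_compose_id [simp]: "S o\<^sub>L id_blinfun = S" "id_blinfun o\<^sub>L T = T"
  by (auto intro!: blinfun_eqI)

lemma op_eqI:
  fixes S T :: "'a::complex_hilbert op"
  assumes "\<And>x y. cinner x (S y) = cinner x (T y)"
  shows "S = T"
  using assms by (blast intro: blinfun_eqI cinner_eq_ext)

text \<open>
  Over the complex numbers the quadratic form determines the operator, by polarization.
\<close>

lemma op_eqI_quadratic:
  fixes S T :: "'a::complex_hilbert op"
  assumes "S \<in> bounded_ops" "T \<in> bounded_ops" and eq: "\<And>x. cinner x (S x) = cinner x (T x)"
  shows "S = T"
proof (rule op_eqI)
  fix x y :: 'a
  define D where "D = S - T"
  have D: "D \<in> bounded_ops" and q: "cinner z (D z) = 0" for z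
    using assms by (auto simp: D_def blinfun.diff_left cinner.diff_right)
  have "cinner x (D y) + cinner y (D x) = 0"
    using q[of "x + y"] q[of x] q[of y]
    by (simp add: blinfun.add_right cinner.add_left cinner.add_right add.commute)
  moreover have "\<i> * cinner x (D y) - \<i> * cinner y (D x) = 0"
    using q[of "x + \<i> *\<^sub>C y"] q[of x] q[of y]
    by (simp add: blinfun.add_right cinner.add_left cinner.add_right bounded_opsD[OF D])
  ultimately have "cinner x (D y) = 0"
    by (simp add: algebra_simps)
  then show "cinner x (S y) = cinner x (T y)"
    by (simp add: D_def blinfun.diff_left cinner.diff_right)
qed

section \<open>Representation of forms and the adjoint\<close>

text \<open>
  The minimizing sequence of \<open>\<lambda>v. \<parallel>v\<parallel>\<^sup>2 / 2 - g v\<close> on \<open>M\<close> is Cauchy by the parallelogram law, and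
  the first-order condition at its limit is the claim.
\<close>

lemma riesz_on_subspace:
  fixes g :: "'a::{real_inner,banach} \<Rightarrow> real"
  assumes M: "subspace M"
    and g_add: "\<And>v w. v \<in> M \<Longrightarrow> w \<in> M \<Longrightarrow> g (v + w) = g v + g w"
    and g_scale: "\<And>r v. v \<in> M \<Longrightarrow> g (r *\<^sub>R v) = r * g v"
    and g_bound: "\<And>v. v \<in> M \<Longrightarrow> \<bar>g v\<bar> \<le> K * norm v"
  shows "\<exists>u \<in> closure M. \<forall>v\<in>M. u \<bullet> v = g v"
proof -
  define J where "J v = (norm v)\<^sup>2 / 2 - g v" for v
  have J_ge: "- (K\<^sup>2 / 2) \<le> J v" if "v \<in> M" for v
  proof -
    have "0 \<le> (norm v - K)\<^sup>2" by simp
    moreover have "g v \<le> K * norm v" using g_bound[OF that] by simp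
    ultimately show ?thesis
      by (simp add: J_def power2_diff mult.commute)
  qed
  define m where "m = Inf (J ` M)"
  have bdd: "bdd_below (J ` M)"
    using J_ge by (auto intro!: bdd_belowI2)
  have m_le: "m \<le> J v" if "v \<in> M" for v
    unfolding m_def using bdd that by (auto intro: cInf_lower)
  have "\<exists>v\<in>M. J v < m + 1 / real (Suc n)" for n
  proof -
    have "J ` M \<noteq> {}" using subspace_0[OF M] by auto
    then show ?thesis
      using cInf_lessD[of "J ` M" "m + 1 / real (Suc n)"] by (auto simp: m_def)
  qed
  then obtain X where X: "X n \<in> M" "J (X n) < m + 1 / real (Suc n)" for n
    by metis
  have dist: "(norm (X i - X j))\<^sup>2 \<le> 4 * (1 / real (Suc i) + 1 / real (Suc j))" for i j
  proof -
    define c where "c = 1 / real (Suc i) + 1 / real (Suc j)"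
    let ?z = "(1/2) *\<^sub>R (X i + X j)"
    have "?z \<in> M" using M X by (simp add: subspace_add subspace_scale)
    then have "m \<le> J ?z" by (rule m_le)
    also have "J ?z = (norm (X i + X j))\<^sup>2 / 8 - (g (X i) + g (X j)) / 2"
    proof -
      have "g ?z = (g (X i) + g (X j)) / 2"
        using g_scale[of "X i + X j" "1/2"] g_add[of "X i" "X j"] X(1) subspace_add[OF M] by simp
      moreover have "(norm ?z)\<^sup>2 = (norm (X i + X j))\<^sup>2 / 4"
        unfolding norm_scaleR power_mult_distrib by (simp add: power2_eq_square)
      ultimately show ?thesis by (simp only: J_def)
    qed
    finally have "m \<le> (norm (X i + X j))\<^sup>2 / 8 - (g (X i) + g (X j)) / 2" .
    moreover have "(norm (X i + X j))\<^sup>2 = 2 * (norm (X i))\<^sup>2 + 2 * (norm (X j))\<^sup>2 - (norm (X i - X j))\<^sup>2"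
      by (simp add: power2_norm_eq_inner inner_add inner_diff inner_commute)
    moreover have "J (X i) + J (X j) \<le> 2 * m + c"
      using X(2)[of i] X(2)[of j] unfolding c_def by linarith
    moreover have "d \<le> 4 * c" if "m \<le> S / 8 - (g1 + g2) / 2" "S = 2 * a + 2 * b - d"
      "(a / 2 - g1) + (b / 2 - g2) \<le> 2 * m + c" for S a b d g1 g2 :: real
      using that by (simp add: field_simps)
    ultimately show ?thesis
      unfolding J_def c_def[symmetric] by blast
  qed
  have "Cauchy X"
  proof (rule metric_CauchyI)
    fix e :: real assume "e > 0"
    then obtain N where N: "1 / real (Suc N) < e\<^sup>2 / 8"
      using reals_Archimedean[of "e\<^sup>2 / 8"] by (auto simp: inverse_eq_divide)
    have "dist (X i) (X j) < e" if "i \<ge> N" "j \<ge> N" for i j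
    proof -
      have "1 / real (Suc i) \<le> 1 / real (Suc N)" "1 / real (Suc j) \<le> 1 / real (Suc N)"
        using that by (auto intro!: divide_left_mono)
      then have "(norm (X i - X j))\<^sup>2 < e\<^sup>2"
        using dist[of i j] N by simp
      then show ?thesis
        using \<open>e > 0\<close> by (simp add: dist_norm power2_less_imp_less)
    qed
    then show "\<exists>M. \<forall>m\<ge>M. \<forall>n\<ge>M. dist (X m) (X n) < e" by blast
  qed
  then obtain u where u: "X \<longlonglongrightarrow> u"
    using Cauchy_convergent_iff convergent_def by blast
  have "u \<in> closure M"
    using X(1) u closure_sequential by blast
  moreover have "u \<bullet> v = g v" if v: "v \<in> M" for v
  proof -
    have quad: "0 \<le> r * (u \<bullet> v - g v) + r\<^sup>2 * (norm v)\<^sup>2 / 2" for r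
    proof (rule LIMSEQ_le_const)
      show "(\<lambda>n. (r * (X n \<bullet> v - g v) + r\<^sup>2 * (norm v)\<^sup>2 / 2) + 1 / real (Suc n))
          \<longlonglongrightarrow> r * (u \<bullet> v - g v) + r\<^sup>2 * (norm v)\<^sup>2 / 2"
      proof -
        have "(\<lambda>n. (r * (X n \<bullet> v - g v) + r\<^sup>2 * (norm v)\<^sup>2 / 2) + inverse (real (Suc n)))
          \<longlonglongrightarrow> (r * (u \<bullet> v - g v) + r\<^sup>2 * (norm v)\<^sup>2 / 2) + 0"
          by (intro tendsto_intros u LIMSEQ_inverse_real_of_nat)
        then show ?thesis by (simp add: inverse_eq_divide)
      qed
      have "0 \<le> (r * (X n \<bullet> v - g v) + r\<^sup>2 * (norm v)\<^sup>2 / 2) + 1 / real (Suc n)" for n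
      proof -
        have "m \<le> J (X n + r *\<^sub>R v)"
          using X(1) v M by (intro m_le) (simp add: subspace_add subspace_scale)
        also have "J (X n + r *\<^sub>R v) = J (X n) + r * (X n \<bullet> v - g v) + r\<^sup>2 * (norm v)\<^sup>2 / 2"
        proof -
          have "(norm (X n + r *\<^sub>R v))\<^sup>2 = (norm (X n))\<^sup>2 + 2 * r * (X n \<bullet> v) + r\<^sup>2 * (norm v)\<^sup>2"
            unfolding power2_norm_eq_inner by (simp add: inner_add inner_commute power2_eq_square)
          moreover have "g (X n + r *\<^sub>R v) = g (X n) + r * g v"
            using X(1) v M by (simp add: g_add g_scale subspace_scale)
          ultimately show ?thesis by (simp add: J_def field_simps)
        qed
        finally show ?thesis using X(2)[of n] by simp
      qed
      then show "\<exists>N. \<forall>n\<ge>N. 0 \<le> (r * (X n \<bullet> v - g v) + r\<^sup>2 * (norm v)\<^sup>2 / 2) + 1 / real (Suc n)"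
        by blast
    qed
    define d where "d = u \<bullet> v - g v"
    \<comment> \<open>the summand \<open>1\<close> covers the case \<open>v = 0\<close>\<close>
    define q where "q = (norm v)\<^sup>2 + 1"
    have "q > 0" unfolding q_def by (smt (verit) zero_le_power2)
    have "0 \<le> (- d / q) * d + (- d / q)\<^sup>2 * (norm v)\<^sup>2 / 2"
      using quad[of "- d / q"] by (simp add: d_def)
    also have "\<dots> \<le> (- d / q) * d + (- d / q)\<^sup>2 * q / 2"
      by (intro add_left_mono divide_right_mono mult_left_mono) (auto simp: q_def)
    also have "\<dots> = - (d\<^sup>2 / (2 * q))"
      using \<open>q > 0\<close> by (simp add: field_simps power2_eq_square)
    finally have "d\<^sup>2 \<le> 0" using \<open>q > 0\<close> by (simp add: field_simps)
    then show ?thesis by (simp add: d_def)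
  qed
  ultimately show ?thesis by blast
qed

text \<open>
  With \<open>P\<close> the identity this represents a bounded sesquilinear form by an operator. The version
  relative to \<open>P\<close>, where the form is only bounded by \<open>\<parallel>P z\<parallel>\<close>, is what the polar decomposition
  needs: there the operator has to live on the closed range of \<open>P\<close>.
\<close>

lemma sesquilinear_form_representation:
  fixes P :: "'a::complex_hilbert op" and b :: "'a \<Rightarrow> 'a \<Rightarrow> complex"
  assumes P: "P \<in> bounded_ops" and K: "K \<ge> 0"
    and b_add_left: "\<And>x y z. b (x + y) z = b x z + b y z"
    and b_scale_left: "\<And>c x z. b (c *\<^sub>C x) z = cnj c * b x z"
    and b_add_right: "\<And>x y z. b x (y + z) = b x y + b x z"
    and b_scale_right: "\<And>c x z. b x (c *\<^sub>C z) = c * b x z"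
    and b_bound: "\<And>x z. cmod (b x z) \<le> K * norm x * norm (P z)"
  obtains V where "V \<in> bounded_ops" "\<And>x z. cinner (V x) (P z) = b x z" 
    "\<And>x. V x \<in> closure (range P)" "norm V \<le> K"
proof -
  define M where "M = range (blinfun_apply P)"
  have M: "subspace M"
    unfolding M_def by (rule subspace_UNIV[THEN linear_subspace_image[rotated]])
      (simp add: blinfun.bounded_linear_right bounded_linear.linear)
  have orth_zero: "u = 0" if "u \<in> closure M" "\<And>z. cinner u (P z) = 0" for u
  proof -
    have "closure M \<subseteq> {w. cinner u w = 0}"
      using that(2) by (intro closure_minimal closed_Collect_eq continuous_intros cinner.continuous_on) (auto simp: M_def)
    then have "cinner u u = 0" using that(1) by blast
    then show "u = 0" by (simp add: cinner_self)
  qed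
  have "\<exists>u \<in> closure M. \<forall>z. cinner u (P z) = b x z" for x
  proof -
    define g where "g v = Re (b x (SOME z. P z = v))" for v
    have g: "g (P z) = Re (b x z)" for z
    proof -
      define z' where "z' = (SOME z'. P z' = P z)"
      have "P z' = P z" unfolding z'_def by (rule someI[of _ z]) simp
      then have "P (z' - z) = 0" by (simp add: blinfun.diff_right)
      then have "b x (z' - z) = 0" using b_bound[of x "z' - z"] by simp
      moreover have "b x z' = b x (z' - z) + b x z" by (metis b_add_right diff_add_cancel)
      ultimately show ?thesis unfolding g_def z'_def by simp
    qed
    have "\<exists>u \<in> closure M. \<forall>v\<in>M. u \<bullet> v = g v"
    proof (rule riesz_on_subspace[OF M])
      show "g (v + w) = g v + g w" if "v \<in> M" "w \<in> M" for v w
        using that by (auto simp: M_def g b_add_right simp flip: blinfun.add_right)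
      show "g (r *\<^sub>R v) = r * g v" if vM: "v \<in> M" for r v
      proof -
        obtain z where v: "v = P z" using vM by (auto simp: M_def)
        have "g (r *\<^sub>R v) = Re (b x (r *\<^sub>R z))"
          by (simp only: v g flip: blinfun.scaleR_right)
        then show ?thesis by (simp add: v g b_scale_right scaleR_eq_scaleC)
      qed
      show "\<bar>g v\<bar> \<le> (K * norm x) * norm v" if "v \<in> M" for v
      proof -
        from that have "v \<in> range P" by (simp add: M_def)
        then obtain z where v: "v = P z" by blast
        show ?thesis
          unfolding v g by (rule order_trans[OF abs_Re_le_cmod b_bound])
      qed
    qed
    then obtain u where u: "u \<in> closure M" "\<And>z. Re (cinner u (P z)) = Re (b x z)"
      by (auto simp: M_def inner_eq_Re_cinner g)
    have "cinner u (P z) = b x z" for z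
      using u(2)[of z] u(2)[of "\<i> *\<^sub>C z"]
      by (simp add: complex_eq_iff bounded_opsD[OF P] b_scale_right)
    then show ?thesis using u(1) by blast
  qed
  then obtain V where V: "V x \<in> closure M" "cinner (V x) (P z) = b x z" for x z
    by metis
  have scM: "c *\<^sub>C w \<in> closure M" if "w \<in> closure M" for c w
  proof -
    have "(\<lambda>w. c *\<^sub>C w) ` closure M \<subseteq> closure ((\<lambda>w. c *\<^sub>C w) ` M)"
      by (rule closure_bounded_linear_image_subset[OF bounded_linear_scaleC])
    also have "(\<lambda>w. c *\<^sub>C w) ` M \<subseteq> M"
      by (auto simp: M_def simp flip: bounded_opsD[OF P])
    finally show ?thesis using that closure_mono by blast
  qed
  have addM: "v + w \<in> closure M" if vw: "v \<in> closure M" "w \<in> closure M" for v w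
  proof -
    obtain v' w' where "\<And>n. v' n \<in> M" "v' \<longlonglongrightarrow> v" "\<And>n. w' n \<in> M" "w' \<longlonglongrightarrow> w"
      using vw unfolding closure_sequential by auto
    then have "\<And>n. v' n + w' n \<in> M" "(\<lambda>n. v' n + w' n) \<longlonglongrightarrow> v + w"
      using M by (auto intro: subspace_add tendsto_add)
    then show ?thesis unfolding closure_sequential by (intro exI[of _ "\<lambda>n. v' n + w' n"]) auto
  qed
  have diffM: "v - w \<in> closure M" if "v \<in> closure M" "w \<in> closure M" for v w
    using addM[OF that(1) scM[OF that(2), of "-1"]] by simp
  have V_add: "V (x + y) = V x + V y" for x y
  proof -
    have "V (x + y) - (V x + V y) = 0"
      by (rule orth_zero)
        (auto intro!: diffM addM V simp: cinner.diff_left cinner.add_left V b_add_left)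
    then show ?thesis by simp
  qed
  have V_scale: "V (c *\<^sub>C x) = c *\<^sub>C V x" for c x
  proof -
    have "V (c *\<^sub>C x) - c *\<^sub>C V x = 0"
      by (rule orth_zero)
        (auto intro!: diffM scM V simp: cinner.diff_left V b_scale_left)
    then show ?thesis by simp
  qed
  have V_norm: "norm (V x) \<le> K * norm x" for x
  proof -
    have "closure M \<subseteq> {w. cmod (cinner (V x) w) \<le> (K * norm x) * norm w}"
      using b_bound by (intro closure_minimal closed_Collect_le continuous_intros cinner.continuous_on) 
        (auto simp: M_def V)
    then have "cmod (cinner (V x) (V x)) \<le> (K * norm x) * norm (V x)" using V(1) by blast
    then have "norm (V x) * norm (V x) \<le> (K * norm x) * norm (V x)"
      by (simp add: cinner_self norm_power power2_eq_square norm_mult)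
    then show ?thesis
      using K by (cases "norm (V x) = 0") auto
  qed
  have bl: "bounded_linear V"
    by (rule bounded_linear_intro[where K = K])
      (auto simp: V_add scaleR_eq_scaleC V_scale V_norm mult.commute)
  show ?thesis
  proof (rule that[of "Blinfun V"])
    show "norm (Blinfun V) \<le> K"
      by (rule norm_blinfun_bound) (auto simp: K bounded_linear_Blinfun_apply[OF bl] V_norm)
  qed (auto simp: bounded_ops_def bounded_linear_Blinfun_apply[OF bl] V_scale V[unfolded M_def])
qed

lemma adj_exists:
  fixes T :: "'a::complex_hilbert op"
  assumes T: "T \<in> bounded_ops"
  shows "\<exists>S. (S \<in> bounded_ops \<and> (\<forall>x y. cinner (S x) y = cinner x (T y))) \<and> norm S \<le> norm T"
proof -
  have bound: "cmod (cinner x (T z)) \<le> norm T * norm x * norm (id_blinfun z)" for x z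
  proof -
    have "cmod (cinner x (T z)) \<le> norm x * norm (T z)" by (rule norm_cinner_le)
    also have "\<dots> \<le> norm x * (norm T * norm z)" by (intro mult_left_mono norm_blinfun) auto
    finally show ?thesis by (simp add: ac_simps)
  qed
  obtain V where "V \<in> bounded_ops" "\<And>x z. cinner (V x) (id_blinfun z) = cinner x (T z)" "norm V \<le> norm T"
    by (rule sesquilinear_form_representation[where b = "\<lambda>x z. cinner x (T z)" and P = id_blinfun, OF _ _ _ _ _ _ bound])
      (auto simp: cinner.add_left cinner.add_right blinfun.add_right bounded_opsD[OF T])
  then show ?thesis by auto
qed

lemma adj_properties:
  fixes T :: "'a::complex_hilbert op"
  assumes "T \<in> bounded_ops"
  shows "adj T \<in> bounded_ops \<and> (\<forall>x y. cinner (adj T x) y = cinner x (T y))"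
proof -
  obtain S where S: "S \<in> bounded_ops \<and> (\<forall>x y. cinner (S x) y = cinner x (T y))"
    using adj_exists[OF assms] by blast
  show ?thesis
    unfolding adj_def
  proof (rule theI[where P = "\<lambda>S. S \<in> bounded_ops \<and> (\<forall>x y. cinner (S x) y = cinner x (T y))", OF S])
    show "S' = S" if "S' \<in> bounded_ops \<and> (\<forall>x y. cinner (S' x) y = cinner x (T y))" for S'
      using that S by (intro op_eqI) (metis cinner_commute)
  qed
qed

lemma adj_bounded_ops [simp, intro]: "T \<in> bounded_ops \<Longrightarrow> adj T \<in> bounded_ops"
  and cinner_adj_left: "T \<in> bounded_ops \<Longrightarrow> cinner (adj T x) y = cinner x (T y)"
  using adj_properties by blast+

lemma cinner_adj_right: "T \<in> bounded_ops \<Longrightarrow> cinner x (adj T y) = cinner (T x) y"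
  by (metis cinner_adj_left cinner_commute)

lemma adj_eqI:
  fixes S T :: "'a::complex_hilbert op"
  assumes "T \<in> bounded_ops" "\<And>x y. cinner (S x) y = cinner x (T y)"
  shows "adj T = S"
  using assms by (intro op_eqI) (metis cinner_commute cinner_adj_right)

lemma adj_adj [simp]: "T \<in> bounded_ops \<Longrightarrow> adj (adj T) = T"
  by (rule adj_eqI) (auto simp: cinner_adj_right)

lemma adj_compose: "S \<in> bounded_ops \<Longrightarrow> T \<in> bounded_ops \<Longrightarrow> adj (S o\<^sub>L T) = adj T o\<^sub>L adj S"
  by (rule adj_eqI) (auto simp: cinner_adj_left)

lemma adj_add: "S \<in> bounded_ops \<Longrightarrow> T \<in> bounded_ops \<Longrightarrow> adj (S + T) = adj S + adj T"
  by (rule adj_eqI) (auto simp: cinner_adj_left blinfun.add_left cinner.add_left cinner.add_right)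

lemma adj_scaleC: "S \<in> bounded_ops \<Longrightarrow> adj (c *\<^sub>C S) = cnj c *\<^sub>C adj S"
  by (rule adj_eqI) (auto simp: cinner_adj_left)

lemma adj_id [simp]: "adj id_blinfun = id_blinfun"
  by (rule adj_eqI) auto

lemma norm_adj_le:
  assumes "T \<in> bounded_ops" shows "norm (adj T) \<le> norm T"
proof -
  obtain S where S: "S \<in> bounded_ops" "\<forall>x y. cinner (S x) y = cinner x (T y)" "norm S \<le> norm T"
    using adj_exists[OF assms] by blast
  then show ?thesis using adj_eqI[OF assms] by metis
qed

section \<open>Positive operators, square roots and polar decomposition\<close>

lemma positive_opI:
  "P \<in> bounded_ops \<Longrightarrow> (\<And>x. \<exists>r\<ge>0. cinner x (P x) = complex_of_real r) \<Longrightarrow> positive_op P"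
  unfolding positive_op_def by (metis nonneg_Reals_of_real_iff)

lemma positive_op_bounded_ops [intro]: "positive_op P \<Longrightarrow> P \<in> bounded_ops"
  by (simp add: positive_op_def)

lemma positive_op_Re: "positive_op P \<Longrightarrow> 0 \<le> Re (cinner x (P x))"
  and positive_op_real: "positive_op P \<Longrightarrow> cinner x (P x) = of_real (Re (cinner x (P x)))"
  by (auto simp: positive_op_def complex_nonneg_Reals_iff complex_eq_iff)

lemma positive_op_adj:
  assumes "positive_op P" shows "adj P = P"
proof (rule op_eqI_quadratic)
  show "cinner x (adj P x) = cinner x (P x)" for x
    using positive_op_real[OF assms, of x] assms
    by (metis cinner_adj_right cinner_commute complex_cnj_complex_of_real positive_op_def)
qed (use assms in \<open>auto simp: positive_op_def\<close>)

lemma positive_op_cinner: "positive_op P \<Longrightarrow> cinner (P x) y = cinner x (P y)"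
  using positive_op_adj[of P] cinner_adj_left[of P] by (metis positive_op_def)

lemma positive_op_adj_compose:
  assumes "S \<in> bounded_ops" shows "positive_op (adj S o\<^sub>L S)"
proof (rule positive_opI)
  show "\<exists>r\<ge>0. cinner x ((adj S o\<^sub>L S) x) = complex_of_real r" for x
    by (rule exI[of _ "(norm (S x))\<^sup>2"]) (simp add: cinner_adj_right assms cinner_self)
qed (use assms in auto)

text \<open>This is Cauchy--Schwarz for the semi-inner product \<open>\<lambda>x y. cinner x (P y)\<close>.\<close>

lemma positive_op_schwarz:
  assumes P: "positive_op P"
  shows "(cmod (cinner x (P y)))\<^sup>2 \<le> Re (cinner x (P x)) * Re (cinner y (P y))"
proof (cases "cinner x (P y) = 0")
  case True
  then show ?thesis using positive_op_Re[OF P] by simp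
next
  case False
  define b where "b = cmod (cinner x (P y))"
  have b: "b > 0" using False by (simp add: b_def)
  define p q where "p = Re (cinner x (P x))" and "q = Re (cinner y (P y))"
  have q: "q \<ge> 0" using positive_op_Re[OF P] by (simp add: q_def)
  have Pb: "P \<in> bounded_ops" using P by blast
  have quad: "0 \<le> p - 2 * t * b + t\<^sup>2 * q" for t
  proof -
    \<comment> \<open>the phase that makes the cross terms negative\<close>
    define c where "c = - (of_real t * cnj (cinner x (P y)) / of_real b)"
    have c1: "c * cinner x (P y) = of_real (- t * b)"
    proof -
      have "c * cinner x (P y) = - (of_real t * (cinner x (P y) * cnj (cinner x (P y))) / of_real b)"
        by (simp add: c_def)
      also have "\<dots> = - (of_real t * of_real (b\<^sup>2) / of_real b)"
        by (simp only: b_def complex_norm_square)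
      finally show ?thesis using b by (simp add: power2_eq_square)
    qed
    have "cmod c = \<bar>t\<bar>" using b by (simp add: c_def norm_mult norm_divide) (simp add: b_def)
    then have "cnj c * c = of_real (t\<^sup>2)"
      by (metis complex_norm_square mult.commute power2_abs)
    then have c2: "Re (cnj c * (c * cinner y (P y))) = t\<^sup>2 * q"
      unfolding mult.assoc[symmetric] by (simp add: q_def del: of_real_power)
    have c3: "cnj c * cinner y (P x) = cnj (c * cinner x (P y))"
      using positive_op_cinner[OF P, of y x] cinner_commute[of "P y" x] by simp
    have "0 \<le> Re (cinner (x + c *\<^sub>C y) (P (x + c *\<^sub>C y)))"
      by (rule positive_op_Re[OF P])
    also have "\<dots> = p + Re (c * cinner x (P y)) + Re (cnj c * cinner y (P x)) + Re (cnj c * (c * cinner y (P y)))"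
      by (simp add: blinfun.add_right cinner.add_left cinner.add_right bounded_opsD[OF Pb] p_def
          distrib_left mult.left_commute del: times_complex.sel)
    also have "\<dots> = p - 2 * t * b + t\<^sup>2 * q"
      unfolding c3 c2 c1 by simp
    finally show ?thesis .
  qed
  have "b\<^sup>2 \<le> p * q"
  proof (cases "q = 0")
    case True
    then have False
      using quad[of "(p + 1) / (2 * b)"] b by (simp add: field_simps)
    then show ?thesis ..
  next
    case False
    then show ?thesis
      using quad[of "b / q"] q by (simp add: field_simps power2_eq_square)
  qed
  then show ?thesis by (simp add: b_def p_def q_def)
qed

lemma positive_op_null:
  assumes "positive_op P" "cinner y (P y) = 0" shows "P y = 0"
proof -
  have "cinner x (P y) = cinner x 0" for x
    using positive_op_schwarz[OF assms(1), of x y] assms(2) by simp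
  then show ?thesis by (rule cinner_eq_ext)
qed

lemma Re_cinner_op_le: "Re (cinner x (blinfun_apply S x)) \<le> norm S * (norm (x::'a::complex_hilbert))\<^sup>2"
proof -
  have "Re (cinner x (S x)) \<le> norm x * norm (S x)"
    using norm_cinner_le[of x "S x"] complex_Re_le_cmod order_trans by blast
  also have "\<dots> \<le> norm x * (norm S * norm x)"
    by (intro mult_left_mono norm_blinfun) auto
  finally show ?thesis by (simp add: power2_eq_square ac_simps)
qed

lemma positive_op_norm_le_one:
  assumes P: "positive_op P" and le: "\<And>x. Re (cinner x (P x)) \<le> (norm x)\<^sup>2"
  shows "norm P \<le> 1"
proof (rule norm_blinfun_bound)
  fix y
  have "((norm (P y))\<^sup>2)\<^sup>2 \<le> Re (cinner (P y) (P (P y))) * Re (cinner y (P y))"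
    using positive_op_schwarz[OF P, of "P y" y] by (simp add: cinner_self norm_power)
  also have "\<dots> \<le> (norm (P y))\<^sup>2 * (norm y)\<^sup>2"
    by (intro mult_mono le positive_op_Re[OF P]) auto
  finally have "(norm (P y))\<^sup>2 \<le> (norm y)\<^sup>2"
    by (cases "P y = 0") (auto simp: power2_eq_square)
  then show "norm (P y) \<le> 1 * norm y"
    by (simp add: power_mono_iff)
qed simp


lemma positive_opI_symmetric:
  assumes "P \<in> bounded_ops" "\<And>x y. cinner (P x) y = cinner x (P y)" "\<And>x. 0 \<le> Re (cinner x (P x))"
  shows "positive_op P"
proof (rule positive_opI)
  fix x
  have "Im (cinner x (P x)) = 0"
    using assms(2)[of x x] cinner_commute[of x "P x"] by (metis complex_cnj_cancel_iff complex_eq_iff cnj.simps(2) neg_equal_zero)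
  then show "\<exists>r\<ge>0. cinner x (P x) = complex_of_real r"
    using assms(3)[of x] by (intro exI[of _ "Re (cinner x (P x))"]) (simp add: complex_eq_iff)
qed (rule assms(1))

text \<open>
  The iteration \<open>Y \<mapsto> (X + Y\<^sup>2) / 2\<close> with \<open>X = 1 - A\<close> has as fixed points the \<open>Y\<close> with
  \<open>(1 - Y)\<^sup>2 = A\<close>. As \<open>\<parallel>X\<parallel> \<le> 1\<close>, the increments are majorized by those of the same scalar
  iteration with \<open>X\<close> replaced by \<open>1\<close>, which increases and is bounded by \<open>1\<close>; hence it
  converges in norm.
\<close>

lemma positive_sqrt_exists_contraction:
  fixes A :: "'a::complex_hilbert op"
  assumes A: "positive_op A" and norm_A: "norm A \<le> 1"
  shows "\<exists>Q. positive_op Q \<and> Q o\<^sub>L Q = A \<and> (\<forall>C. A o\<^sub>L C = C o\<^sub>L A \<longrightarrow> Q o\<^sub>L C = C o\<^sub>L Q)"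
proof -
  define X where "X = id_blinfun - A"
  have Re_le: "Re (cinner x (S x)) \<le> (norm x)\<^sup>2" if "norm S \<le> 1" for S :: "'a op" and x
    using Re_cinner_op_le[of x S] mult_right_mono[OF that, of "(norm x)\<^sup>2"] by simp
  have X: "positive_op X"
  proof (rule positive_opI_symmetric)
    show "cinner (X x) y = cinner x (X y)" for x y
      by (simp add: X_def blinfun.diff_left cinner.diff_left cinner.diff_right positive_op_cinner[OF A])
    show "0 \<le> Re (cinner x (X x))" for x
      using Re_le[OF norm_A, of x] by (simp add: X_def blinfun.diff_left cinner.diff_right cinner_self)
  qed (use A in \<open>auto simp: X_def\<close>)
  have norm_X: "norm X \<le> 1"
  proof (rule positive_op_norm_le_one[OF X])
    show "Re (cinner x (X x)) \<le> (norm x)\<^sup>2" for x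
      using positive_op_Re[OF A, of x] by (simp add: X_def blinfun.diff_left cinner.diff_right cinner_self)
  qed
  define Y where "Y = rec_nat (0::'a op) (\<lambda>_ Y. (1/2) *\<^sub>R (X + (Y o\<^sub>L Y)))"
  define y where "y = rec_nat (0::real) (\<lambda>_ y. (1 + y * y) / 2)"
  have Y_Suc: "Y (Suc n) = (1/2) *\<^sub>R (X + (Y n o\<^sub>L Y n))" and y_Suc: "y (Suc n) = (1 + y n * y n) / 2"
    and Y0: "Y 0 = 0" and y0: "y 0 = 0" for n
    by (simp_all add: Y_def y_def)
  have y_bounds: "0 \<le> y n \<and> y n \<le> 1" for n
  proof (induction n)
    case (Suc n)
    then have "y n * y n \<le> 1 * 1" by (intro mult_mono) auto
    then show ?case using Suc by (simp add: y_Suc)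
  qed (simp add: y0)
  have y_mono: "y n \<le> y (Suc n)" for n
  proof -
    have "0 \<le> (1 - y n) * (1 - y n)" by simp
    then show ?thesis by (simp add: y_Suc algebra_simps)
  qed
  have norm_Y: "norm (Y n) \<le> y n" for n
  proof (induction n)
    case (Suc n)
    have "norm (Y n o\<^sub>L Y n) \<le> y n * y n"
      using Suc y_bounds[of n] by (intro order_trans[OF norm_blinfun_compose] mult_mono) auto
    then have "norm (X + (Y n o\<^sub>L Y n)) \<le> 1 + y n * y n"
      using norm_X by (intro norm_triangle_mono)
    then show ?case by (simp add: Y_Suc y_Suc)
  qed (simp add: Y0 y0)
  have incr: "norm (Y (Suc n) - Y n) \<le> y (Suc n) - y n" for n
  proof (induction n)
    case 0
    then show ?case using norm_X by (simp add: Y_Suc Y0 y_Suc y0)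
  next
    case (Suc n)
    define D where "D = Y (Suc n) - Y n"
    have "Y (Suc (Suc n)) - Y (Suc n) = (1/2) *\<^sub>R ((Y (Suc n) o\<^sub>L D) + (D o\<^sub>L Y n))"
      by (subst (1 2) Y_Suc)
        (simp add: D_def blinfun_compose_diff_left blinfun_compose_diff_right scaleR_diff_right[symmetric])
    moreover have "norm ((Y (Suc n) o\<^sub>L D) + (D o\<^sub>L Y n)) \<le> y (Suc n) * (y (Suc n) - y n) + (y (Suc n) - y n) * y n"
      using Suc norm_Y y_bounds y_mono
      by (intro norm_triangle_mono order_trans[OF norm_blinfun_compose] mult_mono) (auto simp: D_def)
    moreover have "y (Suc (Suc n)) - y (Suc n) = (y (Suc n) * (y (Suc n) - y n) + (y (Suc n) - y n) * y n) / 2"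
      using y_Suc[of n] by (simp add: y_Suc[of "Suc n"] field_simps)
    ultimately show ?case by simp
  qed
  have dist_Y: "norm (Y m - Y n) \<le> y m - y n" if "n \<le> m" for m n
    using that
  proof (induction m rule: dec_induct)
    case (step m)
    have "Y (Suc m) - Y n = (Y (Suc m) - Y m) + (Y m - Y n)" by simp
    then show ?case using norm_triangle_mono[OF incr[of m] step.IH] by simp
  qed simp
  have "convergent y"
    using y_mono y_bounds by (intro Bseq_mono_convergent BseqI'[where K = 1]) (auto simp: lift_Suc_mono_le)
  then have "Cauchy y" by (rule convergent_Cauchy)
  have "Cauchy Y"
  proof (rule metric_CauchyI)
    fix e :: real assume "e > 0"
    then obtain N where N: "\<forall>m\<ge>N. \<forall>n\<ge>N. dist (y m) (y n) < e"
      using \<open>Cauchy y\<close> unfolding Cauchy_def by blast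
    have "dist (Y m) (Y n) < e" if "m \<ge> N" "n \<ge> N" for m n
    proof -
      have "norm (Y m - Y n) \<le> dist (y m) (y n)"
        using dist_Y[of m n] dist_Y[of n m] by (cases "n \<le> m") (auto simp: dist_real_def norm_minus_commute)
      then show ?thesis using N that by (metis dist_norm le_less_trans)
    qed
    then show "\<exists>M. \<forall>m\<ge>M. \<forall>n\<ge>M. dist (Y m) (Y n) < e" by blast
  qed
  then obtain L where L: "Y \<longlonglongrightarrow> L"
    using Cauchy_convergent_iff convergent_def by blast
  have compose_lim: "(\<lambda>n. F n o\<^sub>L G n) \<longlonglongrightarrow> (f o\<^sub>L g)" if "F \<longlonglongrightarrow> f" "G \<longlonglongrightarrow> g"
    for F G :: "nat \<Rightarrow> 'a op" and f g
    using that by (rule bounded_bilinear.tendsto[OF bounded_bilinear_blinfun_compose])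
  have fixpoint: "L = (1/2) *\<^sub>R (X + (L o\<^sub>L L))"
  proof (rule LIMSEQ_unique)
    show "(\<lambda>n. Y (Suc n)) \<longlonglongrightarrow> L" using L by (rule LIMSEQ_Suc)
    show "(\<lambda>n. Y (Suc n)) \<longlonglongrightarrow> (1/2) *\<^sub>R (X + (L o\<^sub>L L))"
      unfolding Y_Suc by (intro tendsto_intros compose_lim L)
  qed
  have Y_ops: "Y n \<in> bounded_ops" for n
    using X by (induction n) (auto simp: Y0 Y_Suc)
  then have L_ops: "L \<in> bounded_ops"
    using L closed_bounded_ops closed_sequentially by blast
  have Y_sym: "cinner (Y n x) z = cinner x (Y n z)" for n x z
    by (induction n arbitrary: x z)
      (simp_all add: Y0 Y_Suc blinfun.scaleR_left blinfun.add_left cinner.add_left cinner.add_right positive_op_cinner[OF X])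
  have L_sym: "cinner (L x) z = cinner x (L z)" for x z
  proof (rule LIMSEQ_unique)
    show "(\<lambda>n. cinner (Y n x) z) \<longlonglongrightarrow> cinner (L x) z"
      by (intro cinner.tendsto blinfun.tendsto L tendsto_const)
    show "(\<lambda>n. cinner (Y n x) z) \<longlonglongrightarrow> cinner x (L z)"
      unfolding Y_sym by (intro cinner.tendsto blinfun.tendsto L tendsto_const)
  qed
  have norm_L: "norm L \<le> 1"
  proof (rule LIMSEQ_le_const2)
    show "(\<lambda>n. norm (Y n)) \<longlonglongrightarrow> norm L" by (intro tendsto_norm L)
    show "\<exists>N. \<forall>n\<ge>N. norm (Y n) \<le> 1" using norm_Y y_bounds order_trans by blast
  qed
  define Q where "Q = id_blinfun - L"
  have "positive_op Q"
  proof (rule positive_opI_symmetric)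
    show "cinner (Q x) y = cinner x (Q y)" for x y
      by (simp add: Q_def blinfun.diff_left cinner.diff_left cinner.diff_right L_sym)
    show "0 \<le> Re (cinner x (Q x))" for x
      using Re_le[OF norm_L, of x] by (simp add: Q_def blinfun.diff_left cinner.diff_right cinner_self)
  qed (use L_ops in \<open>auto simp: Q_def\<close>)
  moreover have "Q o\<^sub>L Q = A"
  proof -
    have "2 *\<^sub>R L = X + (L o\<^sub>L L)" by (subst fixpoint) simp
    then show ?thesis
      by (simp add: Q_def X_def blinfun_compose_diff_left blinfun_compose_diff_right scaleR_2 algebra_simps)
  qed
  moreover have "Q o\<^sub>L C = C o\<^sub>L Q" if C: "A o\<^sub>L C = C o\<^sub>L A" for C
  proof -
    have XC: "X o\<^sub>L C = C o\<^sub>L X"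
      by (simp add: X_def blinfun_compose_diff_left blinfun_compose_diff_right C)
    have YC: "Y n o\<^sub>L C = C o\<^sub>L Y n" for n
    proof (induction n)
      case (Suc n)
      have "(Y n o\<^sub>L Y n) o\<^sub>L C = C o\<^sub>L (Y n o\<^sub>L Y n)"
        by (metis Suc blinfun_compose_assoc)
      then show ?case
        using XC by (simp add: Y_Suc blinfun_eq_iff blinfun.scaleR_left blinfun.add_left blinfun.scaleR_right blinfun.add_right)
    qed (auto intro!: blinfun_eqI simp: Y0)
    have "L o\<^sub>L C = C o\<^sub>L L"
    proof (rule LIMSEQ_unique)
      show "(\<lambda>n. Y n o\<^sub>L C) \<longlonglongrightarrow> (L o\<^sub>L C)" by (intro compose_lim L tendsto_const)
      show "(\<lambda>n. Y n o\<^sub>L C) \<longlonglongrightarrow> (C o\<^sub>L L)" unfolding YC by (intro compose_lim L tendsto_const)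
    qed
    then show ?thesis by (simp add: Q_def blinfun_compose_diff_left blinfun_compose_diff_right)
  qed
  ultimately show ?thesis by blast
qed

lemma positive_op_scaleR: "positive_op P \<Longrightarrow> r \<ge> 0 \<Longrightarrow> positive_op (r *\<^sub>R P)"
  by (rule positive_opI_symmetric) (auto simp: blinfun.scaleR_left positive_op_cinner positive_op_Re)

lemma positive_sqrt_exists:
  fixes A :: "'a::complex_hilbert op"
  assumes A: "positive_op A"
  shows "\<exists>Q. positive_op Q \<and> Q o\<^sub>L Q = A \<and> (\<forall>C. A o\<^sub>L C = C o\<^sub>L A \<longrightarrow> Q o\<^sub>L C = C o\<^sub>L Q)"
proof (cases "A = 0")
  case True
  then show ?thesis
    by (intro exI[of _ 0]) (auto intro!: blinfun_eqI simp: positive_op_def)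
next
  case False
  define a where "a = norm A"
  have a: "a > 0" using False by (simp add: a_def)
  define A1 where "A1 = (1 / a) *\<^sub>R A"
  have A_eq: "A = a *\<^sub>R A1" using a by (simp add: A1_def)
  have "positive_op A1" "norm A1 \<le> 1"
    using a A by (auto simp: A1_def a_def intro: positive_op_scaleR)
  then have "\<exists>Q. positive_op Q \<and> Q o\<^sub>L Q = A1 \<and> (\<forall>C. A1 o\<^sub>L C = C o\<^sub>L A1 \<longrightarrow> Q o\<^sub>L C = C o\<^sub>L Q)"
    by (rule positive_sqrt_exists_contraction)
  then obtain Q where Q: "positive_op Q" "Q o\<^sub>L Q = A1" "\<forall>C. A1 o\<^sub>L C = C o\<^sub>L A1 \<longrightarrow> Q o\<^sub>L C = C o\<^sub>L Q"
    by (elim exE conjE) (rule that)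
  show ?thesis
  proof (intro exI[of _ "sqrt a *\<^sub>R Q"] conjI allI impI)
    show "positive_op (sqrt a *\<^sub>R Q)" using Q(1) a by (simp add: positive_op_scaleR)
    show "sqrt a *\<^sub>R Q o\<^sub>L sqrt a *\<^sub>R Q = A"
      using a Q(2) by (auto simp: A_eq blinfun_eq_iff blinfun.scaleR_left blinfun.scaleR_right)
    fix C assume C: "A o\<^sub>L C = C o\<^sub>L A"
    have "A1 o\<^sub>L C = C o\<^sub>L A1"
      using C by (simp add: A1_def blinfun_eq_iff blinfun.scaleR_left blinfun.scaleR_right)
    then have "Q o\<^sub>L C = C o\<^sub>L Q" by (rule Q(3)[rule_format])
    then show "sqrt a *\<^sub>R Q o\<^sub>L C = C o\<^sub>L sqrt a *\<^sub>R Q"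
      by (simp add: blinfun_eq_iff blinfun.scaleR_left blinfun.scaleR_right)
  qed
qed

text \<open>
  Both roots commute with a root \<open>S\<close> that commutes with everything commuting with \<open>P\<^sup>2\<close>. On the
  range of \<open>P - S\<close> the forms of \<open>P\<close> and \<open>S\<close> add up to \<open>0\<close>, hence both vanish there.
\<close>

lemma positive_sqrt_unique:
  fixes P Q :: "'a::complex_hilbert op"
  assumes P: "positive_op P" and Q: "positive_op Q" and eq: "P o\<^sub>L P = Q o\<^sub>L Q"
  shows "P = Q"
proof -
  have "positive_op (P o\<^sub>L P)"
    using positive_op_adj_compose[OF positive_op_bounded_ops[OF P]] by (simp add: positive_op_adj[OF P])
  from positive_sqrt_exists[OF this] obtain S where S: "positive_op S" "S o\<^sub>L S = P o\<^sub>L P"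
    "\<forall>C. (P o\<^sub>L P) o\<^sub>L C = C o\<^sub>L (P o\<^sub>L P) \<longrightarrow> S o\<^sub>L C = C o\<^sub>L S"
    by (elim exE conjE) (rule that)
  have root_eq: "R = S" if R: "positive_op R" and RR: "R o\<^sub>L R = P o\<^sub>L P" for R
  proof (rule blinfun_eqI)
    fix x
    have "(P o\<^sub>L P) o\<^sub>L R = R o\<^sub>L (P o\<^sub>L P)"
      unfolding RR[symmetric] by (rule blinfun_compose_assoc)
    from S(3)[rule_format, OF this] have comm: "S (R z) = R (S z)" for z
      by (simp add: blinfun_eq_iff)
    have "R o\<^sub>L R = S o\<^sub>L S"
      using RR S(2) by simp
    then have sq: "R (R z) = S (S z)" for z
      by (simp add: blinfun_eq_iff)
    define y where "y = R x - S x"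
    have "R y + S y = 0"
      by (simp add: y_def blinfun.diff_right sq comm)
    then have "Re (cinner y (R y + S y)) = 0"
      by simp
    then have "Re (cinner y (R y)) + Re (cinner y (S y)) = 0"
      by (simp add: cinner.add_right)
    then have "Re (cinner y (R y)) = 0" "Re (cinner y (S y)) = 0"
      using positive_op_Re[OF R, of y] positive_op_Re[OF S(1), of y] by linarith+
    then have "cinner y (R y) = 0" "cinner y (S y) = 0"
      using positive_op_real[OF R, of y] positive_op_real[OF S(1), of y] by simp_all
    then have "R y = 0" "S y = 0"
      using positive_op_null R S(1) by blast+
    then have "cinner y y = 0"
      using positive_op_cinner[OF R, of x y] positive_op_cinner[OF S(1), of x y]
      by (subst (1) y_def) (simp add: cinner.diff_left)
    then show "R x = S x" by (simp add: cinner_self y_def)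
  qed
  show ?thesis
    using root_eq[OF P refl] root_eq[OF Q eq[symmetric]] by simp
qed

lemma abs_op_properties:
  assumes T: "T \<in> bounded_ops"
  shows "positive_op (abs_op T) \<and> abs_op T o\<^sub>L abs_op T = adj T o\<^sub>L T"
proof -
  obtain Q where Q: "positive_op Q \<and> Q o\<^sub>L Q = adj T o\<^sub>L T"
    using positive_sqrt_exists[OF positive_op_adj_compose[OF T]] by (elim exE conjE) (rule that, rule conjI)
  show ?thesis
    unfolding abs_op_def
  proof (rule theI[where P = "\<lambda>P. positive_op P \<and> P o\<^sub>L P = adj T o\<^sub>L T", OF Q])
    show "Q' = Q" if "positive_op Q' \<and> Q' o\<^sub>L Q' = adj T o\<^sub>L T" for Q'
      by (rule positive_sqrt_unique) (use that Q in simp_all)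
  qed
qed

lemma positive_abs_op: "T \<in> bounded_ops \<Longrightarrow> positive_op (abs_op T)"
  by (simp add: abs_op_properties)

lemma abs_op_bounded_ops [simp, intro]: "T \<in> bounded_ops \<Longrightarrow> abs_op T \<in> bounded_ops"
  by (rule positive_op_bounded_ops[OF positive_abs_op])

lemma abs_op_positive [simp]:
  assumes "positive_op P" shows "abs_op P = P"
proof (rule positive_sqrt_unique)
  have P: "P \<in> bounded_ops" using assms by (rule positive_op_bounded_ops)
  then show "positive_op (abs_op P)" by (rule positive_abs_op)
  show "abs_op P o\<^sub>L abs_op P = P o\<^sub>L P"
    using abs_op_properties[OF P] positive_op_adj[OF assms] by simp
qed (rule assms)

lemma cinner_abs_op:
  assumes "T \<in> bounded_ops"
  shows "cinner (abs_op T x) (abs_op T y) = cinner (T x) (T y)"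
proof -
  have "cinner (abs_op T x) (abs_op T y) = cinner x ((abs_op T o\<^sub>L abs_op T) y)"
    using positive_op_cinner[OF positive_abs_op[OF assms]] by simp
  then show ?thesis
    using abs_op_properties[OF assms] by (simp add: cinner_adj_right assms)
qed

text \<open>
  \<open>V\<close> is the adjoint of the partial isometry in \<open>T = V\<^sup>* \<bar>T\<bar>\<close>.
\<close>

lemma polar_decomposition:
  fixes T :: "'a::complex_hilbert op"
  assumes T: "T \<in> bounded_ops"
  obtains V where "V \<in> bounded_ops" "norm V \<le> 1" "V o\<^sub>L T = abs_op T" "T = adj V o\<^sub>L abs_op T"
proof -
  define P where "P = abs_op T"
  have P: "P \<in> bounded_ops" "positive_op P"
    unfolding P_def using T by (rule abs_op_bounded_ops, rule positive_abs_op)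
  have PT: "cinner (P x) (P y) = cinner (T x) (T y)" for x y
    by (simp add: P_def cinner_abs_op T)
  have norm_PT: "norm (P z) = norm (T z)" for z
    using PT[of z z] by (simp add: cinner_self flip: of_real_power)
  have bound: "cmod (cinner x (T z)) \<le> 1 * norm x * norm (P z)" for x z
    using norm_cinner_le[of x "T z"] by (simp add: norm_PT)
  obtain V where V: "V \<in> bounded_ops" "\<And>x z. cinner (V x) (P z) = cinner x (T z)"
    "\<And>x. V x \<in> closure (range P)" "norm V \<le> 1"
    by (rule sesquilinear_form_representation[where b = "\<lambda>x z. cinner x (T z)" and P = P, OF P(1) _ _ _ _ _ bound])
      (auto simp: cinner.add_left cinner.add_right blinfun.add_right bounded_opsD[OF T])
  have "V (T y) = P y" for y
  proof -
    define u where "u = V (T y) - P y"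
    have "closure (range P) \<subseteq> {w. cinner u w = 0}"
      by (intro closure_minimal closed_Collect_eq continuous_intros cinner.continuous_on)
        (auto simp: u_def cinner.diff_left V(2) PT)
    moreover have "P y \<in> closure (range P)"
      by (rule subsetD[OF closure_subset]) simp
    ultimately have "cinner u (V (T y)) = 0" "cinner u (P y) = 0"
      using V(3)[of "T y"] by auto
    then have "cinner u u = 0"
      by (subst (2) u_def) (simp add: cinner.diff_right)
    then show ?thesis by (simp add: cinner_self u_def)
  qed
  then have 1: "V o\<^sub>L T = P" by (auto intro: blinfun_eqI)
  have 2: "T = adj V o\<^sub>L P"
    by (rule op_eqI) (simp add: cinner_adj_right V)
  show ?thesis by (rule that[OF V(1,4) 1[unfolded P_def] 2[unfolded P_def]])
qed

section \<open>Orthonormal bases\<close>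

definition orthonormal :: "'a::complex_hilbert set \<Rightarrow> bool" where
  "orthonormal E \<longleftrightarrow> (\<forall>e\<in>E. norm e = 1) \<and> (\<forall>e\<in>E. \<forall>f\<in>E. e \<noteq> f \<longrightarrow> cinner e f = 0)"

lemma is_onb_orthonormal: "is_onb E \<Longrightarrow> orthonormal E"
  by (simp add: is_onb_def orthonormal_def)

lemma orthonormal_subset: "orthonormal E \<Longrightarrow> F \<subseteq> E \<Longrightarrow> orthonormal F"
  by (auto simp: orthonormal_def subset_iff)

lemma is_onb_eq_0: "is_onb E \<Longrightarrow> (\<And>e. e \<in> E \<Longrightarrow> cinner e x = 0) \<Longrightarrow> x = 0"
  by (simp add: is_onb_def)

lemma orthonormal_cinner: "orthonormal E \<Longrightarrow> e \<in> E \<Longrightarrow> f \<in> E \<Longrightarrow> cinner e f = (if e = f then 1 else 0)"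
  by (simp add: orthonormal_def cinner_self)

text \<open>
  A maximal orthonormal set, which exists by Zorn's lemma, is a basis.
\<close>

lemma is_onb_exists: "\<exists>E :: 'a::complex_hilbert set. is_onb E"
proof -
  have "\<exists>E\<in>Collect orthonormal. \<forall>F\<in>Collect (orthonormal :: 'a set \<Rightarrow> bool). E \<subseteq> F \<longrightarrow> F = E"
  proof (rule subset_Zorn_nonempty)
    have "orthonormal ({} :: 'a set)" by (simp add: orthonormal_def)
    then show "Collect (orthonormal :: 'a set \<Rightarrow> bool) \<noteq> {}" by blast
    fix C :: "'a set set" assume C: "subset.chain (Collect orthonormal) C"
    have "orthonormal (\<Union>C)"
      unfolding orthonormal_def
    proof (intro conjI ballI impI)
      show "norm e = 1" if "e \<in> \<Union>C" for e
        using that C by (auto simp: subset.chain_def orthonormal_def)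
      show "cinner e f = 0" if e: "e \<in> \<Union>C" and f: "f \<in> \<Union>C" and ef: "e \<noteq> f" for e f
      proof -
        obtain X Y where XY: "X \<in> C" "e \<in> X" "Y \<in> C" "f \<in> Y" using e f by blast
        then have "X \<subseteq> Y \<or> Y \<subseteq> X" using C by (auto simp: subset.chain_def)
        moreover have "orthonormal X" "orthonormal Y" using XY C by (auto simp: subset.chain_def)
        ultimately show ?thesis
          using XY ef by (auto simp: orthonormal_def subset_iff)
      qed
    qed
    then show "\<Union>C \<in> Collect orthonormal" by simp
  qed
  then obtain E :: "'a set" where E: "orthonormal E" and max: "\<And>F. orthonormal F \<Longrightarrow> E \<subseteq> F \<Longrightarrow> F = E"
    by auto
  have "x = 0" if x: "\<forall>e\<in>E. cinner e x = 0" for x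
  proof (rule ccontr)
    assume "x \<noteq> 0"
    define u where "u = (1 / norm x) *\<^sub>R x"
    have u: "norm u = 1" using \<open>x \<noteq> 0\<close> by (simp add: u_def)
    have eu: "cinner e u = 0" "cinner u e = 0" if "e \<in> E" for e
      using x that cinner_commute[of x e] by (auto simp: u_def)
    have "orthonormal (insert u E)"
      using E u eu by (auto simp: orthonormal_def)
    then have "u \<in> E" using max[of "insert u E"] by auto
    then have "cinner u u = 0" using eu by blast
    then show False using u by (simp add: cinner_self)
  qed
  then have "is_onb E" using E by (simp add: is_onb_def orthonormal_def)
  then show ?thesis ..
qed

lemma is_onb_some_onb: "is_onb some_onb"
  unfolding some_onb_def by (rule someI_ex[OF is_onb_exists])

lemma norm_minus_projection:
  assumes E: "orthonormal E" and F: "finite F" "F \<subseteq> E"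
  shows "(norm (x - (\<Sum>e\<in>F. cinner e x *\<^sub>C e)))\<^sup>2 = (norm x)\<^sup>2 - (\<Sum>e\<in>F. (cmod (cinner e x))\<^sup>2)"
proof -
  define p where "p = (\<Sum>e\<in>F. cinner e x *\<^sub>C e)"
  have px: "cinner p x = of_real (\<Sum>e\<in>F. (cmod (cinner e x))\<^sup>2)"
    by (simp add: p_def cinner.sum_left complex_norm_square mult.commute del: of_real_power)
  have "cinner e p = cinner e x" if "e \<in> F" for e
  proof -
    have "cinner e p = (\<Sum>f\<in>F. if f = e then cinner e x else 0)"
      unfolding p_def cinner.sum_right
      by (rule sum.cong) (use that orthonormal_cinner[OF orthonormal_subset[OF E F(2)]] in auto)
    then show ?thesis using that F by simp
  qed
  then have "(\<Sum>e\<in>F. cnj (cinner e x) * cinner e p) = (\<Sum>e\<in>F. cnj (cinner e x) * cinner e x)"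
    by simp
  then have "cinner p p = cinner p x"
    by (simp only: p_def cinner.sum_left cinner_scaleC_left)
  moreover have "cinner x p = cnj (cinner p x)" by (rule cinner_commute)
  ultimately have "Re (cinner (x - p) (x - p)) = (norm x)\<^sup>2 - (\<Sum>e\<in>F. (cmod (cinner e x))\<^sup>2)"
    by (simp add: cinner.diff_left cinner.diff_right px) (simp add: cinner_self flip: of_real_power)
  then show ?thesis by (simp add: cinner_self p_def flip: of_real_power)
qed

lemma bessel_inequality:
  assumes "orthonormal E" "finite F" "F \<subseteq> E"
  shows "(\<Sum>e\<in>F. (cmod (cinner e x))\<^sup>2) \<le> (norm x)\<^sup>2"
  using norm_minus_projection[OF assms, of x] by (smt (verit) zero_le_power2)

lemma cauchy_schwarz_infsum:
  fixes a b :: "'i \<Rightarrow> real"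
  assumes a: "(\<lambda>i. (a i)\<^sup>2) summable_on E" and b: "(\<lambda>i. (b i)\<^sup>2) summable_on E"
    and nonneg: "\<And>i. i \<in> E \<Longrightarrow> a i \<ge> 0" "\<And>i. i \<in> E \<Longrightarrow> b i \<ge> 0"
  shows "(\<lambda>i. a i * b i) summable_on E"
    and "infsum (\<lambda>i. a i * b i) E \<le> sqrt (infsum (\<lambda>i. (a i)\<^sup>2) E) * sqrt (infsum (\<lambda>i. (b i)\<^sup>2) E)"
proof -
  have fin: "(\<Sum>i\<in>F. a i * b i) \<le> sqrt (infsum (\<lambda>i. (a i)\<^sup>2) E) * sqrt (infsum (\<lambda>i. (b i)\<^sup>2) E)"
    if F: "finite F" "F \<subseteq> E" for F
  proof -
    have "(\<Sum>i\<in>F. a i * b i)\<^sup>2 \<le> (\<Sum>i\<in>F. (a i)\<^sup>2) * (\<Sum>i\<in>F. (b i)\<^sup>2)"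
      by (rule Cauchy_Schwarz_ineq_sum)
    also have "\<dots> \<le> infsum (\<lambda>i. (a i)\<^sup>2) E * infsum (\<lambda>i. (b i)\<^sup>2) E"
      using F by (intro mult_mono finite_sum_le_infsum a b infsum_nonneg sum_nonneg) auto
    finally show ?thesis
      by (simp add: real_le_rsqrt flip: real_sqrt_mult)
  qed
  show sm: "(\<lambda>i. a i * b i) summable_on E"
    using fin nonneg by (intro nonneg_bdd_above_summable_on) (auto intro!: bdd_aboveI2 mult_nonneg_nonneg)
  show "infsum (\<lambda>i. a i * b i) E \<le> sqrt (infsum (\<lambda>i. (a i)\<^sup>2) E) * sqrt (infsum (\<lambda>i. (b i)\<^sup>2) E)"
    by (rule infsum_le_finite_sums[OF sm fin])
qed

text \<open>
  The sum of the series is a bounded form in \<open>x\<close> and \<open>z\<close>; the operator representing it fixes the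
  inner products with all basis vectors, so it is the identity.
\<close>

lemma parseval_cinner:
  fixes x z :: "'a::complex_hilbert"
  assumes E: "is_onb E"
  shows "((\<lambda>e. cinner x e * cinner e z) has_sum cinner x z) E"
proof -
  have orth: "orthonormal E" using E by (rule is_onb_orthonormal)
  have sq: "(\<lambda>e. (cmod (cinner e x))\<^sup>2) summable_on E" for x
    using bessel_inequality[OF orth] by (intro nonneg_bdd_above_summable_on) (auto intro!: bdd_aboveI2)
  have sq_le: "infsum (\<lambda>e. (cmod (cinner e x))\<^sup>2) E \<le> (norm x)\<^sup>2" for x
    by (rule infsum_le_finite_sums[OF sq bessel_inequality[OF orth]])
  have cm: "cmod (cinner x e * cinner e z) = cmod (cinner e x) * cmod (cinner e z)" for x e z
    by (metis cinner_commute complex_mod_cnj norm_mult)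
  have abs: "(\<lambda>e. cmod (cinner x e * cinner e z)) summable_on E" for x z
    unfolding cm by (rule cauchy_schwarz_infsum(1)) (auto intro: sq)
  then have sm: "(\<lambda>e. cinner x e * cinner e z) summable_on E" for x z
    by (rule abs_summable_summable)
  define b where "b x z = infsum (\<lambda>e. cinner x e * cinner e z) E" for x z
  have bound: "cmod (b x z) \<le> 1 * norm x * norm (id_blinfun z)" for x z
  proof -
    have "cmod (b x z) \<le> infsum (\<lambda>e. cmod (cinner e x) * cmod (cinner e z)) E"
      unfolding b_def using norm_infsum_bound[OF abs[of x z]] by (simp add: cm)
    also have "\<dots> \<le> sqrt (infsum (\<lambda>e. (cmod (cinner e x))\<^sup>2) E) * sqrt (infsum (\<lambda>e. (cmod (cinner e z))\<^sup>2) E)"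
      by (rule cauchy_schwarz_infsum(2)) (auto intro: sq)
    also have "\<dots> \<le> sqrt ((norm x)\<^sup>2) * sqrt ((norm z)\<^sup>2)"
      by (intro mult_mono real_sqrt_le_mono sq_le) (auto intro: infsum_nonneg)
    finally show ?thesis by simp
  qed
  obtain V where V: "\<And>x z. cinner (blinfun_apply V x) (id_blinfun z) = b x z"
  proof (rule sesquilinear_form_representation[where b = b and P = id_blinfun, OF _ _ _ _ _ _ bound])
    show "b (x + y) z = b x z + b y z" for x y z
      unfolding b_def by (simp add: cinner.add_left distrib_right infsum_add[OF sm sm])
    show "b x (y + z) = b x y + b x z" for x y z
      unfolding b_def by (simp add: cinner.add_right distrib_left infsum_add[OF sm sm])
    show "b (c *\<^sub>C x) z = cnj c * b x z" for c x z
      unfolding b_def by (simp add: mult.assoc infsum_cmult_right')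
    show "b x (c *\<^sub>C z) = c * b x z" for c x z
      unfolding b_def by (simp add: mult.left_commute infsum_cmult_right')
  qed auto
  have "cinner (V x) e = cinner x e" if "e \<in> E" for e
  proof -
    have "((\<lambda>f. cinner x f * cinner f e) has_sum cinner x e) E"
      by (rule has_sum_finite_neutralI[of "{e}"])
        (use that in \<open>auto simp: orthonormal_cinner[OF orth]\<close>)
    then have "b x e = cinner x e" unfolding b_def by (rule infsumI)
    then show ?thesis using V[of x e] by simp
  qed
  then have "V x - x = 0"
    by (intro is_onb_eq_0[OF E]) (metis cinner.diff_right cinner_commute eq_iff_diff_eq_0)
  then have "b x z = cinner x z" using V[of x z] by simp
  then show ?thesis using has_sum_infsum[OF sm, of x z] by (simp add: b_def)
qed

lemma parseval:
  assumes "is_onb E"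
  shows "((\<lambda>e. (cmod (cinner e x))\<^sup>2) has_sum (norm x)\<^sup>2) E"
proof -
  have "cinner x e * cinner e x = of_real ((cmod (cinner e x))\<^sup>2)" for e
    by (metis cinner_commute complex_norm_square mult.commute)
  then have "((\<lambda>e. complex_of_real ((cmod (cinner e x))\<^sup>2)) has_sum complex_of_real ((norm x)\<^sup>2)) E"
    using parseval_cinner[OF assms, of x x] by (simp only: cinner_self)
  then show ?thesis by (simp only: has_sum_of_real_iff)
qed

section \<open>Hilbert--Schmidt operators\<close>

lemma nonneg_has_sum_swap:
  fixes g :: "'i \<Rightarrow> 'j \<Rightarrow> real"
  assumes a: "\<And>i. i \<in> I \<Longrightarrow> (g i has_sum a i) J" and b: "\<And>j. j \<in> J \<Longrightarrow> ((\<lambda>i. g i j) has_sum b j) I"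
    and nonneg: "\<And>i j. g i j \<ge> 0" and s: "(a has_sum s) I"
  shows "(b has_sum s) J"
proof -
  have inf: "infsum (g i) J = a i" if "i \<in> I" for i using a[OF that] by (rule infsumI)
  have a0: "a i \<ge> 0" if "i \<in> I" for i using a[OF that] nonneg by (rule has_sum_nonneg)
  have "(\<lambda>p. norm (case p of (i, j) \<Rightarrow> g i j)) summable_on I \<times> J"
    unfolding Infinite_Sum.abs_summable_on_Sigma_iff
  proof (intro conjI ballI)
    show "(\<lambda>j. norm (case (i, j) of (i, j) \<Rightarrow> g i j)) summable_on J" if "i \<in> I" for i
      using a[OF that] nonneg by (auto simp: summable_on_def)
    have "(\<lambda>i. norm (\<Sum>\<^sub>\<infinity>j\<in>J. norm (case (i, j) of (i, j) \<Rightarrow> g i j))) summable_on I \<longleftrightarrow> a summable_on I"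
      by (rule summable_on_cong) (use nonneg inf a0 in auto)
    then show "(\<lambda>i. norm (\<Sum>\<^sub>\<infinity>j\<in>J. norm (case (i, j) of (i, j) \<Rightarrow> g i j))) summable_on I"
      using s by (auto simp: summable_on_def)
  qed
  then have "(\<lambda>(i, j). g i j) summable_on I \<times> J"
    using nonneg by (simp add: case_prod_unfold)
  then have "((\<lambda>(i, j). g i j) has_sum s) (I \<times> J)"
    by (intro has_sum_SigmaI[where g = a]) (use a s in auto)
  then have "((\<lambda>(j, i). g i j) has_sum s) (J \<times> I)"
    by (subst (asm) has_sum_swap) (simp add: case_prod_unfold)
  then show ?thesis
    by (rule has_sum_SigmaD) (use b in auto)
qed

text \<open>
  Both sides are the sum of \<open>(cmod (cinner f (T e)))\<^sup>2\<close> over all pairs \<open>(e, f)\<close>. With two applications,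
  the sum of the \<open>(norm (T e))\<^sup>2\<close> becomes independent of the basis.
\<close>

lemma has_sum_norm_adj:
  assumes T: "T \<in> bounded_ops" and E: "is_onb E" and F: "is_onb F"
    and s: "((\<lambda>e. (norm (blinfun_apply T e))\<^sup>2) has_sum s) E"
  shows "((\<lambda>f. (norm (blinfun_apply (adj T) f))\<^sup>2) has_sum s) F"
proof (rule nonneg_has_sum_swap[where g = "\<lambda>e f. (cmod (cinner f (T e)))\<^sup>2" and I = E])
  show "((\<lambda>f. (cmod (cinner f (T e)))\<^sup>2) has_sum (norm (T e))\<^sup>2) F" for e
    by (rule parseval[OF F])
  show "((\<lambda>e. (cmod (cinner f (T e)))\<^sup>2) has_sum (norm (adj T f))\<^sup>2) E" for f
  proof -
    have "cmod (cinner f (T e)) = cmod (cinner e (adj T f))" for e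
      by (metis T cinner_adj_left cinner_commute complex_mod_cnj)
    then show ?thesis using parseval[OF E, of "adj T f"] by simp
  qed
  show "((\<lambda>e. (norm (T e))\<^sup>2) has_sum s) E" by (rule s)
qed simp

definition hilbert_schmidt :: "'a::complex_hilbert op \<Rightarrow> bool" where
  "hilbert_schmidt T \<longleftrightarrow> T \<in> bounded_ops \<and> (\<lambda>e. (norm (T e))\<^sup>2) summable_on some_onb"

definition hs_norm_sq :: "'a::complex_hilbert op \<Rightarrow> real" where
  "hs_norm_sq T = (\<Sum>\<^sub>\<infinity>e\<in>some_onb. (norm (T e))\<^sup>2)"

lemma hilbert_schmidt_bounded_ops: "hilbert_schmidt T \<Longrightarrow> T \<in> bounded_ops"
  by (simp add: hilbert_schmidt_def)

lemma hs_norm_sq_nonneg: "hs_norm_sq T \<ge> 0"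
  unfolding hs_norm_sq_def by (rule infsum_nonneg) simp

lemma has_sum_hs_norm_sq_adj:
  assumes "hilbert_schmidt T" "is_onb F"
  shows "((\<lambda>f. (norm (blinfun_apply (adj T) f))\<^sup>2) has_sum hs_norm_sq T) F"
  using assms has_sum_norm_adj[OF _ is_onb_some_onb, of T F "hs_norm_sq T"]
  by (simp add: hilbert_schmidt_def hs_norm_sq_def)

lemma hilbert_schmidt_adj: "hilbert_schmidt T \<Longrightarrow> hilbert_schmidt (adj T)"
  using has_sum_hs_norm_sq_adj[OF _ is_onb_some_onb, of T]
  by (auto simp: hilbert_schmidt_def summable_on_def)

lemma hs_norm_sq_adj: "hilbert_schmidt T \<Longrightarrow> hs_norm_sq (adj T) = hs_norm_sq T"
  using infsumI[OF has_sum_hs_norm_sq_adj[OF _ is_onb_some_onb, of T]] by (simp add: hs_norm_sq_def)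

lemma hilbert_schmidtI_onb:
  assumes T: "T \<in> bounded_ops" and E: "is_onb E" and s: "(\<lambda>e. (norm (blinfun_apply T e))\<^sup>2) summable_on E"
  shows "hilbert_schmidt T"
proof -
  have "hilbert_schmidt (adj T)"
    using has_sum_norm_adj[OF T E is_onb_some_onb has_sum_infsum[OF s]] T
    by (auto simp: hilbert_schmidt_def summable_on_def)
  then show ?thesis using hilbert_schmidt_adj[of "adj T"] T by simp
qed

lemma hilbert_schmidt_add:
  assumes S: "hilbert_schmidt S" and T: "hilbert_schmidt T"
  shows "hilbert_schmidt (S + T)" and "hs_norm_sq (S + T) \<le> 2 * hs_norm_sq S + 2 * hs_norm_sq T"
proof -
  have le: "(norm ((S + T) e))\<^sup>2 \<le> 2 * (norm (S e))\<^sup>2 + 2 * (norm (T e))\<^sup>2" for e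
  proof -
    have "(norm ((S + T) e))\<^sup>2 \<le> (norm (S e) + norm (T e))\<^sup>2"
      by (intro power_mono) (auto simp: blinfun.add_left norm_triangle_ineq)
    also have "\<dots> \<le> 2 * (norm (S e))\<^sup>2 + 2 * (norm (T e))\<^sup>2"
      using sum_squares_bound[of "norm (S e)" "norm (T e)"] by (simp add: power2_sum)
    finally show ?thesis .
  qed
  have sm: "(\<lambda>e. 2 * (norm (S e))\<^sup>2 + 2 * (norm (T e))\<^sup>2) summable_on some_onb"
    using S T by (intro summable_on_add summable_on_cmult_right) (auto simp: hilbert_schmidt_def)
  then have sm': "(\<lambda>e. (norm ((S + T) e))\<^sup>2) summable_on some_onb"
    by (rule summable_on_comparison_test) (auto intro: le)
  then show "hilbert_schmidt (S + T)"
    using S T by (auto simp: hilbert_schmidt_def)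
  have "hs_norm_sq (S + T) \<le> infsum (\<lambda>e. 2 * (norm (S e))\<^sup>2 + 2 * (norm (T e))\<^sup>2) some_onb"
    unfolding hs_norm_sq_def by (rule infsum_mono[OF sm' sm le])
  also have "\<dots> = 2 * hs_norm_sq S + 2 * hs_norm_sq T"
    using S T by (simp add: hs_norm_sq_def hilbert_schmidt_def infsum_add summable_on_cmult_right infsum_cmult_right')
  finally show "hs_norm_sq (S + T) \<le> 2 * hs_norm_sq S + 2 * hs_norm_sq T" .
qed

lemma hilbert_schmidt_scaleC:
  assumes T: "hilbert_schmidt T"
  shows "hilbert_schmidt (c *\<^sub>C T)" and "hs_norm_sq (c *\<^sub>C T) = (cmod c)\<^sup>2 * hs_norm_sq T"
  using T by (auto simp: hilbert_schmidt_def hs_norm_sq_def norm_scaleC power_mult_distrib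
      infsum_cmult_right' intro: summable_on_cmult_right)

lemma hilbert_schmidt_compose_left:
  assumes B: "B \<in> bounded_ops" and T: "hilbert_schmidt T"
  shows "hilbert_schmidt (B o\<^sub>L T)" and "hs_norm_sq (B o\<^sub>L T) \<le> (norm B)\<^sup>2 * hs_norm_sq T"
proof -
  have le: "(norm ((B o\<^sub>L T) e))\<^sup>2 \<le> (norm B)\<^sup>2 * (norm (T e))\<^sup>2" for e
    unfolding power_mult_distrib[symmetric]
    by (rule power_mono) (auto simp: norm_blinfun)
  have sm: "(\<lambda>e. (norm B)\<^sup>2 * (norm (T e))\<^sup>2) summable_on some_onb"
    using T by (intro summable_on_cmult_right) (auto simp: hilbert_schmidt_def)
  then have sm': "(\<lambda>e. (norm ((B o\<^sub>L T) e))\<^sup>2) summable_on some_onb"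
    by (rule summable_on_comparison_test) (use le in auto)
  then show "hilbert_schmidt (B o\<^sub>L T)"
    using B T by (auto simp: hilbert_schmidt_def)
  show "hs_norm_sq (B o\<^sub>L T) \<le> (norm B)\<^sup>2 * hs_norm_sq T"
    using infsum_mono[OF sm' sm le] by (simp add: hs_norm_sq_def infsum_cmult_right')
qed

lemma hilbert_schmidt_compose_right:
  assumes B: "B \<in> bounded_ops" and T: "hilbert_schmidt T"
  shows "hilbert_schmidt (T o\<^sub>L B)" and "hs_norm_sq (T o\<^sub>L B) \<le> (norm B)\<^sup>2 * hs_norm_sq T"
proof -
  have Tb: "T \<in> bounded_ops" using T by (rule hilbert_schmidt_bounded_ops)
  have hs: "hilbert_schmidt (adj B o\<^sub>L adj T)"
    using B T by (intro hilbert_schmidt_compose_left hilbert_schmidt_adj) auto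
  have eq: "T o\<^sub>L B = adj (adj B o\<^sub>L adj T)"
    using B Tb by (simp add: adj_compose)
  show "hilbert_schmidt (T o\<^sub>L B)"
    unfolding eq by (rule hilbert_schmidt_adj[OF hs])
  have "hs_norm_sq (T o\<^sub>L B) \<le> (norm (adj B))\<^sup>2 * hs_norm_sq (adj T)"
    unfolding eq hs_norm_sq_adj[OF hs]
    using B T by (intro hilbert_schmidt_compose_left(2) hilbert_schmidt_adj) auto
  also have "\<dots> \<le> (norm B)\<^sup>2 * hs_norm_sq T"
    unfolding hs_norm_sq_adj[OF T]
    using B by (intro mult_right_mono power_mono norm_adj_le hs_norm_sq_nonneg) auto
  finally show "hs_norm_sq (T o\<^sub>L B) \<le> (norm B)\<^sup>2 * hs_norm_sq T" .
qed

lemma norm_le_hs_norm_sq: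
  assumes T: "hilbert_schmidt T"
  shows "(norm (blinfun_apply T x))\<^sup>2 \<le> hs_norm_sq T * (norm x)\<^sup>2"
proof -
  have Tb: "T \<in> bounded_ops" using T by (rule hilbert_schmidt_bounded_ops)
  have "(cmod (cinner e (T x)))\<^sup>2 \<le> (norm (adj T e))\<^sup>2 * (norm x)\<^sup>2" for e
    unfolding power_mult_distrib[symmetric]
    using norm_cinner_le[of "adj T e" x] by (intro power_mono) (auto simp: cinner_adj_left Tb)
  then have "(norm (T x))\<^sup>2 \<le> hs_norm_sq T * (norm x)\<^sup>2"
    by (intro has_sum_mono[OF parseval[OF is_onb_some_onb]
        has_sum_cmult_left[OF has_sum_hs_norm_sq_adj[OF T is_onb_some_onb]]])
  then show ?thesis .
qed

lemma diagonal_adj_compose: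
  assumes S: "hilbert_schmidt S" and T: "hilbert_schmidt T"
  shows "(\<lambda>e. cmod (cinner e (blinfun_apply (adj S o\<^sub>L T) e))) summable_on some_onb"
    and "(\<Sum>\<^sub>\<infinity>e\<in>some_onb. cmod (cinner e (blinfun_apply (adj S o\<^sub>L T) e))) \<le> sqrt (hs_norm_sq S) * sqrt (hs_norm_sq T)"
proof -
  have le: "cmod (cinner e ((adj S o\<^sub>L T) e)) \<le> norm (S e) * norm (T e)" for e
    using norm_cinner_le[of "S e" "T e"] by (simp add: cinner_adj_right hilbert_schmidt_bounded_ops[OF S])
  have sm: "(\<lambda>e. norm (S e) * norm (T e)) summable_on some_onb"
    by (rule cauchy_schwarz_infsum(1)) (use S T in \<open>auto simp: hilbert_schmidt_def\<close>)
  then show sm': "(\<lambda>e. cmod (cinner e ((adj S o\<^sub>L T) e))) summable_on some_onb"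
    by (rule summable_on_comparison_test) (use le in auto)
  have "(\<Sum>\<^sub>\<infinity>e\<in>some_onb. cmod (cinner e ((adj S o\<^sub>L T) e))) \<le> (\<Sum>\<^sub>\<infinity>e\<in>some_onb. norm (S e) * norm (T e))"
    by (rule infsum_mono[OF sm' sm le])
  also have "\<dots> \<le> sqrt (hs_norm_sq S) * sqrt (hs_norm_sq T)"
    unfolding hs_norm_sq_def by (rule cauchy_schwarz_infsum(2)) (use S T in \<open>auto simp: hilbert_schmidt_def\<close>)
  finally show "(\<Sum>\<^sub>\<infinity>e\<in>some_onb. cmod (cinner e ((adj S o\<^sub>L T) e))) \<le> sqrt (hs_norm_sq S) * sqrt (hs_norm_sq T)" .
qed

section \<open>The trace class\<close>

lemma trace_class_bounded_ops: "T \<in> trace_class \<Longrightarrow> T \<in> bounded_ops"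
  by (simp add: trace_class_def)

text \<open>
  Polar decomposition together with the square root of \<open>\<bar>T\<bar>\<close>: a trace class operator is a
  product of two Hilbert--Schmidt operators, whose norms control the trace norm.
\<close>

lemma trace_class_polar:
  assumes T: "T \<in> trace_class"
  obtains V Q where "V \<in> bounded_ops" "norm V \<le> 1" "V o\<^sub>L T = abs_op T" "positive_op Q" "hilbert_schmidt Q"
    "abs_op T = Q o\<^sub>L Q" "T = adj V o\<^sub>L Q o\<^sub>L Q" "tr (abs_op T) = of_real (trace_norm T)" "hs_norm_sq Q = trace_norm T"
proof -
  have Tb: "T \<in> bounded_ops" using T by (rule trace_class_bounded_ops)
  obtain V where V: "V \<in> bounded_ops" "norm V \<le> 1" "V o\<^sub>L T = abs_op T" "T = adj V o\<^sub>L abs_op T"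
    by (rule polar_decomposition[OF Tb])
  from positive_sqrt_exists[OF positive_abs_op[OF Tb]] obtain Q where Q: "positive_op Q" "Q o\<^sub>L Q = abs_op T"
    by (elim exE conjE) (rule that)
  have diag: "cinner e (abs_op T e) = of_real ((norm (Q e))\<^sup>2)" for e
    using positive_op_cinner[OF Q(1), of e "Q e"] by (simp add: Q(2)[symmetric] cinner_self)
  obtain E :: "'a set" where E: "is_onb E" and "(\<lambda>e. cinner e (abs_op T e)) summable_on E"
    using T unfolding trace_class_def by auto
  then have "(\<lambda>e. Re (cinner e (abs_op T e))) summable_on E"
    by (intro summable_on_Re)
  then have "(\<lambda>e. (norm (Q e))\<^sup>2) summable_on E"
    by (simp only: diag Re_complex_of_real)
  then have hs: "hilbert_schmidt Q"
    by (rule hilbert_schmidtI_onb[OF positive_op_bounded_ops[OF Q(1)] E])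
  then have "((\<lambda>e. cinner e (abs_op T e)) has_sum of_real (hs_norm_sq Q)) some_onb"
    unfolding diag hs_norm_sq_def by (intro has_sum_of_real has_sum_infsum) (simp add: hilbert_schmidt_def)
  then have tr: "tr (abs_op T) = of_real (hs_norm_sq Q)"
    unfolding tr_def by (rule infsumI)
  then have n: "hs_norm_sq Q = trace_norm T"
    by (simp add: trace_norm_def)
  have "T = adj V o\<^sub>L Q o\<^sub>L Q"
    using V(4) by (simp add: blinfun_compose_assoc Q(2))
  then show ?thesis
    by (rule that[OF V(1-3) Q(1) hs Q(2)[symmetric] _ tr[unfolded n] n])
qed

lemma trace_class_factorization:
  assumes T: "T \<in> trace_class"
  obtains S R where "hilbert_schmidt S" "hilbert_schmidt R" "T = adj S o\<^sub>L R"
    "hs_norm_sq S \<le> trace_norm T" "hs_norm_sq R = trace_norm T"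
proof -
  obtain V Q where V: "V \<in> bounded_ops" "norm V \<le> 1" and Q: "positive_op Q" "hilbert_schmidt Q"
    and eq: "T = adj V o\<^sub>L Q o\<^sub>L Q" and n: "hs_norm_sq Q = trace_norm T"
    by (rule trace_class_polar[OF T])
  have "hs_norm_sq (Q o\<^sub>L V) \<le> (norm V)\<^sup>2 * hs_norm_sq Q"
    by (rule hilbert_schmidt_compose_right(2)[OF V(1) Q(2)])
  also have "\<dots> \<le> 1 * hs_norm_sq Q"
    using V(2) by (intro mult_right_mono hs_norm_sq_nonneg) (simp add: power_le_one)
  finally have le: "hs_norm_sq (Q o\<^sub>L V) \<le> trace_norm T" by (simp add: n)
  have "T = adj (Q o\<^sub>L V) o\<^sub>L Q"
    by (simp add: eq adj_compose positive_op_bounded_ops[OF Q(1)] V(1) positive_op_adj[OF Q(1)])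
  then show ?thesis
    by (rule that[OF hilbert_schmidt_compose_right(1)[OF V(1) Q(2)] Q(2) _ le n])
qed

text \<open>
  For \<open>T = S\<^sup>* R\<close> and \<open>V\<close> from its polar decomposition, \<open>\<bar>T\<bar> = V T = (S V\<^sup>*)\<^sup>* R\<close> is again a product of two
  Hilbert--Schmidt operators.
\<close>

lemma trace_class_adj_compose:
  assumes S: "hilbert_schmidt S" and R: "hilbert_schmidt R"
  shows "adj S o\<^sub>L R \<in> trace_class"
proof -
  let ?T = "adj S o\<^sub>L R"
  have b: "S \<in> bounded_ops" "R \<in> bounded_ops" using S R by (auto intro: hilbert_schmidt_bounded_ops)
  then have Tb: "?T \<in> bounded_ops" by auto
  obtain V where V: "V \<in> bounded_ops" "V o\<^sub>L ?T = abs_op ?T"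
    by (rule polar_decomposition[OF Tb])
  have "abs_op ?T = adj (S o\<^sub>L adj V) o\<^sub>L R"
    using V b by (simp add: adj_compose blinfun_compose_assoc)
  then have "(\<lambda>e. cinner e (abs_op ?T e)) summable_on some_onb"
    using diagonal_adj_compose(1)[OF hilbert_schmidt_compose_right(1)[OF adj_bounded_ops[OF V(1)] S] R]
    by (simp only: abs_summable_summable)
  then show ?thesis
    unfolding trace_class_def using Tb is_onb_some_onb by blast
qed

lemma trace_norm_nonneg: "T \<in> trace_class \<Longrightarrow> trace_norm T \<ge> 0"
  by (metis trace_class_factorization hs_norm_sq_nonneg)

lemma trace_class_compose_left:
  assumes B: "B \<in> bounded_ops" and T: "T \<in> trace_class"
  shows "B o\<^sub>L T \<in> trace_class"
    and "(\<Sum>\<^sub>\<infinity>e\<in>some_onb. cmod (cinner e (blinfun_apply (B o\<^sub>L T) e))) \<le> norm B * trace_norm T"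
proof -
  obtain S R where SR: "hilbert_schmidt S" "hilbert_schmidt R" and T_eq: "T = adj S o\<^sub>L R"
    and n: "hs_norm_sq S \<le> trace_norm T" "hs_norm_sq R = trace_norm T"
    by (rule trace_class_factorization[OF T])
  have eq: "B o\<^sub>L T = adj (S o\<^sub>L adj B) o\<^sub>L R"
    by (simp add: T_eq adj_compose B hilbert_schmidt_bounded_ops[OF SR(1)] blinfun_compose_assoc)
  have hs: "hilbert_schmidt (S o\<^sub>L adj B)"
    by (rule hilbert_schmidt_compose_right(1)[OF adj_bounded_ops[OF B] SR(1)])
  show "B o\<^sub>L T \<in> trace_class"
    unfolding eq by (rule trace_class_adj_compose[OF hs SR(2)])
  have "hs_norm_sq (S o\<^sub>L adj B) \<le> (norm (adj B))\<^sup>2 * hs_norm_sq S"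
    by (rule hilbert_schmidt_compose_right(2)[OF adj_bounded_ops[OF B] SR(1)])
  also have "\<dots> \<le> (norm B)\<^sup>2 * trace_norm T"
    using n by (intro mult_mono power_mono norm_adj_le B) (auto intro: hs_norm_sq_nonneg)
  finally have "sqrt (hs_norm_sq (S o\<^sub>L adj B)) * sqrt (hs_norm_sq R) \<le> sqrt ((norm B)\<^sup>2 * trace_norm T) * sqrt (trace_norm T)"
    using n trace_norm_nonneg[OF T] by (intro mult_mono) auto
  also have "\<dots> = norm B * trace_norm T"
    using trace_norm_nonneg[OF T] by (simp add: real_sqrt_mult)
  finally show "(\<Sum>\<^sub>\<infinity>e\<in>some_onb. cmod (cinner e (blinfun_apply (B o\<^sub>L T) e))) \<le> norm B * trace_norm T"
    using diagonal_adj_compose(2)[OF hs SR(2)] unfolding eq by linarith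
qed

lemma trace_class_compose_right:
  assumes B: "B \<in> bounded_ops" and T: "T \<in> trace_class"
  shows "T o\<^sub>L B \<in> trace_class"
proof -
  obtain S R where SR: "hilbert_schmidt S" "hilbert_schmidt R" and T_eq: "T = adj S o\<^sub>L R"
    by (rule trace_class_factorization[OF T])
  show ?thesis
    unfolding T_eq blinfun_compose_assoc
    by (rule trace_class_adj_compose[OF SR(1) hilbert_schmidt_compose_right(1)[OF B SR(2)]])
qed

lemma trace_class_diagonal_summable:
  assumes T: "T \<in> trace_class"
  shows "(\<lambda>e. cmod (cinner e (blinfun_apply T e))) summable_on some_onb"
proof -
  obtain S R where SR: "hilbert_schmidt S" "hilbert_schmidt R" and T_eq: "T = adj S o\<^sub>L R"
    by (rule trace_class_factorization[OF T])
  show ?thesis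
    unfolding T_eq by (rule diagonal_adj_compose(1)[OF SR])
qed

lemma trace_has_sum:
  assumes T: "T \<in> trace_class"
  shows "((\<lambda>e. cinner e (blinfun_apply T e)) has_sum tr T) some_onb"
  unfolding tr_def by (rule has_sum_infsum[OF abs_summable_summable[OF trace_class_diagonal_summable[OF T]]])

text \<open>
  In contrast to the condition on \<open>\<bar>T\<bar>\<close> in the definition, this criterion is linear in \<open>T\<close>; it is the
  reason why sums of trace class operators are trace class.
\<close>

lemma trace_classI:
  assumes T: "T \<in> bounded_ops"
    and sm: "\<And>U. U \<in> bounded_ops \<Longrightarrow> (\<lambda>e. cinner e (blinfun_apply (U o\<^sub>L T) e)) summable_on some_onb"
  shows "T \<in> trace_class"
proof -
  obtain V where V: "V \<in> bounded_ops" "V o\<^sub>L T = abs_op T"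
    by (rule polar_decomposition[OF T])
  show ?thesis
    unfolding trace_class_def using T is_onb_some_onb sm[OF V(1)] V(2) by auto
qed

lemma trace_class_summable_compose:
  "T \<in> trace_class \<Longrightarrow> U \<in> bounded_ops \<Longrightarrow> (\<lambda>e. cinner e (blinfun_apply (U o\<^sub>L T) e)) summable_on some_onb"
  by (rule abs_summable_summable[OF trace_class_diagonal_summable[OF trace_class_compose_left(1)]])

lemma trace_class_add:
  assumes S: "S \<in> trace_class" and T: "T \<in> trace_class" shows "S + T \<in> trace_class"
proof (rule trace_classI)
  fix U :: "'a op" assume U: "U \<in> bounded_ops"
  show "(\<lambda>e. cinner e ((U o\<^sub>L (S + T)) e)) summable_on some_onb"
    using summable_on_add[OF trace_class_summable_compose[OF S U] trace_class_summable_compose[OF T U]]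
    by (simp add: blinfun.add_left blinfun.add_right cinner.add_right)
qed (use S T in \<open>auto intro: trace_class_bounded_ops\<close>)

lemma trace_class_scaleC:
  assumes T: "T \<in> trace_class" shows "c *\<^sub>C T \<in> trace_class"
proof -
  have "c *\<^sub>C T = (c *\<^sub>C id_blinfun) o\<^sub>L T"
    by (simp add: blinfun_compose_scaleC_left)
  then show ?thesis using trace_class_compose_left(1)[of "c *\<^sub>C id_blinfun" T] T by auto
qed

lemma trace_class_scaleR: "T \<in> trace_class \<Longrightarrow> r *\<^sub>R T \<in> trace_class"
  by (simp add: scaleR_eq_scaleC trace_class_scaleC)

lemma trace_class_minus: "T \<in> trace_class \<Longrightarrow> - T \<in> trace_class"
  using trace_class_scaleC[of T "-1"] by simp

lemma trace_class_diff: "S \<in> trace_class \<Longrightarrow> T \<in> trace_class \<Longrightarrow> S - T \<in> trace_class"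
  using trace_class_add[of S "- T"] trace_class_minus[of T] by simp

lemma trace_class_zero: "0 \<in> trace_class"
  by (rule trace_classI) auto

lemma trace_class_sum: "(\<And>i. i \<in> I \<Longrightarrow> f i \<in> trace_class) \<Longrightarrow> sum f I \<in> trace_class"
  by (induction I rule: infinite_finite_induct) (auto intro: trace_class_zero trace_class_add)

lemma tr_add: "S \<in> trace_class \<Longrightarrow> T \<in> trace_class \<Longrightarrow> tr (S + T) = tr S + tr T"
  using has_sum_add[OF trace_has_sum trace_has_sum, of S T]
  by (intro has_sum_unique[OF trace_has_sum[OF trace_class_add]])
    (auto simp: blinfun.add_left cinner.add_right)

lemma tr_scaleC: "T \<in> trace_class \<Longrightarrow> tr (c *\<^sub>C T) = c * tr T"
  using has_sum_cmult_right[OF trace_has_sum, of T c]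
  by (intro has_sum_unique[OF trace_has_sum[OF trace_class_scaleC]]) auto

lemma tr_scaleR: "T \<in> trace_class \<Longrightarrow> tr (r *\<^sub>R T) = of_real r * tr T"
  by (simp add: scaleR_eq_scaleC tr_scaleC)

lemma tr_minus: "T \<in> trace_class \<Longrightarrow> tr (- T) = - tr T"
  using tr_scaleC[of T "-1"] by simp

lemma tr_diff: "S \<in> trace_class \<Longrightarrow> T \<in> trace_class \<Longrightarrow> tr (S - T) = tr S - tr T"
  using tr_add[of S "- T"] trace_class_minus[of T] by (simp add: tr_minus)

lemma tr_zero [simp]: "tr 0 = 0"
  by (simp add: tr_def)

lemma tr_sum: "(\<And>i. i \<in> I \<Longrightarrow> f i \<in> trace_class) \<Longrightarrow> tr (sum f I) = (\<Sum>i\<in>I. tr (f i))"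
  by (induction I rule: infinite_finite_induct) (auto simp: tr_add trace_class_sum)

lemma tr_adj:
  assumes "T \<in> trace_class" shows "tr (adj T) = cnj (tr T)"
proof -
  have "cinner e (adj T e) = cnj (cinner e (T e))" for e
    by (metis assms cinner_adj_right cinner_commute trace_class_bounded_ops)
  then show ?thesis by (simp add: tr_def)
qed

lemma tr_adj_compose_self:
  assumes X: "hilbert_schmidt X"
  shows "tr (adj X o\<^sub>L X) = of_real (hs_norm_sq X)"
proof -
  have "((\<lambda>e. cinner e ((adj X o\<^sub>L X) e)) has_sum of_real (hs_norm_sq X)) some_onb"
    using X by (auto simp: cinner_adj_right cinner_self hilbert_schmidt_def hs_norm_sq_def
        simp del: of_real_power intro!: has_sum_of_real has_sum_infsum)
  then show ?thesis unfolding tr_def by (rule infsumI)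
qed

text \<open>
  For \<open>R = S\<close> the identity is the invariance of the Hilbert--Schmidt norm under adjoints; the
  general case follows by polarization.
\<close>

lemma tr_adj_compose_commute:
  assumes S: "hilbert_schmidt S" and R: "hilbert_schmidt R"
  shows "tr (adj S o\<^sub>L R) = tr (R o\<^sub>L adj S)"
proof -
  have quad: "tr (adj W o\<^sub>L W) = tr (W o\<^sub>L adj W)" if W: "hilbert_schmidt W" for W :: "'a op"
  proof -
    have Wb: "W \<in> bounded_ops" using W by (rule hilbert_schmidt_bounded_ops)
    show ?thesis
      using tr_adj_compose_self[OF W] tr_adj_compose_self[OF hilbert_schmidt_adj[OF W]]
      by (simp add: hs_norm_sq_adj W Wb)
  qed
  have b: "S \<in> bounded_ops" "R \<in> bounded_ops" using S R by (auto intro: hilbert_schmidt_bounded_ops)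
  have tc: "adj X o\<^sub>L Y \<in> trace_class" "X o\<^sub>L adj Y \<in> trace_class" if "hilbert_schmidt X" "hilbert_schmidt Y"
    for X Y :: "'a op"
    using trace_class_adj_compose[of X Y] trace_class_adj_compose[of "adj X" "adj Y"] that
    by (auto simp: hilbert_schmidt_adj hilbert_schmidt_bounded_ops)
  \<comment> \<open>the quadratic case at \<open>S + c R\<close>; \<open>c = 1\<close> and \<open>c = \<i>\<close> separate the two cross terms\<close>
  have *: "c * tr (adj S o\<^sub>L R) + cnj c * tr (adj R o\<^sub>L S) = c * tr (R o\<^sub>L adj S) + cnj c * tr (S o\<^sub>L adj R)" for c
  proof -
    have hs: "hilbert_schmidt (S + c *\<^sub>C R)"
      by (intro hilbert_schmidt_add hilbert_schmidt_scaleC S R)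
    have 1: "adj (S + c *\<^sub>C R) = adj S + cnj c *\<^sub>C adj R"
      using b by (simp add: adj_add adj_scaleC)
    note expand = 1 blinfun_compose_add_left blinfun_compose_add_right blinfun_compose_scaleC_left
      blinfun_compose_scaleC_right b adj_bounded_ops tr_add tr_scaleC tc S R trace_class_add trace_class_scaleC
    have "tr (adj (S + c *\<^sub>C R) o\<^sub>L (S + c *\<^sub>C R))
        = tr (adj S o\<^sub>L S) + (c * tr (adj S o\<^sub>L R) + cnj c * tr (adj R o\<^sub>L S)) + c * (cnj c * tr (adj R o\<^sub>L R))"
      by (simp add: expand)
    moreover have "tr ((S + c *\<^sub>C R) o\<^sub>L adj (S + c *\<^sub>C R))
        = tr (S o\<^sub>L adj S) + (c * tr (R o\<^sub>L adj S) + cnj c * tr (S o\<^sub>L adj R)) + c * (cnj c * tr (R o\<^sub>L adj R))"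
      by (simp add: expand)
    ultimately show ?thesis
      using quad[OF hs] quad[OF S] quad[OF R] by simp
  qed
  show ?thesis
    using *[of 1] *[of \<i>] by (simp add: complex_eq_iff)
qed

text \<open>
  Write \<open>T = S\<^sup>* R\<close> and move the Hilbert--Schmidt factor \<open>S\<^sup>*\<close> around the trace; \<open>B\<close> goes with \<open>R\<close>
  the first time and with \<open>S\<^sup>*\<close> the second time.
\<close>

lemma tr_commute:
  assumes T: "T \<in> trace_class" and B: "B \<in> bounded_ops"
  shows "tr (T o\<^sub>L B) = tr (B o\<^sub>L T)"
proof -
  obtain S R where SR: "hilbert_schmidt S" "hilbert_schmidt R" and T_eq: "T = adj S o\<^sub>L R"
    by (rule trace_class_factorization[OF T])
  have b: "S \<in> bounded_ops" using SR by (auto intro: hilbert_schmidt_bounded_ops)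
  have "tr (T o\<^sub>L B) = tr (R o\<^sub>L B o\<^sub>L adj S)"
    using tr_adj_compose_commute[OF SR(1) hilbert_schmidt_compose_right(1)[OF B SR(2)]]
    by (simp add: T_eq blinfun_compose_assoc)
  also have "\<dots> = tr (B o\<^sub>L T)"
    using tr_adj_compose_commute[OF hilbert_schmidt_compose_right(1)[OF adj_bounded_ops[OF B] SR(1)] SR(2)]
    by (simp add: T_eq blinfun_compose_assoc adj_compose b B)
  finally show ?thesis .
qed

lemma cmod_tr_compose_le:
  assumes B: "B \<in> bounded_ops" and T: "T \<in> trace_class"
  shows "cmod (tr (B o\<^sub>L T)) \<le> norm B * trace_norm T"
  unfolding tr_def
  using norm_infsum_bound[OF trace_class_diagonal_summable[OF trace_class_compose_left(1)[OF B T]]]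
    trace_class_compose_left(2)[OF B T] by linarith

text \<open>The bound of the trace pairing is attained; this makes the trace norm a dual norm.\<close>

lemma trace_norm_attained:
  assumes "T \<in> trace_class"
  obtains V where "V \<in> bounded_ops" "norm V \<le> 1" "tr (V o\<^sub>L T) = of_real (trace_norm T)"
  using assms by (elim trace_class_polar) (metis that)

lemma trace_norm_le:
  assumes T: "T \<in> trace_class"
    and le: "\<And>V. V \<in> bounded_ops \<Longrightarrow> norm V \<le> 1 \<Longrightarrow> cmod (tr (V o\<^sub>L T)) \<le> C"
  shows "trace_norm T \<le> C"
proof -
  obtain V where V: "V \<in> bounded_ops" "norm V \<le> 1" "tr (V o\<^sub>L T) = of_real (trace_norm T)"
    by (rule trace_norm_attained[OF T])
  show ?thesis
    using le[OF V(1,2)] trace_norm_nonneg[OF T] by (simp add: V(3))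
qed

lemma cmod_tr_contraction_le:
  assumes "B \<in> bounded_ops" "T \<in> trace_class" "norm B \<le> 1"
  shows "cmod (tr (B o\<^sub>L T)) \<le> trace_norm T"
  using cmod_tr_compose_le[OF assms(1,2)] mult_right_mono[OF assms(3) trace_norm_nonneg[OF assms(2)]] by simp

lemma trace_norm_triangle:
  assumes S: "S \<in> trace_class" and T: "T \<in> trace_class"
  shows "trace_norm (S + T) \<le> trace_norm S + trace_norm T"
proof (rule trace_norm_le[OF trace_class_add[OF S T]])
  fix V :: "'a op" assume V: "V \<in> bounded_ops" "norm V \<le> 1"
  have "tr (V o\<^sub>L (S + T)) = tr (V o\<^sub>L S) + tr (V o\<^sub>L T)"
    using V S T by (simp add: blinfun_compose_add_right tr_add trace_class_compose_left)
  then show "cmod (tr (V o\<^sub>L (S + T))) \<le> trace_norm S + trace_norm T"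
    using norm_triangle_mono[OF cmod_tr_contraction_le[OF V(1) S V(2)] cmod_tr_contraction_le[OF V(1) T V(2)]] by simp
qed

lemma trace_norm_compose_left:
  assumes B: "B \<in> bounded_ops" and T: "T \<in> trace_class"
  shows "trace_norm (B o\<^sub>L T) \<le> norm B * trace_norm T"
proof (rule trace_norm_le[OF trace_class_compose_left(1)[OF B T]])
  fix V :: "'a op" assume V: "V \<in> bounded_ops" "norm V \<le> 1"
  have "cmod (tr ((V o\<^sub>L B) o\<^sub>L T)) \<le> norm (V o\<^sub>L B) * trace_norm T"
    by (rule cmod_tr_compose_le[OF compose_bounded_ops[OF V(1) B] T])
  also have "\<dots> \<le> (1 * norm B) * trace_norm T"
    using V(2) by (intro mult_right_mono trace_norm_nonneg T order_trans[OF norm_blinfun_compose]) auto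
  finally show "cmod (tr (V o\<^sub>L (B o\<^sub>L T))) \<le> norm B * trace_norm T"
    by (simp add: blinfun_compose_assoc)
qed

lemma trace_norm_scaleC_le:
  assumes T: "T \<in> trace_class" shows "trace_norm (c *\<^sub>C T) \<le> cmod c * trace_norm T"
proof (rule trace_norm_le[OF trace_class_scaleC[OF T]])
  fix V :: "'a op" assume V: "V \<in> bounded_ops" "norm V \<le> 1"
  have "tr (V o\<^sub>L (c *\<^sub>C T)) = c * tr (V o\<^sub>L T)"
    using V T by (simp add: blinfun_compose_scaleC_right tr_scaleC trace_class_compose_left)
  then show "cmod (tr (V o\<^sub>L (c *\<^sub>C T))) \<le> cmod c * trace_norm T"
    using mult_left_mono[OF cmod_tr_contraction_le[OF V(1) T V(2)], of "cmod c"] by (simp add: norm_mult)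
qed

text \<open>
  The square root \<open>Q\<close> of \<open>\<bar>T\<bar>\<close> has operator norm at most its Hilbert--Schmidt norm \<open>sqrt (trace_norm T)\<close>,
  and \<open>Q\<close> occurs twice in \<open>T\<close>.
\<close>

lemma norm_le_trace_norm:
  assumes T: "T \<in> trace_class" shows "norm T \<le> trace_norm T"
proof -
  obtain V Q where V: "V \<in> bounded_ops" "norm V \<le> 1" and Q: "positive_op Q" "hilbert_schmidt Q"
    and eq: "T = adj V o\<^sub>L Q o\<^sub>L Q" and n: "hs_norm_sq Q = trace_norm T"
    by (rule trace_class_polar[OF T])
  have "norm (Q x) \<le> sqrt (trace_norm T) * norm x" for x
    using real_sqrt_le_mono[OF norm_le_hs_norm_sq[OF Q(2), of x]] by (simp add: n real_sqrt_mult)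
  then have nQ: "norm Q \<le> sqrt (trace_norm T)"
    using trace_norm_nonneg[OF T] by (intro norm_blinfun_bound) auto
  have "norm T \<le> norm (adj V o\<^sub>L Q) * norm Q"
    unfolding eq by (rule norm_blinfun_compose)
  also have "\<dots> \<le> (norm (adj V) * norm Q) * norm Q"
    by (intro mult_right_mono norm_blinfun_compose) auto
  also have "\<dots> \<le> (1 * sqrt (trace_norm T)) * sqrt (trace_norm T)"
    using norm_adj_le[OF V(1)] V(2) nQ trace_norm_nonneg[OF T] by (intro mult_mono) auto
  finally show ?thesis using trace_norm_nonneg[OF T] by simp
qed

lemma trace_norm_positive:
  assumes "positive_op P" "P \<in> trace_class"
  shows "tr P = of_real (trace_norm P)"
  using trace_class_polar[OF assms(2)] abs_op_positive[OF assms(1)] by metis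

subsection \<open>Rank one operators\<close>

lift_definition rank_one :: "'a::complex_hilbert \<Rightarrow> 'a \<Rightarrow> 'a op" is "\<lambda>x y z. cinner y z *\<^sub>C x"
proof -
  fix x y :: 'a
  show "bounded_linear (\<lambda>z. cinner y z *\<^sub>C x)"
  proof (rule bounded_linear_intro[where K = "norm y * norm x"])
    show "norm (cinner y z *\<^sub>C x) \<le> norm z * (norm y * norm x)" for z
      using mult_right_mono[OF norm_cinner_le[of y z] norm_ge_zero[of x]]
      by (simp add: norm_scaleC ac_simps)
  qed (auto simp: cinner.add_right scaleC_add_left scaleR_eq_scaleC scaleC_scaleC)
qed

lemma rank_one_apply [simp]: "blinfun_apply (rank_one x y) z = cinner y z *\<^sub>C x"
  by transfer simp

lemma rank_one_bounded_ops [simp, intro]: "rank_one x y \<in> bounded_ops"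
  by (simp add: bounded_ops_def scaleC_scaleC)

lemma compose_rank_one: "B \<in> bounded_ops \<Longrightarrow> B o\<^sub>L rank_one x y = rank_one (B x) y"
  by (rule blinfun_eqI) (simp add: bounded_opsD)

lemma rank_one_add_left: "rank_one (x + x') y = rank_one x y + rank_one x' y"
  and rank_one_add_right: "rank_one x (y + y') = rank_one x y + rank_one x y'"
  and rank_one_scaleC_left: "rank_one (c *\<^sub>C x) y = c *\<^sub>C rank_one x y"
  and rank_one_scaleC_right: "rank_one x (c *\<^sub>C y) = cnj c *\<^sub>C rank_one x y"
  by (auto intro!: blinfun_eqI simp: blinfun.add_left scaleC_add_right cinner.add_left scaleC_add_left scaleC_scaleC mult.commute)

lemma rank_one_has_sum: "((\<lambda>e. cinner e (rank_one x y e)) has_sum cinner y x) some_onb"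
  using parseval_cinner[OF is_onb_some_onb, of y x] by simp

lemma rank_one_trace_class [simp, intro]: "rank_one x y \<in> trace_class"
proof (rule trace_classI)
  fix U :: "'a op" assume "U \<in> bounded_ops"
  then show "(\<lambda>e. cinner e ((U o\<^sub>L rank_one x y) e)) summable_on some_onb"
    using rank_one_has_sum[of "U x" y] by (auto simp: compose_rank_one summable_on_def simp del: rank_one_apply)
qed auto

lemma tr_rank_one [simp]: "tr (rank_one x y) = cinner y x"
  unfolding tr_def by (rule infsumI[OF rank_one_has_sum])

lemma tr_rank_one_compose: "B \<in> bounded_ops \<Longrightarrow> tr (rank_one x y o\<^sub>L B) = cinner y (B x)"
  by (simp add: tr_commute compose_rank_one)

lemma positive_rank_one: "positive_op (rank_one x x)"
proof (rule positive_opI)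
  show "\<exists>r\<ge>0. cinner z (rank_one x x z) = complex_of_real r" for z
  proof (intro exI[of _ "(cmod (cinner x z))\<^sup>2"] conjI)
    show "cinner z (rank_one x x z) = complex_of_real ((cmod (cinner x z))\<^sup>2)"
      unfolding complex_norm_square by (simp add: cinner_commute[of z x])
  qed simp
qed simp

lemma trace_norm_rank_one_le: "trace_norm (rank_one x y) \<le> norm x * norm y"
proof (rule trace_norm_le)
  fix V :: "'a op" assume V: "V \<in> bounded_ops" "norm V \<le> 1"
  have "cmod (cinner y (V x)) \<le> norm y * norm (V x)" by (rule norm_cinner_le)
  also have "\<dots> \<le> norm y * (1 * norm x)"
    using V(2) by (intro mult_left_mono order_trans[OF norm_blinfun] mult_right_mono) auto
  finally show "cmod (tr (V o\<^sub>L rank_one x y)) \<le> norm x * norm y"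
    by (simp add: compose_rank_one V mult.commute)
qed auto

text \<open>On either side of the trace pairing the rank one operators are enough to separate points.\<close>

lemma trace_class_eqI:
  assumes S: "S \<in> trace_class" and T: "T \<in> trace_class"
    and eq: "\<And>B. B \<in> bounded_ops \<Longrightarrow> tr (S o\<^sub>L B) = tr (T o\<^sub>L B)"
  shows "S = T"
proof (rule op_eqI)
  fix x y
  have "cinner x (R y) = tr (R o\<^sub>L rank_one y x)" if "R \<in> trace_class" for R :: "'a op"
    using that by (simp add: compose_rank_one trace_class_bounded_ops)
  then show "cinner x (S y) = cinner x (T y)"
    using eq[of "rank_one y x"] S T by simp
qed

lemma bounded_ops_eqI:
  assumes "A \<in> bounded_ops" "B \<in> bounded_ops"
    and eq: "\<And>T. T \<in> trace_class \<Longrightarrow> tr (T o\<^sub>L A) = tr (T o\<^sub>L B)"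
  shows "A = B"
proof (rule op_eqI)
  show "cinner x (A y) = cinner x (B y)" for x y
    using eq[of "rank_one y x"] assms(1,2) by (simp add: tr_rank_one_compose)
qed

section \<open>The trace class as a Banach space\<close>

text \<open>
  Bounds of the trace norm pass to limits in operator norm, as they amount to bounds on the finite
  partial sums of diagonals. Completeness of the trace class follows.
\<close>

lemma trace_norm_lower_semicontinuous:
  fixes L :: "'a::complex_hilbert op"
  assumes Z: "\<And>m. Z m \<in> trace_class" and lim: "Z \<longlonglongrightarrow> L" 
    and le: "eventually (\<lambda>m. trace_norm (Z m) \<le> C) sequentially" 
  shows "L \<in> trace_class" and "trace_norm L \<le> C"
proof -
  have L: "L \<in> bounded_ops"
    using closed_sequentially[OF closed_bounded_ops, of Z L] Z lim by (simp add: trace_class_bounded_ops)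
  have fin: "(\<Sum>e\<in>F. cmod (cinner e ((U o\<^sub>L L) e))) \<le> norm U * C"
    if U: "U \<in> bounded_ops" and F: "finite F" "F \<subseteq> some_onb" for U F
  proof (rule tendsto_upperbound)
    show "(\<lambda>m. \<Sum>e\<in>F. cmod (cinner e ((U o\<^sub>L Z m) e))) \<longlonglongrightarrow> (\<Sum>e\<in>F. cmod (cinner e ((U o\<^sub>L L) e)))"
      by (intro tendsto_sum tendsto_norm cinner.tendsto tendsto_const blinfun.tendsto
          bounded_bilinear.tendsto[OF bounded_bilinear_blinfun_compose] lim)
    have "(\<Sum>e\<in>F. cmod (cinner e ((U o\<^sub>L Z m) e))) \<le> norm U * C" if m: "trace_norm (Z m) \<le> C" for m
    proof -
      have "(\<Sum>e\<in>F. cmod (cinner e ((U o\<^sub>L Z m) e))) \<le> (\<Sum>\<^sub>\<infinity>e\<in>some_onb. cmod (cinner e ((U o\<^sub>L Z m) e)))"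
        using F by (intro finite_sum_le_infsum trace_class_diagonal_summable trace_class_compose_left U Z) auto
      also have "\<dots> \<le> norm U * trace_norm (Z m)"
        by (rule trace_class_compose_left(2)[OF U Z])
      also have "\<dots> \<le> norm U * C"
        using m by (intro mult_left_mono) auto
      finally show ?thesis .
    qed
    then show "eventually (\<lambda>m. (\<Sum>e\<in>F. cmod (cinner e ((U o\<^sub>L Z m) e))) \<le> norm U * C) sequentially"
      using le by (auto elim: eventually_mono)
  qed simp
  have sm: "(\<lambda>e. cmod (cinner e ((U o\<^sub>L L) e))) summable_on some_onb" if "U \<in> bounded_ops" for U
    using fin[OF that] by (intro nonneg_bdd_above_summable_on) (auto intro!: bdd_aboveI2)
  show T: "L \<in> trace_class"
    by (rule trace_classI[OF L abs_summable_summable[OF sm]])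
  have C: "C \<ge> 0"
  proof -
    obtain m where "trace_norm (Z m) \<le> C"
      using eventually_happens'[OF _ le] by auto
    then show ?thesis using trace_norm_nonneg[OF Z[of m]] by linarith
  qed
  show "trace_norm L \<le> C"
  proof (rule trace_norm_le[OF T])
    fix V :: "'a op" assume V: "V \<in> bounded_ops" "norm V \<le> 1"
    have "cmod (tr (V o\<^sub>L L)) \<le> (\<Sum>\<^sub>\<infinity>e\<in>some_onb. cmod (cinner e ((V o\<^sub>L L) e)))"
      unfolding tr_def by (rule norm_infsum_bound[OF sm[OF V(1)]])
    also have "\<dots> \<le> norm V * C"
      by (rule infsum_le_finite_sums[OF sm fin]) (use V in auto)
    also have "\<dots> \<le> 1 * C"
      using V(2) C by (intro mult_right_mono)
    finally show "cmod (tr (V o\<^sub>L L)) \<le> C" by simp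
  qed
qed

lemma trace_norm_scaleR: 
  assumes T: "T \<in> trace_class" shows "trace_norm (r *\<^sub>R T) = \<bar>r\<bar> * trace_norm T"
proof (cases "r = 0")
  case True
  then show ?thesis
    using trace_norm_scaleC_le[OF T, of 0] trace_norm_nonneg[OF trace_class_zero, where 'a = 'a] by simp
next
  case False
  have le: "trace_norm (s *\<^sub>R S) \<le> \<bar>s\<bar> * trace_norm S" if "S \<in> trace_class" for s and S :: "'a op"
    using trace_norm_scaleC_le[OF that, of "of_real s"] by (simp add: scaleR_eq_scaleC)
  have "trace_norm T \<le> \<bar>1 / r\<bar> * trace_norm (r *\<^sub>R T)"
    using le[OF trace_class_scaleR[OF T, of r], of "1 / r"] False by simp
  then show ?thesis
    using le[OF T, of r] False by (simp add: field_simps)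
qed

text \<open>
  As a type of class \<open>banach\<close> the trace class inherits limits, continuity and the integral of
  vector-valued functions.
\<close>

typedef (overloaded) 'a tc = "trace_class :: 'a::complex_hilbert op set"
  morphisms op_of Tc
  using trace_class_zero by blast

lemmas op_of_trace_class [simp, intro] = op_of
lemmas op_of_Tc [simp] = Tc_inverse
lemmas Tc_op_of [simp] = op_of_inverse

instantiation tc :: (complex_hilbert) real_normed_vector
begin

definition zero_tc :: "'a tc" where "zero_tc = Tc 0"
definition plus_tc :: "'a tc \<Rightarrow> 'a tc \<Rightarrow> 'a tc" where "plus_tc S T = Tc (op_of S + op_of T)"
definition minus_tc :: "'a tc \<Rightarrow> 'a tc \<Rightarrow> 'a tc" where "minus_tc S T = Tc (op_of S - op_of T)"
definition uminus_tc :: "'a tc \<Rightarrow> 'a tc" where "uminus_tc T = Tc (- op_of T)"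
definition scaleR_tc :: "real \<Rightarrow> 'a tc \<Rightarrow> 'a tc" where "scaleR_tc r T = Tc (r *\<^sub>R op_of T)"
definition norm_tc :: "'a tc \<Rightarrow> real" where "norm_tc T = trace_norm (op_of T)"
definition dist_tc :: "'a tc \<Rightarrow> 'a tc \<Rightarrow> real" where "dist_tc S T = norm (S - T)"
definition sgn_tc :: "'a tc \<Rightarrow> 'a tc" where "sgn_tc T = scaleR (inverse (norm T)) T"
definition [code del]: "(uniformity :: ('a tc \<times> 'a tc) filter) = (INF e\<in>{0<..}. principal {(x, y). dist x y < e})"
definition [code del]: "open (U :: 'a tc set) = (\<forall>x\<in>U. eventually (\<lambda>(x', y). x' = x \<longrightarrow> y \<in> U) uniformity)"

lemma op_of_zero [simp]: "op_of (0 :: 'a tc) = 0"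
  and op_of_add [simp]: "op_of (S + T :: 'a tc) = op_of S + op_of T"
  and op_of_diff [simp]: "op_of (S - T :: 'a tc) = op_of S - op_of T"
  and op_of_minus [simp]: "op_of (- T :: 'a tc) = - op_of T"
  and op_of_scaleR [simp]: "op_of (r *\<^sub>R T :: 'a tc) = r *\<^sub>R op_of T"
  by (simp_all add: zero_tc_def plus_tc_def minus_tc_def uminus_tc_def scaleR_tc_def
      trace_class_zero trace_class_add trace_class_diff trace_class_minus trace_class_scaleR)

instance
proof
  fix S T U :: "'a tc" and r s :: real
  show "S + T + U = S + (T + U)" "S + T = T + S" "0 + S = S" "- S + S = 0" "S - T = S + - T"
    "r *\<^sub>R (S + T) = r *\<^sub>R S + r *\<^sub>R T" "(r + s) *\<^sub>R S = r *\<^sub>R S + s *\<^sub>R S"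
    "r *\<^sub>R s *\<^sub>R S = (r * s) *\<^sub>R S" "1 *\<^sub>R S = S"
    by (simp_all flip: op_of_inject add: algebra_simps)
  show "dist S T = norm (S - T)" by (rule dist_tc_def)
  show "sgn T = scaleR (inverse (norm T)) T" by (rule sgn_tc_def)
  show "(uniformity :: ('a tc \<times> 'a tc) filter) = (INF e\<in>{0<..}. principal {(x, y). dist x y < e})"
    by (rule uniformity_tc_def)
  show "open V = (\<forall>x\<in>V. eventually (\<lambda>(x', y). x' = x \<longrightarrow> y \<in> V) uniformity)" for V :: "'a tc set"
    by (rule open_tc_def)
  show "norm S = 0 \<longleftrightarrow> S = 0"
  proof
    assume "norm S = 0"
    then have "norm (op_of S) \<le> 0"
      using norm_le_trace_norm[of "op_of S"] by (simp add: norm_tc_def)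
    then show "S = 0" by (simp flip: op_of_inject)
  qed (use trace_norm_scaleR[OF trace_class_zero, of 0] in \<open>simp add: norm_tc_def\<close>)
  show "norm (S + T) \<le> norm S + norm T"
    by (simp add: norm_tc_def trace_norm_triangle)
  show "norm (r *\<^sub>R S) = \<bar>r\<bar> * norm S"
    by (simp add: norm_tc_def trace_norm_scaleR)
qed

end

instance tc :: (complex_hilbert) banach
proof
  fix X :: "nat \<Rightarrow> 'a tc" assume X: "Cauchy X"
  have "Cauchy (\<lambda>n. op_of (X n))"
  proof (rule metric_CauchyI)
    fix e :: real assume "e > 0"
    then obtain N where N: "\<forall>m\<ge>N. \<forall>n\<ge>N. dist (X m) (X n) < e"
      using X unfolding Cauchy_def by blast
    have "dist (op_of S) (op_of T) \<le> dist S T" for S T :: "'a tc"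
      unfolding dist_norm norm_tc_def op_of_diff by (intro norm_le_trace_norm trace_class_diff) auto
    then show "\<exists>N. \<forall>m\<ge>N. \<forall>n\<ge>N. dist (op_of (X m)) (op_of (X n)) < e"
      using N le_less_trans by blast
  qed
  then obtain L where L: "(\<lambda>n. op_of (X n)) \<longlonglongrightarrow> L"
    using Cauchy_convergent_iff convergent_def by blast
  have close: "op_of (X n) - L \<in> trace_class \<and> trace_norm (op_of (X n) - L) \<le> e"
    if N: "\<forall>m\<ge>N. dist (X n) (X m) < e" for n N e
  proof -
    have "\<And>m. op_of (X n) - op_of (X m) \<in> trace_class"
      by (intro trace_class_diff) auto
    moreover have "(\<lambda>m. op_of (X n) - op_of (X m)) \<longlonglongrightarrow> op_of (X n) - L"
      by (intro tendsto_intros L)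
    moreover have "eventually (\<lambda>m. trace_norm (op_of (X n) - op_of (X m)) \<le> e) sequentially"
      using N by (auto simp: eventually_sequentially dist_norm norm_tc_def intro!: exI[of _ N] less_imp_le)
    ultimately show ?thesis
      by (intro conjI) (rule trace_norm_lower_semicontinuous; assumption)+
  qed
  have "L \<in> trace_class"
  proof -
    obtain N where "\<forall>m\<ge>N. \<forall>n\<ge>N. dist (X m) (X n) < 1"
      using X unfolding Cauchy_def by (meson zero_less_one)
    then have "op_of (X N) - L \<in> trace_class" using close[of N N 1] by blast
    then have "op_of (X N) - (op_of (X N) - L) \<in> trace_class"
      by (rule trace_class_diff[OF op_of_trace_class])
    then show ?thesis by simp
  qed
  have "X \<longlonglongrightarrow> Tc L"
  proof (rule metric_LIMSEQ_I)
    fix e :: real assume "e > 0"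
    then have "e / 2 > 0" by simp
    then obtain N where N: "\<forall>m\<ge>N. \<forall>n\<ge>N. dist (X m) (X n) < e / 2"
      using X unfolding Cauchy_def by blast
    have "dist (X n) (Tc L) < e" if "n \<ge> N" for n
    proof -
      have "\<forall>m\<ge>N. dist (X n) (X m) < e / 2" using N that by blast
      then have "trace_norm (op_of (X n) - L) \<le> e / 2" using close by blast
      then show ?thesis using \<open>L \<in> trace_class\<close> \<open>e > 0\<close> by (simp add: dist_norm norm_tc_def)
    qed
    then show "\<exists>N. \<forall>n\<ge>N. dist (X n) (Tc L) < e" by blast
  qed
  then show "convergent X" by (auto simp: convergent_def)
qed

lemma norm_Tc [simp]: "T \<in> trace_class \<Longrightarrow> norm (Tc T) = trace_norm T"
  by (simp add: norm_tc_def)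

lemma bounded_linear_trace_pairing:
  assumes B: "B \<in> bounded_ops"
  shows "bounded_linear (\<lambda>T. tr (op_of T o\<^sub>L B))"
proof (rule bounded_linear_intro[where K = "norm B"])
  have tc: "op_of T o\<^sub>L B \<in> trace_class" for T
    using B by (simp add: trace_class_compose_right)
  show "tr (op_of (S + T) o\<^sub>L B) = tr (op_of S o\<^sub>L B) + tr (op_of T o\<^sub>L B)" for S T
    by (simp add: blinfun_compose_add_left tr_add tc)
  show "tr (op_of (r *\<^sub>R T) o\<^sub>L B) = r *\<^sub>R tr (op_of T o\<^sub>L B)" for r T
    by (simp add: scaleR_eq_scaleC[where 'a = "'a op"] blinfun_compose_scaleC_left tr_scaleC tc scaleR_conv_of_real)
  show "norm (tr (op_of T o\<^sub>L B)) \<le> norm T * norm B" for T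
    using cmod_tr_compose_le[OF B op_of_trace_class, of T] B by (simp add: tr_commute norm_tc_def mult.commute)
qed

section \<open>Quantum operations and their duals\<close>

lemma quantum_operation_trace_class: "quantum_operation \<Phi> \<Longrightarrow> T \<in> trace_class \<Longrightarrow> \<Phi> T \<in> trace_class"
  and quantum_operation_add: "quantum_operation \<Phi> \<Longrightarrow> S \<in> trace_class \<Longrightarrow> T \<in> trace_class \<Longrightarrow> \<Phi> (S + T) = \<Phi> S + \<Phi> T"
  and quantum_operation_scaleC: "quantum_operation \<Phi> \<Longrightarrow> T \<in> trace_class \<Longrightarrow> \<Phi> (c *\<^sub>C T) = c *\<^sub>C \<Phi> T"
  and quantum_operation_tr: "quantum_operation \<Phi> \<Longrightarrow> T \<in> trace_class \<Longrightarrow> tr (\<Phi> T) = tr T"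
  and quantum_operation_completely_positive: "quantum_operation \<Phi> \<Longrightarrow> completely_positive \<Phi>"
  by (auto simp: quantum_operation_def)

lemma quantum_operation_positive:
  assumes \<Phi>: "quantum_operation \<Phi>" and P: "positive_op P" "P \<in> trace_class"
  shows "positive_op (\<Phi> P)"
proof -
  have "positive_block (Suc 0) (\<lambda>i j. P)"
    using P(1) by (simp add: positive_block_def positive_op_def)
  then have "positive_block (Suc 0) (\<lambda>i j. \<Phi> P)"
    using quantum_operation_completely_positive[OF \<Phi>, unfolded completely_positive_def, rule_format,
        of "Suc 0" "\<lambda>i j. P"] P(2) by simp
  then have "cinner x (\<Phi> P x) \<in> \<real>\<^sub>\<ge>\<^sub>0" for x
    unfolding positive_block_def by (drule_tac x = "\<lambda>_. x" in spec) simp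
  then show ?thesis
    unfolding positive_op_def using trace_class_bounded_ops[OF quantum_operation_trace_class[OF \<Phi> P(2)]] by blast
qed

text \<open>
  Every trace class operator is a combination of four positive ones, of comparable trace norm:
  polarize the factorization \<open>T = S\<^sup>* R\<close>.
\<close>

lemma trace_class_polarization:
  assumes T: "T \<in> trace_class"
  shows "\<exists>P. (\<forall>c. positive_op (P c) \<and> P c \<in> trace_class \<and> (cmod c = 1 \<longrightarrow> trace_norm (P c) \<le> 4 * trace_norm T)) \<and>
    T = (1/4) *\<^sub>C P 1 + (-1/4) *\<^sub>C P (-1) + (\<i>/4) *\<^sub>C P \<i> + (-\<i>/4) *\<^sub>C P (-\<i>)"
proof -
  obtain S R where SR: "hilbert_schmidt S" "hilbert_schmidt R" and T_eq: "T = adj S o\<^sub>L R"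
    and n: "hs_norm_sq S \<le> trace_norm T" "hs_norm_sq R = trace_norm T"
    by (rule trace_class_factorization[OF T])
  have b: "S \<in> bounded_ops" "R \<in> bounded_ops" using SR by (auto intro: hilbert_schmidt_bounded_ops)
  define W where "W c = R + c *\<^sub>C S" for c
  define P where "P c = adj (W c) o\<^sub>L W c" for c
  have W: "hilbert_schmidt (W c)" for c
    unfolding W_def by (intro hilbert_schmidt_add hilbert_schmidt_scaleC SR)
  have pos: "positive_op (P c)" for c
    unfolding P_def by (rule positive_op_adj_compose[OF hilbert_schmidt_bounded_ops[OF W]])
  have tc: "P c \<in> trace_class" for c
    unfolding P_def by (rule trace_class_adj_compose[OF W W])
  have "trace_norm (P c) \<le> 4 * trace_norm T" if c: "cmod c = 1" for c
  proof -
    have "trace_norm (P c) = hs_norm_sq (W c)"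
      using trace_norm_positive[OF pos tc, of c] tr_adj_compose_self[OF W, of c] by (simp add: P_def)
    also have "\<dots> \<le> 2 * hs_norm_sq R + 2 * hs_norm_sq (c *\<^sub>C S)"
      unfolding W_def by (intro hilbert_schmidt_add hilbert_schmidt_scaleC SR)
    finally show ?thesis using n c by (simp add: hilbert_schmidt_scaleC[OF SR(1)])
  qed
  moreover have "T = (1/4) *\<^sub>C P 1 + (-1/4) *\<^sub>C P (-1) + (\<i>/4) *\<^sub>C P \<i> + (-\<i>/4) *\<^sub>C P (-\<i>)"
  proof (rule op_eqI)
    fix x y
    have "cinner x (P c y) = cinner (R x) (R y) + c * cinner (R x) (S y) + cnj c * cinner (S x) (R y) + (cnj c * c) * cinner (S x) (S y)" for c
      by (simp add: P_def W_def cinner_adj_right b adj_add adj_scaleC blinfun.add_left cinner.add_left cinner.add_right algebra_simps)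
    then show "cinner x (T y) = cinner x (((1/4) *\<^sub>C P 1 + (-1/4) *\<^sub>C P (-1) + (\<i>/4) *\<^sub>C P \<i> + (-\<i>/4) *\<^sub>C P (-\<i>)) y)"
      by (simp add: T_eq cinner_adj_right b blinfun.add_left cinner.add_right blinfun.diff_left blinfun.minus_left
          cinner.diff_right cinner.minus_right algebra_simps)
  qed
  ultimately show ?thesis
    using pos tc by (intro exI[of _ P]) simp
qed

lemma trace_class_positive_induct [consumes 1, case_names positive add scale]:
  assumes T: "T \<in> trace_class"
    and pos: "\<And>P. positive_op P \<Longrightarrow> P \<in> trace_class \<Longrightarrow> X P"
    and add: "\<And>S T. S \<in> trace_class \<Longrightarrow> T \<in> trace_class \<Longrightarrow> X S \<Longrightarrow> X T \<Longrightarrow> X (S + T)"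
    and scale: "\<And>c T. T \<in> trace_class \<Longrightarrow> X T \<Longrightarrow> X (c *\<^sub>C T)"
  shows "X T"
proof -
  from trace_class_polarization[OF T] obtain P
    where P': "\<forall>c. positive_op (P c) \<and> P c \<in> trace_class \<and> (cmod c = 1 \<longrightarrow> trace_norm (P c) \<le> 4 * trace_norm T)"
    and eq: "T = (1/4) *\<^sub>C P 1 + (-1/4) *\<^sub>C P (-1) + (\<i>/4) *\<^sub>C P \<i> + (-\<i>/4) *\<^sub>C P (-\<i>)"
    by (elim exE conjE) (rule that)
  then have P: "positive_op (P c)" "P c \<in> trace_class" for c by simp_all
  show ?thesis
    unfolding eq by (intro add scale pos trace_class_add trace_class_scaleC P)
qed

text \<open>
  On positive operators the trace norm is the trace, which \<open>\<Phi>\<close> preserves; the constant counts the four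
  positive parts and is far from optimal.
\<close>

lemma quantum_operation_trace_norm_le:
  assumes \<Phi>: "quantum_operation \<Phi>" and T: "T \<in> trace_class"
  shows "trace_norm (\<Phi> T) \<le> 4 * trace_norm T"
proof -
  from trace_class_polarization[OF T] obtain P
    where P': "\<forall>c. positive_op (P c) \<and> P c \<in> trace_class \<and> (cmod c = 1 \<longrightarrow> trace_norm (P c) \<le> 4 * trace_norm T)"
    and eq: "T = (1/4) *\<^sub>C P 1 + (-1/4) *\<^sub>C P (-1) + (\<i>/4) *\<^sub>C P \<i> + (-\<i>/4) *\<^sub>C P (-\<i>)"
    by (elim exE conjE) (rule that)
  then have P: "positive_op (P c)" "P c \<in> trace_class" "cmod c = 1 \<Longrightarrow> trace_norm (P c) \<le> 4 * trace_norm T" for c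
    by simp_all
  have tc: "\<Phi> (P c) \<in> trace_class" for c
    by (rule quantum_operation_trace_class[OF \<Phi> P(2)])
  have le: "trace_norm (d *\<^sub>C \<Phi> (P c)) \<le> trace_norm T" if "cmod c = 1" "cmod d = 1/4" for c d
  proof -
    have "complex_of_real (trace_norm (\<Phi> (P c))) = of_real (trace_norm (P c))"
      using trace_norm_positive[OF quantum_operation_positive[OF \<Phi> P(1,2)] tc] trace_norm_positive[OF P(1,2)]
        quantum_operation_tr[OF \<Phi> P(2)] by metis
    then show ?thesis
      using trace_norm_scaleC_le[OF tc, of d c] P(3)[OF that(1)] that(2) by simp
  qed
  have "\<Phi> T = (1/4) *\<^sub>C \<Phi> (P 1) + (-1/4) *\<^sub>C \<Phi> (P (-1)) + (\<i>/4) *\<^sub>C \<Phi> (P \<i>) + (-\<i>/4) *\<^sub>C \<Phi> (P (-\<i>))"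
    by (subst eq)
      (simp only: quantum_operation_add[OF \<Phi>] quantum_operation_scaleC[OF \<Phi>] trace_class_add trace_class_scaleC P)
  also have "trace_norm \<dots> \<le> trace_norm T + trace_norm T + trace_norm T + trace_norm T"
    by (intro order_trans[OF trace_norm_triangle] add_mono le trace_class_add trace_class_scaleC tc)
      (auto simp: norm_divide)
  finally show ?thesis by simp
qed

text \<open>
  A bounded functional that vanishes on rank one operators vanishes on positive \<open>P\<close> and so everywhere.
  For \<open>P = Q\<^sup>2\<close> the finite rank operators \<open>\<Sum>e\<in>F. rank_one (Q e) (Q e)\<close> lie below \<open>P\<close>, and the
  trace norm of the positive remainder is a tail of the convergent series for \<open>tr P\<close>.
\<close>

lemma trace_functional_eq_0:
  fixes f :: "'a::complex_hilbert op \<Rightarrow> complex"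
  assumes add: "\<And>S T. S \<in> trace_class \<Longrightarrow> T \<in> trace_class \<Longrightarrow> f (S + T) = f S + f T"
    and scale: "\<And>c T. T \<in> trace_class \<Longrightarrow> f (c *\<^sub>C T) = c * f T"
    and bound: "\<And>T. T \<in> trace_class \<Longrightarrow> cmod (f T) \<le> K * trace_norm T"
    and rank_one: "\<And>x y. f (rank_one x y) = 0" and T: "T \<in> trace_class"
  shows "f T = 0"
  using T
proof (induction rule: trace_class_positive_induct)
  fix P :: "'a op" assume P: "positive_op P" "P \<in> trace_class"
  obtain V Q where Q: "positive_op Q" "hilbert_schmidt Q" "abs_op P = Q o\<^sub>L Q" and n: "hs_norm_sq Q = trace_norm P"
    by (rule trace_class_polar[OF P(2)])
  have PQ: "P = Q o\<^sub>L Q" using Q(3) P(1) by simp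
  define D where "D F = (\<Sum>e\<in>F. rank_one (Q e) (Q e))" for F
  have D_tc: "D F \<in> trace_class" for F
    unfolding D_def by (rule trace_class_sum) auto
  have f0: "f 0 = 0" using scale[OF trace_class_zero, of 0] by simp
  have fD: "f (D F) = 0" for F
    unfolding D_def
  proof (induction F rule: infinite_finite_induct)
    case (insert e F)
    then show ?case
      using add[OF rank_one_trace_class D_tc[unfolded D_def], of "Q e" "Q e" F] by (simp add: rank_one)
  qed (simp_all add: f0)
  have le: "cmod (f P) \<le> K * (trace_norm P - (\<Sum>e\<in>F. (norm (Q e))\<^sup>2))" if F: "finite F" "F \<subseteq> some_onb" for F
  proof -
    have R_tc: "P - D F \<in> trace_class" by (rule trace_class_diff[OF P(2) D_tc])
    have R_pos: "positive_op (P - D F)"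
    proof (rule positive_opI)
      fix x
      have "cinner x (rank_one (Q e) (Q e) x) = of_real ((cmod (cinner e (Q x)))\<^sup>2)" for e
        unfolding complex_norm_square
        using positive_op_cinner[OF Q(1), of e x] cinner_commute[of x "Q e"] by simp
      then have "cinner x ((P - D F) x) = of_real ((norm (Q x))\<^sup>2 - (\<Sum>e\<in>F. (cmod (cinner e (Q x)))\<^sup>2))"
        using positive_op_cinner[OF Q(1), of x "Q x"]
        by (simp add: PQ D_def blinfun.diff_left blinfun.sum_left cinner.diff_right cinner.sum_right cinner_self
            del: rank_one_apply)
      moreover have "0 \<le> (norm (Q x))\<^sup>2 - (\<Sum>e\<in>F. (cmod (cinner e (Q x)))\<^sup>2)"
        using bessel_inequality[OF is_onb_orthonormal[OF is_onb_some_onb] F, of "Q x"] by simp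
      ultimately show "\<exists>r\<ge>0. cinner x ((P - D F) x) = complex_of_real r" by blast
    qed (use R_tc in \<open>rule trace_class_bounded_ops\<close>)
    have "tr (D F) = of_real (\<Sum>e\<in>F. (norm (Q e))\<^sup>2)"
      by (simp add: D_def tr_sum cinner_self)
    then have "complex_of_real (trace_norm (P - D F)) = of_real (trace_norm P - (\<Sum>e\<in>F. (norm (Q e))\<^sup>2))"
      unfolding trace_norm_positive[OF R_pos R_tc, symmetric]
      by (simp add: tr_diff P(2) D_tc trace_norm_positive[OF P])
    then have "trace_norm (P - D F) = trace_norm P - (\<Sum>e\<in>F. (norm (Q e))\<^sup>2)"
      unfolding of_real_eq_iff .
    moreover have "f P = f (P - D F)"
      using add[OF R_tc D_tc, of F] fD by simp
    ultimately show ?thesis using bound[OF R_tc] by simp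
  qed
  have "cmod (f P) \<le> K * (trace_norm P - hs_norm_sq Q)"
  proof (rule tendsto_lowerbound)
    have "((\<lambda>e. (norm (Q e))\<^sup>2) has_sum hs_norm_sq Q) some_onb"
      using Q(2) unfolding hs_norm_sq_def hilbert_schmidt_def by (intro has_sum_infsum) simp
    then show "((\<lambda>F. K * (trace_norm P - (\<Sum>e\<in>F. (norm (Q e))\<^sup>2))) \<longlongrightarrow> K * (trace_norm P - hs_norm_sq Q))
        (finite_subsets_at_top some_onb)"
      unfolding has_sum_def by (intro tendsto_intros)
    show "eventually (\<lambda>F. cmod (f P) \<le> K * (trace_norm P - (\<Sum>e\<in>F. (norm (Q e))\<^sup>2))) (finite_subsets_at_top some_onb)"
      by (intro eventually_finite_subsets_at_top_weakI le)
  qed simp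
  then show "f P = 0" by (simp add: n)
qed (auto simp: add scale)

text \<open>
  On rank one operators \<open>T \<mapsto> tr (\<Phi> T S)\<close> is a bounded sesquilinear form, and \<open>S'\<close> is the operator
  representing it. The two functionals then agree on all trace class operators by continuity.
\<close>

lemma dual_map_exists:
  fixes \<Phi> :: "'a::complex_hilbert op \<Rightarrow> 'a op"
  assumes \<Phi>: "quantum_operation \<Phi>" and S: "S \<in> bounded_ops"
  shows "\<exists>S'. S' \<in> bounded_ops \<and> (\<forall>T\<in>trace_class. tr (\<Phi> T o\<^sub>L S) = tr (T o\<^sub>L S'))"
proof -
  define g where "g T = tr (\<Phi> T o\<^sub>L S)" for T
  have tc: "\<Phi> T o\<^sub>L S \<in> trace_class" if "T \<in> trace_class" for T
    by (rule trace_class_compose_right[OF S quantum_operation_trace_class[OF \<Phi> that]])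
  have g_add: "g (T + U) = g T + g U" if "T \<in> trace_class" "U \<in> trace_class" for T U
    using that by (simp add: g_def quantum_operation_add[OF \<Phi>] blinfun_compose_add_left tr_add tc)
  have g_scale: "g (c *\<^sub>C T) = c * g T" if "T \<in> trace_class" for c T
    using that by (simp add: g_def quantum_operation_scaleC[OF \<Phi>] blinfun_compose_scaleC_left tr_scaleC tc)
  have g_bound: "cmod (g T) \<le> norm S * (4 * trace_norm T)" if T: "T \<in> trace_class" for T
  proof -
    have "cmod (g T) \<le> norm S * trace_norm (\<Phi> T)"
      unfolding g_def tr_commute[OF quantum_operation_trace_class[OF \<Phi> T] S]
      by (rule cmod_tr_compose_le[OF S quantum_operation_trace_class[OF \<Phi> T]])
    also have "\<dots> \<le> norm S * (4 * trace_norm T)"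
      by (intro mult_left_mono quantum_operation_trace_norm_le[OF \<Phi> T]) auto
    finally show ?thesis .
  qed
  have bound: "cmod (g (rank_one z x)) \<le> (norm S * 4) * norm x * norm (id_blinfun z)" for x z
  proof -
    have "norm S * (4 * trace_norm (rank_one z x)) \<le> norm S * (4 * (norm z * norm x))"
      by (intro mult_left_mono trace_norm_rank_one_le) auto
    then show ?thesis using g_bound[of "rank_one z x"] by (simp add: ac_simps)
  qed
  obtain V where V: "V \<in> bounded_ops" "\<And>x z. cinner (blinfun_apply V x) (id_blinfun z) = g (rank_one z x)"
    by (rule sesquilinear_form_representation[where b = "\<lambda>x z. g (rank_one z x)" and P = id_blinfun, OF _ _ _ _ _ _ bound])
      (auto simp: rank_one_add_left rank_one_add_right rank_one_scaleC_left rank_one_scaleC_right g_add g_scale)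
  define S' where "S' = adj V"
  have S': "S' \<in> bounded_ops" "cinner x (S' z) = g (rank_one z x)" for x z
    using V by (auto simp: S'_def cinner_adj_right)
  have "g T - tr (T o\<^sub>L S') = 0" if "T \<in> trace_class" for T
  proof (rule trace_functional_eq_0[where f = "\<lambda>T. g T - tr (T o\<^sub>L S')" and K = "norm S * 4 + norm S'", OF _ _ _ _ that])
    have tc': "T o\<^sub>L S' \<in> trace_class" if "T \<in> trace_class" for T
      by (rule trace_class_compose_right[OF S'(1) that])
    show "g (T + U) - tr ((T + U) o\<^sub>L S') = (g T - tr (T o\<^sub>L S')) + (g U - tr (U o\<^sub>L S'))"
      if "T \<in> trace_class" "U \<in> trace_class" for T U
      using that by (simp add: g_add blinfun_compose_add_left tr_add tc')
    show "g (c *\<^sub>C T) - tr ((c *\<^sub>C T) o\<^sub>L S') = c * (g T - tr (T o\<^sub>L S'))" if "T \<in> trace_class" for c T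
      using that by (simp add: g_scale blinfun_compose_scaleC_left tr_scaleC tc' right_diff_distrib)
    show "cmod (g T - tr (T o\<^sub>L S')) \<le> (norm S * 4 + norm S') * trace_norm T" if T: "T \<in> trace_class" for T
    proof -
      have "cmod (tr (T o\<^sub>L S')) \<le> norm S' * trace_norm T"
        unfolding tr_commute[OF T S'(1)] by (rule cmod_tr_compose_le[OF S'(1) T])
      then show ?thesis
        using norm_triangle_ineq4[of "g T" "tr (T o\<^sub>L S')"] g_bound[OF T] by (simp add: algebra_simps)
    qed
    show "g (rank_one x y) - tr (rank_one x y o\<^sub>L S') = 0" for x y
      by (simp add: tr_rank_one_compose S')
  qed
  then show ?thesis
    using S'(1) by (intro exI[of _ S']) (simp add: g_def)
qed

lemma dual_map_eqI:
  assumes R: "R \<in> bounded_ops" and eq: "\<And>T. T \<in> trace_class \<Longrightarrow> tr (\<Phi> T o\<^sub>L S) = tr (T o\<^sub>L R)"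
  shows "\<Phi>\<^sup>\<sharp> S = R"
  unfolding dual_map_def
proof (rule the_equality)
  show "R \<in> bounded_ops \<and> (\<forall>T\<in>trace_class. tr (\<Phi> T o\<^sub>L S) = tr (T o\<^sub>L R))"
    using R eq by auto
  show "R' = R" if R': "R' \<in> bounded_ops \<and> (\<forall>T\<in>trace_class. tr (\<Phi> T o\<^sub>L S) = tr (T o\<^sub>L R'))" for R'
    by (rule bounded_ops_eqI) (use R' R eq in auto)
qed

lemma dual_map_properties:
  assumes "quantum_operation \<Phi>" "S \<in> bounded_ops"
  shows "\<Phi>\<^sup>\<sharp> S \<in> bounded_ops \<and> (\<forall>T\<in>trace_class. tr (\<Phi> T o\<^sub>L S) = tr (T o\<^sub>L \<Phi>\<^sup>\<sharp> S))"
proof -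
  obtain R where R: "R \<in> bounded_ops \<and> (\<forall>T\<in>trace_class. tr (\<Phi> T o\<^sub>L S) = tr (T o\<^sub>L R))"
    using dual_map_exists[OF assms] by (elim exE) (rule that)
  then have "\<Phi>\<^sup>\<sharp> S = R" by (intro dual_map_eqI) auto
  then show ?thesis using R by simp
qed

lemma dual_map_bounded_ops: "quantum_operation \<Phi> \<Longrightarrow> S \<in> bounded_ops \<Longrightarrow> \<Phi>\<^sup>\<sharp> S \<in> bounded_ops"
  and tr_dual_map: "quantum_operation \<Phi> \<Longrightarrow> S \<in> bounded_ops \<Longrightarrow> T \<in> trace_class \<Longrightarrow> tr (\<Phi> T o\<^sub>L S) = tr (T o\<^sub>L \<Phi>\<^sup>\<sharp> S)"
  using dual_map_properties by auto

lemma cinner_dual_map: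
  "quantum_operation \<Phi> \<Longrightarrow> S \<in> bounded_ops \<Longrightarrow> cinner x (\<Phi>\<^sup>\<sharp> S y) = tr (\<Phi> (rank_one y x) o\<^sub>L S)"
  by (simp add: tr_dual_map tr_rank_one_compose dual_map_bounded_ops)

lemma dual_map_eqI_rank_one:
  assumes \<Phi>: "quantum_operation \<Phi>" and S: "S \<in> bounded_ops" and R: "R \<in> bounded_ops"
    and eq: "\<And>x. tr (\<Phi> (rank_one x x) o\<^sub>L S) = cinner x (R x)"
  shows "\<Phi>\<^sup>\<sharp> S = R"
  by (rule op_eqI_quadratic[OF dual_map_bounded_ops[OF \<Phi> S] R]) (simp add: cinner_dual_map \<Phi> S eq)

lemma dual_map_id: "quantum_operation \<Phi> \<Longrightarrow> \<Phi>\<^sup>\<sharp> id_blinfun = id_blinfun"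
  by (rule dual_map_eqI) (auto simp: quantum_operation_tr)

text \<open>
  It suffices that \<open>\<Phi>\<close> maps \<open>rank_one x x\<close> to a positive, hence self-adjoint, operator.
\<close>

lemma dual_map_adj:
  assumes \<Phi>: "quantum_operation \<Phi>" and S: "S \<in> bounded_ops"
  shows "\<Phi>\<^sup>\<sharp> (adj S) = adj (\<Phi>\<^sup>\<sharp> S)"
proof (rule dual_map_eqI_rank_one[OF \<Phi>])
  fix x
  let ?P = "\<Phi> (rank_one x x)"
  have P: "?P \<in> trace_class" "adj ?P = ?P"
    using quantum_operation_trace_class[OF \<Phi>] positive_op_adj[OF quantum_operation_positive[OF \<Phi> positive_rank_one]] by auto
  have "tr (?P o\<^sub>L adj S) = tr (adj (S o\<^sub>L ?P))"
    using P S by (simp add: adj_compose trace_class_bounded_ops)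
  also have "\<dots> = cnj (tr (?P o\<^sub>L S))"
    using P S by (simp add: tr_adj trace_class_compose_left tr_commute)
  also have "\<dots> = cinner x (adj (\<Phi>\<^sup>\<sharp> S) x)"
    using cinner_commute[of "\<Phi>\<^sup>\<sharp> S x" x] by (simp add: cinner_dual_map \<Phi> S cinner_adj_right dual_map_bounded_ops)
  finally show "tr (?P o\<^sub>L adj S) = cinner x (adj (\<Phi>\<^sup>\<sharp> S) x)" .
qed (use S in \<open>auto intro: dual_map_bounded_ops[OF \<Phi>]\<close>)

lemma has_sum_finite_sum:
  fixes f :: "'j \<Rightarrow> 'i \<Rightarrow> 'b::real_normed_vector"
  assumes "\<And>j. j \<in> J \<Longrightarrow> (f j has_sum s j) I"
  shows "((\<lambda>i. \<Sum>j\<in>J. f j i) has_sum (\<Sum>j\<in>J. s j)) I"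
  using assms by (induction J rule: infinite_finite_induct) (auto intro: has_sum_add)

lemma has_sum_nonneg_Reals:
  fixes f :: "'i \<Rightarrow> complex"
  assumes "(f has_sum s) I" "\<And>i. i \<in> I \<Longrightarrow> f i \<in> \<real>\<^sub>\<ge>\<^sub>0"
  shows "s \<in> \<real>\<^sub>\<ge>\<^sub>0"
proof -
  have "Re s \<ge> 0"
    by (rule has_sum_nonneg[OF has_sum_Re[OF assms(1)]]) (use assms(2) in \<open>simp add: complex_nonneg_Reals_iff\<close>)
  moreover have "((\<lambda>i. Im (f i)) has_sum 0) I"
    by (rule has_sum_0) (use assms(2) in \<open>simp add: complex_nonneg_Reals_iff\<close>)
  then have "Im s = 0" using has_sum_Im[OF assms(1)] has_sum_unique by blast
  ultimately show ?thesis by (simp add: complex_nonneg_Reals_iff)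
qed

text \<open>
  Complete positivity of the dual map on block operators of the form \<open>V\<^sub>i\<^sup>* V\<^sub>j\<close>. The block
  operator of the \<open>rank_one (x j) (x i)\<close> is positive, hence so is its image \<open>R\<close> under \<open>\<Phi>\<close>; cyclicity
  turns the pairing of \<open>R\<close> with \<open>V\<^sub>i\<^sup>* V\<^sub>j\<close> into the trace of \<open>\<Sum>i j. V\<^sub>j R\<^sub>j\<^sub>i V\<^sub>i\<^sup>*\<close>, whose
  diagonal entries are values of the form of \<open>R\<close>.
\<close>

lemma dual_map_completely_positive:
  fixes \<Phi> :: "'a::complex_hilbert op \<Rightarrow> 'a op" and V :: "nat \<Rightarrow> 'a op"
  assumes \<Phi>: "quantum_operation \<Phi>" and V: "\<And>i. V i \<in> bounded_ops"
  shows "(\<Sum>i<n. \<Sum>j<n. cinner (x i) (\<Phi>\<^sup>\<sharp> (adj (V i) o\<^sub>L V j) (x j))) \<in> \<real>\<^sub>\<ge>\<^sub>0"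
proof -
  define R where "R j i = \<Phi> (rank_one (x j) (x i))" for j i
  have R_tc: "R j i \<in> trace_class" for i j
    unfolding R_def by (rule quantum_operation_trace_class[OF \<Phi>]) simp
  have "positive_block n (\<lambda>j i. rank_one (x j) (x i))"
    unfolding positive_block_def
  proof
    fix y :: "nat \<Rightarrow> 'a"
    define s where "s = (\<Sum>i<n. cinner (x i) (y i))"
    have "(\<Sum>j<n. \<Sum>i<n. cinner (y j) (rank_one (x j) (x i) (y i))) = (\<Sum>j<n. cinner (y j) (x j)) * s"
      unfolding s_def sum_product by (intro sum.cong refl) (simp add: mult.commute)
    also have "(\<Sum>j<n. cinner (y j) (x j)) = cnj s"
      unfolding s_def cnj_sum by (intro sum.cong refl cinner_commute)
    also have "cnj s * s = of_real ((cmod s)\<^sup>2)"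
      by (simp only: complex_norm_square mult.commute)
    also have "\<dots> \<in> \<real>\<^sub>\<ge>\<^sub>0" by (simp only: nonneg_Reals_of_real_iff zero_le_power2)
    finally show "(\<Sum>j<n. \<Sum>i<n. cinner (y j) (rank_one (x j) (x i) (y i))) \<in> \<real>\<^sub>\<ge>\<^sub>0" .
  qed
  then have "positive_block n R"
    unfolding R_def
    using quantum_operation_completely_positive[OF \<Phi>, unfolded completely_positive_def, rule_format,
        of n "\<lambda>j i. rank_one (x j) (x i)"] by simp
  then have R_pos: "(\<Sum>j<n. \<Sum>i<n. cinner (y j) (R j i (y i))) \<in> \<real>\<^sub>\<ge>\<^sub>0" for y
    by (simp add: positive_block_def)
  have eq: "cinner (x i) (\<Phi>\<^sup>\<sharp> (adj (V i) o\<^sub>L V j) (x j)) = tr (V j o\<^sub>L R j i o\<^sub>L adj (V i))" for i j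
  proof -
    have "cinner (x i) (\<Phi>\<^sup>\<sharp> (adj (V i) o\<^sub>L V j) (x j)) = tr ((R j i o\<^sub>L adj (V i)) o\<^sub>L V j)"
      by (simp add: cinner_dual_map[OF \<Phi>] V R_def blinfun_compose_assoc)
    also have "\<dots> = tr (V j o\<^sub>L R j i o\<^sub>L adj (V i))"
      using tr_commute[OF trace_class_compose_right[OF adj_bounded_ops[OF V] R_tc] V]
      by (simp add: blinfun_compose_assoc)
    finally show ?thesis .
  qed
  have hs: "((\<lambda>e. cinner (adj (V j) e) (R j i (adj (V i) e))) has_sum tr (V j o\<^sub>L R j i o\<^sub>L adj (V i))) some_onb" for i j
    using trace_has_sum[of "V j o\<^sub>L R j i o\<^sub>L adj (V i)"]
    by (simp add: V R_tc trace_class_compose_left trace_class_compose_right cinner_adj_left)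
  have "((\<lambda>e. \<Sum>i<n. \<Sum>j<n. cinner (adj (V j) e) (R j i (adj (V i) e)))
      has_sum (\<Sum>i<n. \<Sum>j<n. cinner (x i) (\<Phi>\<^sup>\<sharp> (adj (V i) o\<^sub>L V j) (x j)))) some_onb"
    unfolding eq by (intro has_sum_finite_sum hs)
  then show ?thesis
  proof (rule has_sum_nonneg_Reals)
    show "(\<Sum>i<n. \<Sum>j<n. cinner (adj (V j) e) (R j i (adj (V i) e))) \<in> \<real>\<^sub>\<ge>\<^sub>0" for e
      using R_pos[of "\<lambda>j. adj (V j) e"] by (subst sum.swap)
  qed
qed

text \<open>
  The block operator of the dual map on \<open>V = (1, A, S\<^sup>*)\<close> is positive, and its form vanishes at
  \<open>(- A y, y, 0)\<close> because \<open>A\<close> and \<open>A\<^sup>* A\<close> are fixed. By Cauchy--Schwarz such a null vector is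
  orthogonal to \<open>(0, 0, z)\<close> for every \<open>z\<close>, and this orthogonality is the claim.
\<close>

lemma dual_map_multiplicative:
  fixes \<Phi> :: "'a::complex_hilbert op \<Rightarrow> 'a op"
  assumes \<Phi>: "quantum_operation \<Phi>" and A: "A \<in> bounded_ops" and S: "S \<in> bounded_ops"
    and fix1: "\<Phi>\<^sup>\<sharp> A = A" and fix2: "\<Phi>\<^sup>\<sharp> (adj A o\<^sub>L A) = adj A o\<^sub>L A"
  shows "\<Phi>\<^sup>\<sharp> (S o\<^sub>L A) = \<Phi>\<^sup>\<sharp> S o\<^sub>L A"
proof (rule blinfun_eqI)
  fix y
  define M N W where "M = \<Phi>\<^sup>\<sharp> S" and "N = \<Phi>\<^sup>\<sharp> (S o\<^sub>L A)" and "W = \<Phi>\<^sup>\<sharp> (S o\<^sub>L adj S)"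
  have MNW: "M \<in> bounded_ops" "N \<in> bounded_ops" "W \<in> bounded_ops"
    using A S by (auto simp: M_def N_def W_def intro!: dual_map_bounded_ops[OF \<Phi>])
  define d where "d = N y - M (A y)"
  have ineq: "0 \<le> 2 * Re (cinner z d) + Re (cinner z (W z))" for z
  proof -
    define V where "V i = (if i = 0 then id_blinfun else if i = Suc 0 then A else adj S)" for i :: nat
    define x where "x i = (if i = 0 then - A y else if i = Suc 0 then y else z)" for i :: nat
    have V: "V i \<in> bounded_ops" for i using A S by (simp add: V_def)
    have e: "adj A o\<^sub>L adj S = adj (S o\<^sub>L A)" using A S by (simp add: adj_compose)
    have sum_eq: "(\<Sum>i<Suc (Suc (Suc 0)). \<Sum>j<Suc (Suc (Suc 0)). cinner (x i) (\<Phi>\<^sup>\<sharp> (adj (V i) o\<^sub>L V j) (x j)))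
        = cinner d z + cinner z d + cinner z (W z)"
      using A S MNW
      by (simp add: V_def x_def e dual_map_id[OF \<Phi>] dual_map_adj[OF \<Phi>] fix1 fix2 flip: M_def N_def W_def)
        (simp add: d_def cinner_adj_right blinfun.minus_right cinner.minus_left cinner.minus_right
          cinner.diff_left cinner.diff_right)
    have "cinner d z + cinner z d + cinner z (W z) \<in> \<real>\<^sub>\<ge>\<^sub>0"
      using dual_map_completely_positive[where V = V and n = "Suc (Suc (Suc 0))" and x = x, OF \<Phi> V]
      unfolding sum_eq .
    then show ?thesis
      by (simp add: complex_nonneg_Reals_iff Re_cinner_commute[of d z])
  qed
  have "d = 0"
  proof (rule ccontr)
    assume "d \<noteq> 0"
    define w where "w = Re (cinner d (W d))"
    \<comment> \<open>small enough for the linear term of the inequality at \<open>- r d\<close> to dominate the quadratic one\<close>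
    define r where "r = (norm d)\<^sup>2 / (\<bar>w\<bar> + 1)"
    have r: "r > 0" using \<open>d \<noteq> 0\<close> by (simp add: r_def add_nonneg_pos)
    have "r * w \<le> r * \<bar>w\<bar>" using r by (intro mult_left_mono) auto
    also have "\<dots> < r * (\<bar>w\<bar> + 1)" using r by simp
    also have "\<dots> = (norm d)\<^sup>2" by (simp add: r_def)
    finally have "r * w < (norm d)\<^sup>2" .
    moreover have "(norm d)\<^sup>2 * (2 * r) \<le> (r * w) * r"
      using ineq[of "(- r) *\<^sub>R d"]
      by (simp add: blinfun.minus_right blinfun.scaleR_right cinner.minus_left cinner.minus_right cinner_self w_def ac_simps)
    ultimately have "(norm d)\<^sup>2 * (2 * r) < (norm d)\<^sup>2 * r"
      using r by (meson le_less_trans mult_strict_right_mono)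
    then show False using r by (simp add: mult_less_cancel_left)
  qed
  then show "\<Phi>\<^sup>\<sharp> (S o\<^sub>L A) y = (\<Phi>\<^sup>\<sharp> S o\<^sub>L A) y"
    by (simp add: d_def M_def N_def)
qed

section \<open>Strongly continuous semigroups\<close>

text \<open>
  For every \<open>e > 0\<close> the bound \<open>norm (f r - f 0) \<le> e * r\<close> holds on a largest initial interval \<open>{0..c}\<close> of
  \<open>{0..t}\<close>, and the right derivative at \<open>c\<close> would extend it beyond \<open>c < t\<close>.
\<close>

lemma right_derivative_zero_imp_constant:
  fixes f :: "real \<Rightarrow> 'b::real_normed_vector"
  assumes cont: "continuous_on {0..} f"
    and deriv: "\<And>t. t \<ge> 0 \<Longrightarrow> ((\<lambda>h. (f (t + h) - f t) /\<^sub>R h) \<longlongrightarrow> 0) (at_right 0)"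
    and t: "t \<ge> 0"
  shows "f t = f 0"
proof -
  have bound: "norm (f t - f 0) \<le> e * t" if e: "e > 0" for e
  proof -
    define S where "S = {s \<in> {0..t}. \<forall>r\<in>{0..s}. norm (f r - f 0) \<le> e * r}"
    define c where "c = Sup S"
    have S0: "0 \<in> S" using t by (auto simp: S_def)
    have bdd: "bdd_above S" by (rule bdd_aboveI[of _ t]) (auto simp: S_def)
    have "0 \<le> c"
      unfolding c_def by (rule cSup_upper[OF S0 bdd])
    moreover have "c \<le> t"
      unfolding c_def
    proof (rule cSup_least)
      show "S \<noteq> {}" using S0 by auto
      show "s \<le> t" if "s \<in> S" for s using that by (simp add: S_def)
    qed
    ultimately have c: "0 \<le> c" "c \<le> t" by simp_all
    have below: "norm (f r - f 0) \<le> e * r" if r: "0 \<le> r" "r < c" for r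
    proof -
      obtain s where "s \<in> S" "r < s"
        using less_cSupD[of S r] r(2) S0 unfolding c_def by force
      then show ?thesis using r by (auto simp: S_def)
    qed
    have at_c: "norm (f c - f 0) \<le> e * c"
    proof (cases "c = 0")
      case False
      have "closed {r \<in> {0..t}. norm (f r - f 0) \<le> e * r}"
        by (intro continuous_on_closed_Collect_le continuous_intros closed_atLeastAtMost
            continuous_on_subset[OF cont]) auto
      moreover have "{0..<c} \<subseteq> {r \<in> {0..t}. norm (f r - f 0) \<le> e * r}"
        using below c by auto
      ultimately have "closure {0..<c} \<subseteq> {r \<in> {0..t}. norm (f r - f 0) \<le> e * r}"
        by (rule closure_minimal[rotated])
      then show ?thesis using False c by auto
    qed simp
    have "c = t"
    proof (rule ccontr)
      assume "c \<noteq> t"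
      have "eventually (\<lambda>h. norm ((f (c + h) - f c) /\<^sub>R h) < e) (at_right 0)"
        using tendstoD[OF deriv[OF c(1)] e] by simp
      then obtain d where d: "d > 0" "\<And>h. 0 < h \<Longrightarrow> h < d \<Longrightarrow> norm ((f (c + h) - f c) /\<^sub>R h) < e"
        unfolding eventually_at_right_field by blast
      define h where "h = min (d / 2) (t - c)"
      have h: "0 < h" "h < d" "c + h \<le> t"
        using d(1) c \<open>c \<noteq> t\<close> by (auto simp: h_def min_def)
      have "norm (f r - f 0) \<le> e * r" if r: "0 \<le> r" "r \<le> c + h" for r
      proof (cases "r \<le> c")
        case True
        then show ?thesis using below[of r] at_c r by (cases "r = c") auto
      next
        case False
        then have "norm ((f (c + (r - c)) - f c) /\<^sub>R (r - c)) < e"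
          using r h by (intro d(2)) auto
        then have "inverse (r - c) * norm (f r - f c) < e"
          using False by simp
        then have "norm (f r - f c) \<le> e * (r - c)"
          using False by (simp add: inverse_eq_divide pos_divide_less_eq)
        then have "norm ((f r - f c) + (f c - f 0)) \<le> e * (r - c) + e * c"
          using at_c by (rule norm_triangle_mono)
        then show ?thesis by (simp add: algebra_simps)
      qed
      then have "c + h \<in> S" using c h by (auto simp: S_def)
      then have "c + h \<le> c" unfolding c_def by (rule cSup_upper[OF _ bdd])
      then show False using h by simp
    qed
    then show ?thesis using at_c by simp
  qed
  have "norm (f t - f 0) \<le> 0 + e" if "e > 0" for e
  proof -
    have "e / (t + 1) * t \<le> e" using t that by (simp add: field_simps)
    then show ?thesis using bound[of "e / (t + 1)"] t that by simp
  qed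
  then have "norm (f t - f 0) \<le> 0" by (rule field_le_epsilon)
  then show ?thesis by simp
qed

lemma has_vector_derivative_imp_right_limit:
  fixes F :: "real \<Rightarrow> 'b::real_normed_vector"
  assumes "(F has_vector_derivative L) (at x within {a..b})" "a \<le> x" "x < b"
  shows "((\<lambda>t. (F (x + t) - F x) /\<^sub>R t) \<longlongrightarrow> L) (at_right 0)"
proof (rule tendstoI)
  fix e :: real assume "e > 0"
  then have "e / 2 > 0" by simp
  then obtain d where d: "d > 0" "\<And>y. y \<in> {a..b} \<Longrightarrow> norm (y - x) < d \<Longrightarrow> norm (F y - F x - (y - x) *\<^sub>R L) \<le> e / 2 * norm (y - x)"
    using assms(1) unfolding has_vector_derivative_def has_derivative_within_alt by blast
  have "dist ((F (x + t) - F x) /\<^sub>R t) L < e" if t: "0 < t" "t < min d (b - x)" for t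
  proof -
    have "norm (F (x + t) - F x - t *\<^sub>R L) \<le> e / 2 * t"
      using d(2)[of "x + t"] t assms by simp
    moreover have "(F (x + t) - F x) /\<^sub>R t - L = (F (x + t) - F x - t *\<^sub>R L) /\<^sub>R t"
      using t by (simp add: scaleR_diff_right)
    ultimately have "dist ((F (x + t) - F x) /\<^sub>R t) L \<le> inverse t * (e / 2 * t)"
      using t by (simp only: dist_norm norm_scaleR) (intro mult_mono, auto)
    then have "dist ((F (x + t) - F x) /\<^sub>R t) L \<le> e / 2"
      using t by (simp add: field_simps)
    then show ?thesis using \<open>e > 0\<close> by simp
  qed
  then show "eventually (\<lambda>t. dist ((F (x + t) - F x) /\<^sub>R t) L < e) (at_right 0)"
    using d(1) assms(3) by (auto simp: eventually_at_right intro!: exI[of _ "min d (b - x)"])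
qed

locale strongly_continuous_semigroup =
  fixes U :: "real \<Rightarrow> 'b::banach \<Rightarrow> 'b"
  assumes bounded_linear: "t \<ge> 0 \<Longrightarrow> bounded_linear (U t)"
    and zero: "U 0 x = x"
    and semigroup: "s \<ge> 0 \<Longrightarrow> t \<ge> 0 \<Longrightarrow> U s (U t x) = U (s + t) x"
    and strongly_continuous: "continuous_on {0..} (\<lambda>t. U t x)"
begin

text \<open>
  The graph of the generator, so that membership in its domain and its value are one statement.
\<close>

definition generator_at :: "'b \<Rightarrow> 'b \<Rightarrow> bool" where
  "generator_at x y \<longleftrightarrow> ((\<lambda>t. (U t x - x) /\<^sub>R t) \<longlongrightarrow> y) (at_right 0)"

lemma generator_at_commute:
  assumes B: "bounded_linear B" and comm: "\<And>t. t \<ge> 0 \<Longrightarrow> B (U t x) = U t (B x)" and gen: "generator_at x y"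
  shows "generator_at (B x) (B y)"
  unfolding generator_at_def
proof (rule Lim_transform_eventually)
  interpret B: bounded_linear B by (rule B)
  show "((\<lambda>t. B ((U t x - x) /\<^sub>R t)) \<longlongrightarrow> B y) (at_right 0)"
    using gen unfolding generator_at_def by (rule B.tendsto)
  show "eventually (\<lambda>t. B ((U t x - x) /\<^sub>R t) = (U t (B x) - B x) /\<^sub>R t) (at_right 0)"
    using eventually_at_right_less[of 0] by eventually_elim (simp add: B.scaleR B.diff comm)
qed

lemma generator_at_orbit:
  assumes "generator_at x y" "s \<ge> 0" shows "generator_at (U s x) (U s y)"
  by (rule generator_at_commute[OF bounded_linear[OF assms(2)] _ assms(1)])
    (use assms(2) in \<open>simp add: semigroup add.commute\<close>)

text \<open>
  \<open>U t\<close> shifts the interval of integration by \<open>t\<close>, so the difference quotient consists of means of the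
  orbit over the intervals of length \<open>t\<close> at \<open>h\<close> and at \<open>0\<close>.
\<close>

lemma generator_at_orbit_integral:
  assumes h: "h \<ge> 0"
  shows "generator_at (integral {0..h} (\<lambda>s. U s x)) (U h x - x)"
proof -
  define F where "F r = integral {0..r} (\<lambda>s. U s x)" for r
  have cont: "continuous_on {a..b} (\<lambda>s. U s x)" if "a \<ge> 0" for a b
    by (rule continuous_on_subset[OF strongly_continuous]) (use that in auto)
  have int: "(\<lambda>s. U s x) integrable_on {a..b}" if "a \<ge> 0" for a b
    by (rule integrable_continuous_real[OF cont[OF that]])
  have F_lim: "((\<lambda>t. (F (r + t) - F r) /\<^sub>R t) \<longlongrightarrow> U r x) (at_right 0)" if "r \<ge> 0" for r
    unfolding F_def
    by (rule has_vector_derivative_imp_right_limit[where a = 0 and b = "r + 1"],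
        rule integral_has_vector_derivative[OF cont]) (use that in auto)
  have shift: "U t (F h) = F (h + t) - F t" if t: "t \<ge> 0" for t
  proof -
    have "((\<lambda>s. U s x) has_integral integral {t..h + t} (\<lambda>s. U s x)) (cbox t (h + t))"
      using int[OF t] by (simp add: has_integral_integral)
    from has_integral_affinity[OF this, of 1 t]
    have "((\<lambda>s. U (s + t) x) has_integral integral {t..h + t} (\<lambda>s. U s x)) {0..h}"
      by (simp add: image_diff_atLeastAtMost)
    then have "((\<lambda>s. U t (U s x)) has_integral integral {t..h + t} (\<lambda>s. U s x)) {0..h}"
      by (rule has_integral_eq[rotated]) (use t in \<open>simp add: semigroup add.commute\<close>)
    moreover have "((\<lambda>s. U t (U s x)) has_integral U t (F h)) {0..h}"
      using has_integral_linear[OF integrable_integral[OF int[of 0 h]] bounded_linear[OF t]]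
      by (simp add: F_def o_def)
    ultimately have "U t (F h) = integral {t..h + t} (\<lambda>s. U s x)"
      by (rule has_integral_unique[rotated])
    moreover have "F t + integral {t..h + t} (\<lambda>s. U s x) = F (h + t)"
      unfolding F_def using t h by (intro Henstock_Kurzweil_Integration.integral_combine int) auto
    ultimately show ?thesis by (simp add: algebra_simps)
  qed
  have "F 0 = 0" by (simp add: F_def)
  have "generator_at (F h) (U h x - U 0 x)"
    unfolding generator_at_def
  proof (rule Lim_transform_eventually)
    show "((\<lambda>t. (F (h + t) - F h) /\<^sub>R t - (F (0 + t) - F 0) /\<^sub>R t) \<longlongrightarrow> U h x - U 0 x) (at_right 0)"
      by (rule tendsto_diff[OF F_lim[OF h] F_lim[OF order_refl]])
    show "eventually (\<lambda>t. (F (h + t) - F h) /\<^sub>R t - (F (0 + t) - F 0) /\<^sub>R t = (U t (F h) - F h) /\<^sub>R t) (at_right 0)"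
      using eventually_at_right_less[of 0]
      by eventually_elim (simp add: shift \<open>F 0 = 0\<close> diff_right_commute flip: scaleR_diff_right)
  qed
  then show ?thesis by (simp add: F_def zero)
qed

text \<open>
  The domain is dense: \<open>x\<close> is the limit of the means of its orbit over \<open>{0..t}\<close> for \<open>t \<rightarrow> 0\<close>.
\<close>

lemma functional_zero_on_domain:
  assumes l: "bounded_linear l" and vanish: "\<And>x y. generator_at x y \<Longrightarrow> l x = 0"
  shows "l x = (0 :: 'c::real_normed_vector)"
proof -
  interpret l: bounded_linear l by (rule l)
  define F where "F r = integral {0..r} (\<lambda>s. U s x)" for r
  have "(F has_vector_derivative U 0 x) (at 0 within {0..1})"
    unfolding F_def
    by (rule integral_has_vector_derivative[OF continuous_on_subset[OF strongly_continuous]]) auto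
  then have "((\<lambda>t. (F (0 + t) - F 0) /\<^sub>R t) \<longlongrightarrow> U 0 x) (at_right 0)"
    by (rule has_vector_derivative_imp_right_limit) auto
  then have "((\<lambda>t. l (F t /\<^sub>R t)) \<longlongrightarrow> l x) (at_right 0)"
    by (intro l.tendsto) (simp add: F_def zero)
  moreover have "eventually (\<lambda>t. l (F t /\<^sub>R t) = 0) (at_right 0)"
    using eventually_at_right_less[of 0]
    by eventually_elim (simp add: F_def l.scaleR vanish[OF generator_at_orbit_integral])
  then have "((\<lambda>t. l (F t /\<^sub>R t)) \<longlongrightarrow> 0) (at_right 0)"
    by (rule tendsto_eventually)
  ultimately show ?thesis
    by (rule tendsto_unique[OF trivial_limit_at_right_real])
qed

text \<open>
  A functional that kills the range of the generator is constant along the orbits that start in the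
  domain, and hence along all orbits.
\<close>

lemma functional_invariant:
  fixes l :: "'b \<Rightarrow> 'c::real_normed_vector"
  assumes l: "bounded_linear l" and vanish: "\<And>x y. generator_at x y \<Longrightarrow> l y = 0" and t: "t \<ge> 0"
  shows "l (U t x) = l x"
proof -
  interpret l: bounded_linear l by (rule l)
  have "l (U t x) - l x = 0"
  proof (rule functional_zero_on_domain)
    show "bounded_linear (\<lambda>x. l (U t x) - l x)"
      by (intro bounded_linear_sub bounded_linear_compose[OF l bounded_linear[OF t]] l)
    fix x y assume gen: "generator_at x y"
    have "l (U t x) = l (U 0 x)"
    proof (rule right_derivative_zero_imp_constant[OF _ _ t])
      show "continuous_on {0..} (\<lambda>t. l (U t x))"
        by (rule l.continuous_on[OF strongly_continuous])
      fix s :: real assume s: "s \<ge> 0"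
      have "((\<lambda>h. l ((U h (U s x) - U s x) /\<^sub>R h)) \<longlongrightarrow> l (U s y)) (at_right 0)"
        using generator_at_orbit[OF gen s] unfolding generator_at_def by (rule l.tendsto)
      then have lim: "((\<lambda>h. l ((U h (U s x) - U s x) /\<^sub>R h)) \<longlongrightarrow> 0) (at_right 0)"
        by (simp only: vanish[OF generator_at_orbit[OF gen s]])
      have "eventually (\<lambda>h. l ((U h (U s x) - U s x) /\<^sub>R h) = (l (U (s + h) x) - l (U s x)) /\<^sub>R h) (at_right 0)"
        using eventually_at_right_less[of 0]
        by eventually_elim (simp add: semigroup s l.scaleR l.diff add.commute)
      with lim show "((\<lambda>h. (l (U (s + h) x) - l (U s x)) /\<^sub>R h) \<longlongrightarrow> 0) (at_right 0)"
        by (rule Lim_transform_eventually)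
    qed
    then show "l (U t x) - l x = 0" by (simp add: zero)
  qed
  then show ?thesis by simp
qed

end

section \<open>Dynamical quantum systems\<close>

text \<open>
  Meaningful for maps that preserve the trace class only; elsewhere \<open>Tc\<close> is unspecified.
\<close>

definition tc_map :: "('a::complex_hilbert op \<Rightarrow> 'a op) \<Rightarrow> 'a tc \<Rightarrow> 'a tc" where
  "tc_map \<Phi> T = Tc (\<Phi> (op_of T))"

lemma op_of_tc_map: "(\<And>T. T \<in> trace_class \<Longrightarrow> \<Phi> T \<in> trace_class) \<Longrightarrow> op_of (tc_map \<Phi> T) = \<Phi> (op_of T)"
  by (simp add: tc_map_def)

lemma bounded_linear_quantum_operation:
  assumes \<Phi>: "quantum_operation \<Phi>" shows "bounded_linear (tc_map \<Phi>)"
proof (rule bounded_linear_intro[where K = 4])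
  note [simp] = op_of_tc_map[OF quantum_operation_trace_class[OF \<Phi>]]
  show "tc_map \<Phi> (S + T) = tc_map \<Phi> S + tc_map \<Phi> T" for S T
    by (simp flip: op_of_inject add: quantum_operation_add[OF \<Phi>])
  show "tc_map \<Phi> (r *\<^sub>R T) = r *\<^sub>R tc_map \<Phi> T" for r T
    by (simp flip: op_of_inject) (simp add: scaleR_eq_scaleC quantum_operation_scaleC[OF \<Phi>])
  show "norm (tc_map \<Phi> T) \<le> norm T * 4" for T
    using quantum_operation_trace_norm_le[OF \<Phi> op_of_trace_class, of T] by (simp add: norm_tc_def mult.commute)
qed

lemma bounded_linear_left_mult:
  assumes A: "A \<in> bounded_ops" shows "bounded_linear (tc_map (left_mult A))"
proof (rule bounded_linear_intro[where K = "norm A"])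
  have [simp]: "op_of (tc_map (left_mult A) T) = A o\<^sub>L op_of T" for T
    using op_of_tc_map[of "left_mult A" T] trace_class_compose_left(1)[OF A] by (simp add: left_mult_def)
  show "tc_map (left_mult A) (S + T) = tc_map (left_mult A) S + tc_map (left_mult A) T" for S T
    by (simp flip: op_of_inject add: blinfun_compose_add_right)
  show "tc_map (left_mult A) (r *\<^sub>R T) = r *\<^sub>R tc_map (left_mult A) T" for r T
    by (simp flip: op_of_inject) (simp add: scaleR_eq_scaleC blinfun_compose_scaleC_right A)
  show "norm (tc_map (left_mult A) T) \<le> norm T * norm A" for T
    using trace_norm_compose_left[OF A op_of_trace_class, of T] by (simp add: norm_tc_def mult.commute)
qed

lemma trace_norm_tendsto_iff:
  assumes f: "eventually (\<lambda>t. f t \<in> trace_class) F"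
  shows "trace_norm_tendsto f L F \<longleftrightarrow> L \<in> trace_class \<and> ((\<lambda>t. Tc (f t)) \<longlongrightarrow> Tc L) F"
proof (cases "L \<in> trace_class")
  case True
  have "((\<lambda>t. trace_norm (f t - L)) \<longlongrightarrow> 0) F \<longleftrightarrow> ((\<lambda>t. dist (Tc (f t)) (Tc L)) \<longlongrightarrow> 0) F"
    by (rule tendsto_cong) (use f in eventually_elim, simp add: dist_norm norm_tc_def True)
  then show ?thesis
    using True by (simp add: trace_norm_tendsto_def tendsto_dist_iff[symmetric])
qed (simp add: trace_norm_tendsto_def)

lemma dynamical_quantum_operation: "dynamical_quantum_system \<Psi> \<Longrightarrow> t \<ge> 0 \<Longrightarrow> quantum_operation (\<Psi> t)"
  by (simp add: dynamical_quantum_system_def)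

lemma dynamical_trace_class: "dynamical_quantum_system \<Psi> \<Longrightarrow> t \<ge> 0 \<Longrightarrow> T \<in> trace_class \<Longrightarrow> \<Psi> t T \<in> trace_class"
  by (simp add: dynamical_quantum_operation quantum_operation_trace_class)

lemma dynamical_strongly_continuous_semigroup:
  fixes \<Psi> :: "real \<Rightarrow> 'a::complex_hilbert op \<Rightarrow> 'a op"
  assumes dyn: "dynamical_quantum_system \<Psi>"
  shows "strongly_continuous_semigroup (\<lambda>t. tc_map (\<Psi> t))"
proof (rule strongly_continuous_semigroup.intro)
  fix s t :: real and T :: "'a tc"
  show "bounded_linear (tc_map (\<Psi> t))" if "t \<ge> 0"
    by (rule bounded_linear_quantum_operation[OF dynamical_quantum_operation[OF dyn that]])
  show "tc_map (\<Psi> 0) T = T"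
    using dyn by (simp add: tc_map_def dynamical_quantum_system_def)
  show "tc_map (\<Psi> s) (tc_map (\<Psi> t) T) = tc_map (\<Psi> (s + t)) T" if "s \<ge> 0" "t \<ge> 0"
    using dyn that by (simp add: tc_map_def dynamical_trace_class[OF dyn]) (simp add: dynamical_quantum_system_def)
  show "continuous_on {0..} (\<lambda>t. tc_map (\<Psi> t) T)"
    unfolding continuous_on_def
  proof
    fix t :: real assume t: "t \<in> {0..}"
    have "trace_norm_tendsto (\<lambda>s. \<Psi> s (op_of T)) (\<Psi> t (op_of T)) (at t within {0..})"
      using dyn t by (simp add: dynamical_quantum_system_def)
    moreover have "eventually (\<lambda>s. \<Psi> s (op_of T) \<in> trace_class) (at t within {0..})"
      using dynamical_trace_class[OF dyn] by (auto simp: eventually_at_filter)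
    ultimately show "((\<lambda>t. tc_map (\<Psi> t) T) \<longlongrightarrow> tc_map (\<Psi> t) T) (at t within {0..})"
      by (simp add: trace_norm_tendsto_iff tc_map_def)
  qed
qed

lemma is_generator_value_iff:
  assumes dyn: "dynamical_quantum_system \<Psi>" and T: "T \<in> trace_class"
  shows "is_generator_value \<Psi> T L \<longleftrightarrow>
    L \<in> trace_class \<and> strongly_continuous_semigroup.generator_at (\<lambda>t. tc_map (\<Psi> t)) (Tc T) (Tc L)"
proof -
  interpret strongly_continuous_semigroup "\<lambda>t. tc_map (\<Psi> t)"
    by (rule dynamical_strongly_continuous_semigroup[OF dyn])
  have pos: "eventually (\<lambda>t::real. t > 0) (at_right 0)"
    by (rule eventually_at_right_less)
  have tc: "eventually (\<lambda>t. (\<Psi> t T - T) /\<^sub>R t \<in> trace_class) (at_right 0)"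
    using pos by eventually_elim (simp add: trace_class_scaleR trace_class_diff dynamical_trace_class[OF dyn] T)
  have "((\<lambda>t. Tc ((\<Psi> t T - T) /\<^sub>R t)) \<longlongrightarrow> Tc L) (at_right 0) \<longleftrightarrow>
      ((\<lambda>t. (tc_map (\<Psi> t) (Tc T) - Tc T) /\<^sub>R t) \<longlongrightarrow> Tc L) (at_right 0)"
  proof (rule tendsto_cong)
    show "eventually (\<lambda>t. Tc ((\<Psi> t T - T) /\<^sub>R t) = (tc_map (\<Psi> t) (Tc T) - Tc T) /\<^sub>R t) (at_right 0)"
      using pos
      by eventually_elim
        (simp flip: op_of_inject add: tc_map_def T dynamical_trace_class[OF dyn] trace_class_scaleR trace_class_diff)
  qed
  then show ?thesis
    unfolding is_generator_value_def trace_norm_tendsto_iff[OF tc] generator_at_def by simp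
qed

lemma generator_eqI:
  assumes dyn: "dynamical_quantum_system \<Psi>" and T: "T \<in> trace_class" and L: "is_generator_value \<Psi> T L"
  shows "T \<in> generator_dom \<Psi>" and "generator \<Psi> T = L"
proof -
  interpret strongly_continuous_semigroup "\<lambda>t. tc_map (\<Psi> t)"
    by (rule dynamical_strongly_continuous_semigroup[OF dyn])
  show "T \<in> generator_dom \<Psi>" using T L by (auto simp: generator_dom_def)
  show "generator \<Psi> T = L"
    unfolding generator_def
  proof (rule the_equality[where P = "is_generator_value \<Psi> T", OF L])
    fix L' assume L': "is_generator_value \<Psi> T L'"
    then have "Tc L' = Tc L"
      using L unfolding is_generator_value_iff[OF dyn T] generator_at_def
      by (auto intro: tendsto_unique[OF trivial_limit_at_right_real])
    then show "L' = L"
      using L L' unfolding is_generator_value_iff[OF dyn T] by (metis op_of_Tc)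
  qed
qed

lemma generator_domD:
  assumes "dynamical_quantum_system \<Psi>" "T \<in> generator_dom \<Psi>"
  shows "T \<in> trace_class" and "is_generator_value \<Psi> T (generator \<Psi> T)"
proof -
  obtain L where L: "T \<in> trace_class" "is_generator_value \<Psi> T L"
    using assms(2) by (auto simp: generator_dom_def)
  show "T \<in> trace_class" by (rule L(1))
  show "is_generator_value \<Psi> T (generator \<Psi> T)"
    using generator_eqI(2)[OF assms(1) L] L(2) by simp
qed

lemma dual_fixed_point_iff:
  assumes \<Phi>: "quantum_operation \<Phi>" and B: "B \<in> bounded_ops"
  shows "\<Phi>\<^sup>\<sharp> B = B \<longleftrightarrow> (\<forall>T\<in>trace_class. tr (\<Phi> T o\<^sub>L B) = tr (T o\<^sub>L B))"
  using tr_dual_map[OF \<Phi> B] dual_map_eqI[OF B, of \<Phi> B] by auto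

lemma generator_value_tr_limit:
  assumes dyn: "dynamical_quantum_system \<Psi>" and T: "T \<in> trace_class" and L: "is_generator_value \<Psi> T L"
    and B: "B \<in> bounded_ops"
  shows "((\<lambda>t. (tr (\<Psi> t T o\<^sub>L B) - tr (T o\<^sub>L B)) /\<^sub>R t) \<longlongrightarrow> tr (L o\<^sub>L B)) (at_right 0)"
proof -
  interpret strongly_continuous_semigroup "\<lambda>t. tc_map (\<Psi> t)"
    by (rule dynamical_strongly_continuous_semigroup[OF dyn])
  interpret l: bounded_linear "\<lambda>T. tr (op_of T o\<^sub>L B)"
    by (rule bounded_linear_trace_pairing[OF B])
  have L_tc: "L \<in> trace_class" and gen: "generator_at (Tc T) (Tc L)"
    using L by (auto simp: is_generator_value_iff[OF dyn T])
  have "((\<lambda>t. tr (op_of ((tc_map (\<Psi> t) (Tc T) - Tc T) /\<^sub>R t) o\<^sub>L B)) \<longlongrightarrow> tr (op_of (Tc L) o\<^sub>L B)) (at_right 0)"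
    using gen unfolding generator_at_def by (rule l.tendsto)
  then have *: "((\<lambda>t. tr (op_of ((tc_map (\<Psi> t) (Tc T) - Tc T) /\<^sub>R t) o\<^sub>L B)) \<longlongrightarrow> tr (L o\<^sub>L B)) (at_right 0)"
    using L_tc by simp
  show ?thesis
  proof (rule Lim_transform_eventually[OF *])
    show "eventually (\<lambda>t. tr (op_of ((tc_map (\<Psi> t) (Tc T) - Tc T) /\<^sub>R t) o\<^sub>L B)
        = (tr (\<Psi> t T o\<^sub>L B) - tr (T o\<^sub>L B)) /\<^sub>R t) (at_right 0)"
      using eventually_at_right_less[of 0]
      by eventually_elim (simp only: l.scaleR l.diff tc_map_def op_of_Tc[OF T]
          op_of_Tc[OF dynamical_trace_class[OF dyn less_imp_le T]])
  qed
qed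

text \<open>
  Differentiate \<open>tr (\<Psi>\<^sub>t(T) B) = tr (T B)\<close> at \<open>t = 0\<close>.
\<close>

lemma generator_value_tr_eq_0:
  assumes dyn: "dynamical_quantum_system \<Psi>" and T: "T \<in> trace_class" and L: "is_generator_value \<Psi> T L"
    and B: "B \<in> bounded_ops" and fixed: "\<And>t. t \<ge> 0 \<Longrightarrow> (\<Psi> t)\<^sup>\<sharp> B = B"
  shows "tr (L o\<^sub>L B) = 0"
proof -
  have "eventually (\<lambda>t. (tr (\<Psi> t T o\<^sub>L B) - tr (T o\<^sub>L B)) /\<^sub>R t = 0) (at_right 0)"
    using eventually_at_right_less[of 0]
  proof eventually_elim
    case (elim t)
    then show ?case
      using tr_dual_map[OF dynamical_quantum_operation[OF dyn] B T, of t] fixed[of t] by simp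
  qed
  then have "((\<lambda>t. (tr (\<Psi> t T o\<^sub>L B) - tr (T o\<^sub>L B)) /\<^sub>R t) \<longlongrightarrow> 0) (at_right 0)"
    by (rule tendsto_eventually)
  then show ?thesis
    by (rule tendsto_unique[OF trivial_limit_at_right_real generator_value_tr_limit[OF dyn T L B]])
qed

text \<open>The converse of the preceding lemma, by density of the domain of the generator.\<close>

lemma dual_fixed_pointI:
  assumes dyn: "dynamical_quantum_system \<Psi>" and B: "B \<in> bounded_ops"
    and vanish: "\<And>T L. T \<in> trace_class \<Longrightarrow> is_generator_value \<Psi> T L \<Longrightarrow> tr (L o\<^sub>L B) = 0"
    and t: "t \<ge> 0"
  shows "(\<Psi> t)\<^sup>\<sharp> B = B"
proof -
  interpret strongly_continuous_semigroup "\<lambda>t. tc_map (\<Psi> t)"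
    by (rule dynamical_strongly_continuous_semigroup[OF dyn])
  have inv: "tr (op_of (tc_map (\<Psi> t) T) o\<^sub>L B) = tr (op_of T o\<^sub>L B)" for T
  proof (rule functional_invariant[OF bounded_linear_trace_pairing[OF B] _ t])
    show "tr (op_of Y o\<^sub>L B) = 0" if "generator_at X Y" for X Y
      using that by (intro vanish[of "op_of X"]) (auto simp: is_generator_value_iff[OF dyn])
  qed
  have "tr (\<Psi> t T o\<^sub>L B) = tr (T o\<^sub>L B)" if T: "T \<in> trace_class" for T
    using inv[of "Tc T"] by (simp add: tc_map_def T dynamical_trace_class[OF dyn t])
  then show ?thesis
    by (simp add: dual_fixed_point_iff[OF dynamical_quantum_operation[OF dyn t] B])
qed

subsection \<open>The equivalences\<close>

text \<open>
  By cyclicity of the trace the transpose of \<open>L\<^sub>A\<close> is \<open>R\<^sub>A\<close>, so the transposes of \<open>\<Phi> L\<^sub>A\<close> and \<open>L\<^sub>A \<Phi>\<close> are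
  \<open>R\<^sub>A \<Phi>\<^sup>\<sharp>\<close> and \<open>\<Phi>\<^sup>\<sharp> R\<^sub>A\<close>; the pairing separates points.
\<close>

lemma left_mult_commutes_iff_right_mult_commutes:
  assumes \<Phi>: "quantum_operation \<Phi>" and A: "A \<in> bounded_ops"
  shows "(\<forall>T\<in>trace_class. commutator (left_mult A) \<Phi> T = 0) \<longleftrightarrow>
    (\<forall>S\<in>bounded_ops. commutator (right_mult A) (\<Phi>\<^sup>\<sharp>) S = 0)"
proof -
  have pairing: "tr (\<Phi> (A o\<^sub>L T) o\<^sub>L S) = tr (T o\<^sub>L (\<Phi>\<^sup>\<sharp> S o\<^sub>L A))"
    "tr ((A o\<^sub>L \<Phi> T) o\<^sub>L S) = tr (T o\<^sub>L \<Phi>\<^sup>\<sharp> (S o\<^sub>L A))" if T: "T \<in> trace_class" and S: "S \<in> bounded_ops" for T S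
  proof -
    have S': "\<Phi>\<^sup>\<sharp> S \<in> bounded_ops" by (rule dual_map_bounded_ops[OF \<Phi> S])
    have "tr (\<Phi> (A o\<^sub>L T) o\<^sub>L S) = tr (A o\<^sub>L (T o\<^sub>L \<Phi>\<^sup>\<sharp> S))"
      by (simp add: tr_dual_map[OF \<Phi> S] trace_class_compose_left A T blinfun_compose_assoc)
    also have "\<dots> = tr ((T o\<^sub>L \<Phi>\<^sup>\<sharp> S) o\<^sub>L A)"
      by (rule tr_commute[OF trace_class_compose_right[OF S' T] A, symmetric])
    finally show "tr (\<Phi> (A o\<^sub>L T) o\<^sub>L S) = tr (T o\<^sub>L (\<Phi>\<^sup>\<sharp> S o\<^sub>L A))"
      by (simp add: blinfun_compose_assoc)
    have \<Phi>T: "\<Phi> T \<in> trace_class" by (rule quantum_operation_trace_class[OF \<Phi> T])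
    have "tr ((A o\<^sub>L \<Phi> T) o\<^sub>L S) = tr ((\<Phi> T o\<^sub>L S) o\<^sub>L A)"
      using tr_commute[OF trace_class_compose_right[OF S \<Phi>T] A] by (simp add: blinfun_compose_assoc)
    then show "tr ((A o\<^sub>L \<Phi> T) o\<^sub>L S) = tr (T o\<^sub>L \<Phi>\<^sup>\<sharp> (S o\<^sub>L A))"
      using tr_dual_map[OF \<Phi> compose_bounded_ops[OF S A] T] by (simp add: blinfun_compose_assoc)
  qed
  have "(\<forall>T\<in>trace_class. A o\<^sub>L \<Phi> T = \<Phi> (A o\<^sub>L T)) \<longleftrightarrow>
      (\<forall>T\<in>trace_class. \<forall>S\<in>bounded_ops. tr ((A o\<^sub>L \<Phi> T) o\<^sub>L S) = tr (\<Phi> (A o\<^sub>L T) o\<^sub>L S))"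
    using A by (auto intro!: trace_class_eqI intro: trace_class_compose_left quantum_operation_trace_class[OF \<Phi>])
  also have "\<dots> \<longleftrightarrow> (\<forall>S\<in>bounded_ops. \<forall>T\<in>trace_class. tr (T o\<^sub>L (\<Phi>\<^sup>\<sharp> S o\<^sub>L A)) = tr (T o\<^sub>L \<Phi>\<^sup>\<sharp> (S o\<^sub>L A)))"
    using pairing by auto
  also have "\<dots> \<longleftrightarrow> (\<forall>S\<in>bounded_ops. \<Phi>\<^sup>\<sharp> S o\<^sub>L A = \<Phi>\<^sup>\<sharp> (S o\<^sub>L A))"
    using A by (auto intro!: bounded_ops_eqI intro: dual_map_bounded_ops[OF \<Phi>])
  finally show ?thesis
    by (simp add: commutator_def left_mult_def right_mult_def)
qed

lemma right_mult_commutes_iff_dual_fixed_points: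
  assumes \<Phi>: "quantum_operation \<Phi>" and A: "A \<in> bounded_ops"
  shows "(\<forall>S\<in>bounded_ops. commutator (right_mult A) (\<Phi>\<^sup>\<sharp>) S = 0) \<longleftrightarrow>
    \<Phi>\<^sup>\<sharp> A = A \<and> \<Phi>\<^sup>\<sharp> (adj A o\<^sub>L A) = adj A o\<^sub>L A"
proof
  assume "\<forall>S\<in>bounded_ops. commutator (right_mult A) (\<Phi>\<^sup>\<sharp>) S = 0"
  then have comm: "\<Phi>\<^sup>\<sharp> (S o\<^sub>L A) = \<Phi>\<^sup>\<sharp> S o\<^sub>L A" if "S \<in> bounded_ops" for S
    using that by (simp add: commutator_def right_mult_def)
  have fixA: "\<Phi>\<^sup>\<sharp> A = A"
    using comm[OF id_bounded_ops] by (simp add: dual_map_id[OF \<Phi>])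
  then show "\<Phi>\<^sup>\<sharp> A = A \<and> \<Phi>\<^sup>\<sharp> (adj A o\<^sub>L A) = adj A o\<^sub>L A"
    using comm[OF adj_bounded_ops[OF A]] by (simp add: dual_map_adj[OF \<Phi> A])
next
  assume "\<Phi>\<^sup>\<sharp> A = A \<and> \<Phi>\<^sup>\<sharp> (adj A o\<^sub>L A) = adj A o\<^sub>L A"
  then show "\<forall>S\<in>bounded_ops. commutator (right_mult A) (\<Phi>\<^sup>\<sharp>) S = 0"
    using dual_map_multiplicative[OF \<Phi> A] by (simp add: commutator_def right_mult_def)
qed

text \<open>
  The density operators \<open>rank_one u u\<close> recover the quadratic form of \<open>\<Psi>\<^sub>t\<^sup>\<sharp> B\<close>.
\<close>

lemma is_constant_iff_dual_fixed_point:
  assumes dyn: "dynamical_quantum_system \<Psi>" and B: "B \<in> bounded_ops"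
  shows "is_constant \<Psi> B \<longleftrightarrow> (\<forall>t\<ge>0. (\<Psi> t)\<^sup>\<sharp> B = B)"
proof
  assume const: "is_constant \<Psi> B"
  show "\<forall>t\<ge>0. (\<Psi> t)\<^sup>\<sharp> B = B"
  proof (intro allI impI)
    fix t :: real assume t: "t \<ge> 0"
    show "(\<Psi> t)\<^sup>\<sharp> B = B"
    proof (rule op_eqI_quadratic)
      note qo = dynamical_quantum_operation[OF dyn t]
      show ops: "(\<Psi> t)\<^sup>\<sharp> B \<in> bounded_ops" by (rule dual_map_bounded_ops[OF qo B])
      fix x
      show "cinner x ((\<Psi> t)\<^sup>\<sharp> B x) = cinner x (B x)"
      proof (cases "x = 0")
        case False
        define u where "u = x /\<^sub>R norm x"
        have x: "x = norm x *\<^sub>R u" and "norm u = 1" using False by (simp_all add: u_def)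
        then have "density_op (rank_one u u)"
          by (simp add: density_op_def positive_rank_one cinner_self)
        then have "tr (\<Psi> t (rank_one u u) o\<^sub>L B) = tr (\<Psi> 0 (rank_one u u) o\<^sub>L B)"
          using const t unfolding is_constant_def by blast
        also have "\<Psi> 0 (rank_one u u) = rank_one u u"
          using dyn by (simp add: dynamical_quantum_system_def)
        finally have "cinner u ((\<Psi> t)\<^sup>\<sharp> B u) = cinner u (B u)"
          by (simp add: cinner_dual_map[OF qo B] tr_rank_one_compose[OF B])
        then show ?thesis
          by (subst (1 2 3 4) x) (simp add: blinfun.scaleR_right)
      qed simp
    qed (rule B)
  qed
next
  assume fixed: "\<forall>t\<ge>0. (\<Psi> t)\<^sup>\<sharp> B = B"
  have "tr (\<Psi> t \<rho> o\<^sub>L B) = tr (\<rho> o\<^sub>L B)" if "t \<ge> 0" "density_op \<rho>" for t \<rho>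
    using that fixed tr_dual_map[OF dynamical_quantum_operation[OF dyn that(1)] B, of \<rho>]
    by (simp add: density_op_def)
  then show "is_constant \<Psi> B"
    using B by (simp add: is_constant_def)
qed

lemma dual_generator_value_unique:
  assumes "is_dual_generator_value \<Psi> S L" "is_dual_generator_value \<Psi> S L'"
  shows "L = L'"
proof (rule bounded_ops_eqI)
  show "L \<in> bounded_ops" "L' \<in> bounded_ops"
    using assms by (simp_all add: is_dual_generator_value_def weak_star_tendsto_def)
  show "tr (T o\<^sub>L L) = tr (T o\<^sub>L L')" if "T \<in> trace_class" for T
    using assms that unfolding is_dual_generator_value_def weak_star_tendsto_def
    by (blast intro: tendsto_unique[OF trivial_limit_at_right_real])
qed

lemma dual_generator_ker_iff:
  assumes "B \<in> bounded_ops"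
  shows "B \<in> dual_generator_ker \<Psi> \<longleftrightarrow> is_dual_generator_value \<Psi> B 0"
proof
  assume B: "B \<in> dual_generator_ker \<Psi>"
  then obtain L where L: "is_dual_generator_value \<Psi> B L"
    by (auto simp: dual_generator_ker_def dual_generator_dom_def)
  have "dual_generator \<Psi> B = L"
    unfolding dual_generator_def by (rule the_equality[where P = "is_dual_generator_value \<Psi> B", OF L dual_generator_value_unique[OF _ L]])
  then show "is_dual_generator_value \<Psi> B 0"
    using B L by (simp add: dual_generator_ker_def)
next
  assume 0: "is_dual_generator_value \<Psi> B 0"
  have "dual_generator \<Psi> B = 0"
    unfolding dual_generator_def by (rule the_equality[where P = "is_dual_generator_value \<Psi> B", OF 0 dual_generator_value_unique[OF _ 0]])
  then show "B \<in> dual_generator_ker \<Psi>"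
    using 0 assms by (auto simp: dual_generator_ker_def dual_generator_dom_def)
qed

text \<open>
  The difference quotients of \<open>\<Psi>\<^sub>t\<^sup>\<sharp> B\<close> paired with \<open>T\<close> are those of \<open>\<Psi>\<^sub>t(T)\<close> paired with \<open>B\<close>, so for \<open>T\<close> in
  the domain of the generator, with value \<open>L\<close>, the weak* limit \<open>0\<close> means \<open>tr (L B) = 0\<close>.
\<close>

lemma dual_generator_ker_iff_dual_fixed_point:
  fixes \<Psi> :: "real \<Rightarrow> 'a::complex_hilbert op \<Rightarrow> 'a op"
  assumes dyn: "dynamical_quantum_system \<Psi>" and B: "B \<in> bounded_ops"
  shows "B \<in> dual_generator_ker \<Psi> \<longleftrightarrow> (\<forall>t\<ge>0. (\<Psi> t)\<^sup>\<sharp> B = B)"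
  unfolding dual_generator_ker_iff[OF B]
proof
  assume fixed: "\<forall>t\<ge>0. (\<Psi> t)\<^sup>\<sharp> B = B"
  show "is_dual_generator_value \<Psi> B 0"
    unfolding is_dual_generator_value_def weak_star_tendsto_def
  proof (intro conjI ballI)
    fix T :: "'a op"
    have "eventually (\<lambda>t. tr (T o\<^sub>L (((\<Psi> t)\<^sup>\<sharp> B - B) /\<^sub>R t)) = tr (T o\<^sub>L 0)) (at_right 0)"
      using eventually_at_right_less[of 0] by eventually_elim (simp add: fixed)
    then show "((\<lambda>t. tr (T o\<^sub>L (((\<Psi> t)\<^sup>\<sharp> B - B) /\<^sub>R t))) \<longlongrightarrow> tr (T o\<^sub>L 0)) (at_right 0)"
      by (rule tendsto_eventually)
  qed auto
next
  assume "is_dual_generator_value \<Psi> B 0"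
  then have lim: "((\<lambda>t. tr (T o\<^sub>L (((\<Psi> t)\<^sup>\<sharp> B - B) /\<^sub>R t))) \<longlongrightarrow> tr (T o\<^sub>L 0)) (at_right 0)"
    if "T \<in> trace_class" for T
    using that by (simp add: is_dual_generator_value_def weak_star_tendsto_def)
  show "\<forall>t\<ge>0. (\<Psi> t)\<^sup>\<sharp> B = B"
  proof (intro allI impI dual_fixed_pointI[OF dyn B])
    fix T L assume T: "T \<in> trace_class" and L: "is_generator_value \<Psi> T L"
    have "((\<lambda>t. tr (T o\<^sub>L (((\<Psi> t)\<^sup>\<sharp> B - B) /\<^sub>R t))) \<longlongrightarrow> tr (L o\<^sub>L B)) (at_right 0)"
    proof (rule Lim_transform_eventually[OF generator_value_tr_limit[OF dyn T L B]])
      show "eventually (\<lambda>t. (tr (\<Psi> t T o\<^sub>L B) - tr (T o\<^sub>L B)) /\<^sub>R t = tr (T o\<^sub>L (((\<Psi> t)\<^sup>\<sharp> B - B) /\<^sub>R t))) (at_right 0)"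
        using eventually_at_right_less[of 0]
      proof eventually_elim
        case (elim t)
        note qo = dynamical_quantum_operation[OF dyn less_imp_le[OF elim]]
        have D: "(\<Psi> t)\<^sup>\<sharp> B \<in> bounded_ops" by (rule dual_map_bounded_ops[OF qo B])
        have "T o\<^sub>L (((\<Psi> t)\<^sup>\<sharp> B - B) /\<^sub>R t) = ((T o\<^sub>L (\<Psi> t)\<^sup>\<sharp> B) - (T o\<^sub>L B)) /\<^sub>R t"
          by (rule blinfun_eqI) (simp add: blinfun.scaleR_left blinfun.scaleR_right blinfun.diff_left blinfun.diff_right)
        then show ?case
          by (simp add: tr_scaleR tr_diff trace_class_diff trace_class_compose_right T D B tr_dual_map[OF qo B T]
              scaleR_conv_of_real)
      qed
    qed
    then have "tr (L o\<^sub>L B) = tr (T o\<^sub>L 0)"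
      using lim[OF T] by (rule tendsto_unique[OF trivial_limit_at_right_real])
    also have "T o\<^sub>L 0 = 0" by (rule blinfun_eqI) simp
    finally show "tr (L o\<^sub>L B) = 0" by simp
  qed
qed

lemma left_mult_commutes_generator:
  assumes dyn: "dynamical_quantum_system \<Psi>" and A: "A \<in> bounded_ops"
    and comm: "\<forall>t\<ge>0. \<forall>T\<in>trace_class. commutator (left_mult A) (\<Psi> t) T = 0"
    and T: "T \<in> generator_dom \<Psi>"
  shows "is_generator_value \<Psi> (left_mult A T) (left_mult A (generator \<Psi> T))"
proof -
  interpret strongly_continuous_semigroup "\<lambda>t. tc_map (\<Psi> t)"
    by (rule dynamical_strongly_continuous_semigroup[OF dyn])
  note T_tc = generator_domD(1)[OF dyn T]
  have AT: "left_mult A X \<in> trace_class" if "X \<in> trace_class" for X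
    using trace_class_compose_left(1)[OF A that] by (simp add: left_mult_def)
  have L: "generator \<Psi> T \<in> trace_class" "generator_at (Tc T) (Tc (generator \<Psi> T))"
    using generator_domD(2)[OF dyn T] by (auto simp: is_generator_value_iff[OF dyn T_tc])
  have "generator_at (tc_map (left_mult A) (Tc T)) (tc_map (left_mult A) (Tc (generator \<Psi> T)))"
  proof (rule generator_at_commute[OF bounded_linear_left_mult[OF A] _ L(2)])
    show "tc_map (left_mult A) (tc_map (\<Psi> t) (Tc T)) = tc_map (\<Psi> t) (tc_map (left_mult A) (Tc T))" if "t \<ge> 0" for t
      using comm that T_tc by (simp add: tc_map_def AT dynamical_trace_class[OF dyn] commutator_def)
  qed
  then show ?thesis
    using L(1) T_tc by (simp add: is_generator_value_iff[OF dyn] AT tc_map_def)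
qed

text \<open>
  The traces of \<open>A L = \<psi> (A T)\<close> vanish because \<open>\<Psi>\<close> preserves traces, so \<open>A\<close> is fixed, and with it
  \<open>A\<^sup>*\<close>. Then \<open>tr (L A\<^sup>* A) = tr (\<psi> (A T) A\<^sup>*)\<close> vanishes because \<open>A\<^sup>*\<close> is fixed.
\<close>

lemma generator_commutes_imp_dual_fixed_points:
  assumes dyn: "dynamical_quantum_system \<Psi>" and A: "A \<in> bounded_ops"
    and comm: "\<And>T L. T \<in> trace_class \<Longrightarrow> is_generator_value \<Psi> T L \<Longrightarrow> is_generator_value \<Psi> (A o\<^sub>L T) (A o\<^sub>L L)"
    and t: "t \<ge> 0"
  shows "(\<Psi> t)\<^sup>\<sharp> A = A \<and> (\<Psi> t)\<^sup>\<sharp> (adj A o\<^sub>L A) = adj A o\<^sub>L A"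
proof -
  have L_tc: "L \<in> trace_class" if "is_generator_value \<Psi> T L" for T L
    using that by (simp add: is_generator_value_def trace_norm_tendsto_def)
  have zero: "tr ((A o\<^sub>L L) o\<^sub>L B) = 0"
    if T: "T \<in> trace_class" and L: "is_generator_value \<Psi> T L" and B: "B \<in> bounded_ops"
      and fixed: "\<And>s. s \<ge> 0 \<Longrightarrow> (\<Psi> s)\<^sup>\<sharp> B = B" for T L B
    by (rule generator_value_tr_eq_0[OF dyn trace_class_compose_left(1)[OF A T] comm[OF T L] B fixed])
  have fixA: "(\<Psi> s)\<^sup>\<sharp> A = A" if s: "s \<ge> 0" for s
  proof (rule dual_fixed_pointI[OF dyn A _ s])
    fix T L assume TL: "T \<in> trace_class" "is_generator_value \<Psi> T L"
    have "tr (A o\<^sub>L L) = 0"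
      using zero[OF TL id_bounded_ops] by (simp add: dual_map_id dynamical_quantum_operation[OF dyn])
    then show "tr (L o\<^sub>L A) = 0"
      by (simp add: tr_commute[OF L_tc[OF TL(2)] A])
  qed
  have fix_adj: "(\<Psi> s)\<^sup>\<sharp> (adj A) = adj A" if s: "s \<ge> 0" for s
    by (simp add: dual_map_adj[OF dynamical_quantum_operation[OF dyn s] A] fixA[OF s])
  have "(\<Psi> t)\<^sup>\<sharp> (adj A o\<^sub>L A) = adj A o\<^sub>L A"
  proof (rule dual_fixed_pointI[OF dyn _ _ t])
    fix T L assume TL: "T \<in> trace_class" "is_generator_value \<Psi> T L"
    have "tr (L o\<^sub>L (adj A o\<^sub>L A)) = tr ((A o\<^sub>L L) o\<^sub>L adj A)"
      using tr_commute[OF trace_class_compose_right[OF adj_bounded_ops[OF A] L_tc[OF TL(2)]] A]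
      by (simp add: blinfun_compose_assoc)
    also have "\<dots> = 0"
      by (rule zero[OF TL adj_bounded_ops[OF A] fix_adj])
    finally show "tr (L o\<^sub>L (adj A o\<^sub>L A)) = 0" .
  qed (use A in auto)
  then show ?thesis using fixA[OF t] by simp
qed

lemma all_equivalentI:
  assumes "a \<longleftrightarrow> d" "b \<longleftrightarrow> d" "c \<longleftrightarrow> d" "e \<longleftrightarrow> d" "f \<longleftrightarrow> d"
  shows "all_equivalent [a, b, c, d, e, f]"
  using assms by (simp add: all_equivalent_def)

theorem theorem5p6:
  fixes \<Psi> :: "real \<Rightarrow> 'a::complex_hilbert op \<Rightarrow> 'a op" and A :: "'a op"
  assumes "dynamical_quantum_system \<Psi>" and "A \<in> bounded_ops"
  shows "all_equivalent
    [ \<forall>t\<ge>0. \<forall>T\<in>trace_class. commutator (left_mult A) (\<Psi> t) T = 0,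
      is_constant \<Psi> A \<and> is_constant \<Psi> (adj A o\<^sub>L A),
      \<forall>t\<ge>0. \<forall>S\<in>bounded_ops. commutator (right_mult A) ((\<Psi> t)\<^sup>\<sharp>) S = 0,
      \<forall>t\<ge>0. (\<Psi> t)\<^sup>\<sharp> A = A \<and> (\<Psi> t)\<^sup>\<sharp> (adj A o\<^sub>L A) = adj A o\<^sub>L A,
      left_mult A ` generator_dom \<Psi> \<subseteq> generator_dom \<Psi> \<and>
        (\<forall>T\<in>generator_dom \<Psi>. left_mult A (generator \<Psi> T) = generator \<Psi> (left_mult A T)),
      A \<in> dual_generator_ker \<Psi> \<and> adj A o\<^sub>L A \<in> dual_generator_ker \<Psi> ]"
    (is "all_equivalent [?i, ?ii, ?iii, ?iv, ?v, ?vi]")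
proof -
  note dyn = assms(1) and A = assms(2)
  have AA: "adj A o\<^sub>L A \<in> bounded_ops" using A by auto
  have i_iii: "?i \<longleftrightarrow> ?iii"
    by (simp add: left_mult_commutes_iff_right_mult_commutes[OF dynamical_quantum_operation[OF dyn] A])
  have iii_iv: "?iii \<longleftrightarrow> ?iv"
    by (simp add: right_mult_commutes_iff_dual_fixed_points[OF dynamical_quantum_operation[OF dyn] A])
  have ii_iv: "?ii \<longleftrightarrow> ?iv"
    unfolding is_constant_iff_dual_fixed_point[OF dyn A] is_constant_iff_dual_fixed_point[OF dyn AA] by auto
  have vi_iv: "?vi \<longleftrightarrow> ?iv"
    unfolding dual_generator_ker_iff_dual_fixed_point[OF dyn A] dual_generator_ker_iff_dual_fixed_point[OF dyn AA] by auto
  have i_v: "?v" if ?i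
  proof -
    have AT: "left_mult A T \<in> trace_class" if "T \<in> generator_dom \<Psi>" for T
      using trace_class_compose_left(1)[OF A generator_domD(1)[OF dyn that]] by (simp add: left_mult_def)
    show ?v
      using generator_eqI[OF dyn AT left_mult_commutes_generator[OF dyn A \<open>?i\<close>]] by auto
  qed
  have v_iv: "?iv" if v: ?v
  proof (intro allI impI generator_commutes_imp_dual_fixed_points[OF dyn A])
    fix T L assume TL: "T \<in> trace_class" "is_generator_value \<Psi> T L"
    have T: "T \<in> generator_dom \<Psi>" "generator \<Psi> T = L"
      by (rule generator_eqI[OF dyn TL])+
    then have "left_mult A T \<in> generator_dom \<Psi>" "generator \<Psi> (left_mult A T) = left_mult A L"
      using v by auto
    then show "is_generator_value \<Psi> (A o\<^sub>L T) (A o\<^sub>L L)"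
      using generator_domD(2)[OF dyn, of "left_mult A T"] by (simp add: left_mult_def)
  qed
  have v_iff_iv: "?v \<longleftrightarrow> ?iv"
    by (rule iffI[OF v_iv i_v[OF iffD2[OF trans[OF i_iii iii_iv]]]])
  show ?thesis
    by (rule all_equivalentI[OF trans[OF i_iii iii_iv] ii_iv iii_iv v_iff_iv vi_iv])
qed

end
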